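(* Consider the quadratic Gaussian setting described in the context, with $\limsup_n\|\Sigma_n\|<\infty$. Let $\{\phi_n\}_{n=1}^\infty$ be a sequence of estimators $\phi_n:(\mathbb R^n,\frac1{\sqrt n}\|\cdot\|_2)\to(\Theta,\rho)$ with $\mathbb E[\rho^2(\theta,\phi_n(Z^n))]<\infty$ whose Lipschitz constants are uniformly bounded in $n$. For each $n$ let $P_{Z^n|Y^n}$ be a $D_y$-admissible code of rate $R_n$ from $\mathbb R^n$ to $\mathbb R^n$, and suppose that $R_n\to R(D_y)$, that for almost every $y^n$, $P_{Z^n|Y^n=y^n}$ is absolutely continuous with respect to $P_{Z^{*n}|Y^n=y^n}$, and that $\lim_{n\to\infty}\frac1nD(P_{Z^n}\,\|\,P_{Z^{*n}})=0$. Then $$\lim_{n\to\infty}\Big|D^{\mathsf{CE}}_{\phi_n}-D^*_{\phi_n}(R(D_y))\Big|=0,$$ where $D^{\mathsf{CE}}_{\phi_n}=\mathbb E[\rho^2(\theta,\phi_n(Z^n))]$ and $D^*_{\phi_n}(R(D_y))=\mathbb E[\rho^2(\theta,\phi_n(Z^{*n}))]$.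
   Context: All logarithms are to base 2; $D(\cdot\|\cdot)$ is relative entropy, $I(\cdot;\cdot)$ mutual information, $\|\Sigma\|$ the operator norm. Quadratic Gaussian setting: $(\Theta,\rho)$ is a Polish metric space (which may depend on $n$), $\theta\in\Theta$ is the latent signal, and the data satisfy $Y^n\sim\mathcal N(\mu^n,\Sigma_n)$ with known $\mu^n\in\mathbb R^n$ and $\Sigma_n$ an $n\times n$ positive definite matrix. For almost every $\theta$ the process $\{Y_n\}$ is stationary ergodic given $\theta$. The reproduction space is $\mathbb R^n$ with metric $\nu(u,v)=\frac1{\sqrt n}\|u-v\|_2$, and the distortion is $d(y^n,z^n)=\|y^n-z^n\|_2^2$. $D_y$ is a fixed distortion level for which Assumption A-RD holds for every $n$. Rate-distortion function: $\mathcal R_{Y^n}(D_y)=\min I(Y^n;Z^n)$ over kernels $P_{Z^n|Y^n}$ with $\mathbb E[d(Y^n,Z^n)]\le nD_y$; $R(D_y)=\inf_n\frac1n\mathcal R_{Y^n}(D_y)=\lim_n\frac1n\mathcal R_{Y^n}(D_y)$. Assumption A-RD: the minimum defining $\mathcal R_{Y^n}(D_y)$ is achieved by a unique kernel $P_{Z^{*n}|Y^n}$, which satisfies $\mathbb E[d(Y^n,Z^{*n})]=nD_y$. $P_{Z^{*n}}$ denotes the marginal of $Z^{*n}$. Code: an $n$-block code of rate $R_n=\frac1n\log M_n$ is a pair of (possibly random, with randomness independent of $(\theta,Y^n)$) maps $f_{\rm enc}:\mathbb R^n\to\{1,\dots,M_n\}$, $f_{\rm dec}:\{1,\dots,M_n\}\to\mathbb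 R^n$ with $Z^n=f_{\rm dec}(f_{\rm enc}(Y^n))$ measurable; it is identified with the induced kernel $P_{Z^n|Y^n}$, with output marginal $P_{Z^n}$. It is $D_y$-admissible if $\mathbb E[d(Y^n,Z^n)]\le nD_y$. Expectations are under $P_{\theta Y^n}P_{Z^n|Y^n}$ and $P_{\theta Y^n}P_{Z^{*n}|Y^n}$ (Markov chains $\theta\to Y^n\to Z^n$, $\theta\to Y^n\to Z^{*n}$); a deterministic $\theta$ corresponds to a point mass.
   Formalization: Besides E[ρ²(θ,φ_n(Z^n))]<∞ for each n, it is also assumed that limsup_n E[ρ²(θ,φ_n(Z^n))]<∞; without this the claim fails (θ=0, φ_n=c_n+g_n with g_n bounded Lipschitz and constants c_n growing fast). *)

theory Defs
  imports
    "HOL-Probability.Probability"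
    "Jordan_Normal_Form.Gauss_Jordan_Elimination"
    "Jordan_Normal_Form.Determinant"
begin

section \<open>Blocks and distances\<close>

text \<open>Points of n-dimensional space are extensional functions on \<open>{..<n}\<close>; the n-block of a
  process consists of its first n coordinates, which are indexed from 0.\<close>

definition Rn :: "nat \<Rightarrow> (nat \<Rightarrow> real) measure" where
  "Rn n = (\<Pi>\<^sub>M i\<in>{..<n}. borel)"

definition block :: "(nat \<Rightarrow> 'w \<Rightarrow> real) \<Rightarrow> nat \<Rightarrow> 'w \<Rightarrow> (nat \<Rightarrow> real)" where
  "block Y n = (\<lambda>\<omega>. \<lambda>i\<in>{..<n}. Y i \<omega>)"

definition distortion :: "nat \<Rightarrow> (nat \<Rightarrow> real) \<Rightarrow> (nat \<Rightarrow> real) \<Rightarrow> real" where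
  "distortion n y z = (L2_set (\<lambda>i. y i - z i) {..<n})\<^sup>2"

definition ndist :: "nat \<Rightarrow> (nat \<Rightarrow> real) \<Rightarrow> (nat \<Rightarrow> real) \<Rightarrow> real" where
  "ndist n u v = L2_set (\<lambda>i. u i - v i) {..<n} / sqrt (real n)"

definition polish_metric :: "'t metric \<Rightarrow> bool" where
  "polish_metric T \<longleftrightarrow> mcomplete_of T \<and> separable_space (mtopology_of T)"

definition metric_borel :: "'t metric \<Rightarrow> 't measure" where
  "metric_borel T = sigma (mspace T) {U. openin (mtopology_of T) U}"


section \<open>The Gaussian law\<close>

definition pos_def_mat :: "nat \<Rightarrow> real mat \<Rightarrow> bool" where
  "pos_def_mat n S \<longleftrightarrow> S \<in> carrier_mat n n \<and> transpose_mat S = S \<and>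
     (\<forall>v\<in>carrier_vec n. v \<noteq> 0\<^sub>v n \<longrightarrow> 0 < scalar_prod v (S *\<^sub>v v))"

definition mat_opnorm :: "real mat \<Rightarrow> real" where
  "mat_opnorm S = (SUP v\<in>{v \<in> carrier_vec (dim_col S). scalar_prod v v \<le> 1}.
     sqrt (scalar_prod (S *\<^sub>v v) (S *\<^sub>v v)))"

text \<open>The Lebesgue density of the nondegenerate normal law with mean \<open>m\<close> and covariance \<open>S\<close>.
  Its use of \<open>the\<close> is harmless for positive definite \<open>S\<close>, which is invertible.\<close>

definition gauss_density :: "nat \<Rightarrow> real vec \<Rightarrow> real mat \<Rightarrow> (nat \<Rightarrow> real) \<Rightarrow> real" where
  "gauss_density n m S y =
     exp (- scalar_prod (vec n y - m) (the (mat_inverse S) *\<^sub>v (vec n y - m)) / 2)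
       / sqrt ((2 * pi) ^ n * det S)"

definition gaussian :: "'w measure \<Rightarrow> nat \<Rightarrow> ('w \<Rightarrow> (nat \<Rightarrow> real)) \<Rightarrow> real vec \<Rightarrow> real mat \<Rightarrow> bool" where
  "gaussian P n X m S \<longleftrightarrow>
     distributed P (\<Pi>\<^sub>M i\<in>{..<n}. lborel) X (\<lambda>y. ennreal (gauss_density n m S y))"


section \<open>Kernels, relative entropy and mutual information\<close>

definition kernels :: "'a measure \<Rightarrow> 'b measure \<Rightarrow> ('a \<Rightarrow> 'b measure) set" where
  "kernels M N = measurable M (prob_algebra N)"

text \<open>The law of \<open>(X, Z)\<close> where \<open>X\<close> has law \<open>Q\<close> and \<open>Z\<close> has conditional law \<open>K x\<close> given
  \<open>X = x\<close>.\<close>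

definition joint_law :: "'a measure \<Rightarrow> ('a \<Rightarrow> 'b measure) \<Rightarrow> 'b measure \<Rightarrow> ('a \<times> 'b) measure" where
  "joint_law Q K N = Q \<bind> (\<lambda>x. distr (K x) (Q \<Otimes>\<^sub>M N) (\<lambda>z. (x, z)))"

text \<open>\<open>relative_entropy P Q\<close> is $D(P \| Q)$ in bits, for probability measures. The library's
  real-valued \<open>KL_divergence 2 Q P\<close> takes its arguments in the opposite order and has no value
  \<open>\<infinity>\<close>. Since the negative part of the log-density is always integrable with respect to \<open>P\<close>,
  failure of integrability means that the divergence is infinite.\<close>

definition relative_entropy :: "'a measure \<Rightarrow> 'a measure \<Rightarrow> ennreal" where
  "relative_entropy P Q =
     (if absolutely_continuous Q P \<and> integrable P (entropy_density 2 Q P)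
      then ennreal (KL_divergence 2 Q P) else \<infinity>)"

definition kernel_information :: "'a measure \<Rightarrow> ('a \<Rightarrow> 'b measure) \<Rightarrow> 'b measure \<Rightarrow> ennreal" where
  "kernel_information Q K N = relative_entropy (joint_law Q K N) (Q \<Otimes>\<^sub>M (Q \<bind> K))"


section \<open>Rate-distortion theory\<close>

definition admissible :: "nat \<Rightarrow> (nat \<Rightarrow> real) measure \<Rightarrow> real \<Rightarrow>
    ((nat \<Rightarrow> real) \<Rightarrow> (nat \<Rightarrow> real) measure) \<Rightarrow> bool" where
  "admissible n PY D K \<longleftrightarrow> K \<in> kernels (Rn n) (Rn n) \<and>
     integrable (joint_law PY K (Rn n)) (\<lambda>(y, z). distortion n y z) \<and>
     (\<integral>(y, z). distortion n y z \<partial>joint_law PY K (Rn n)) \<le> real n * D"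

definition block_rdf :: "nat \<Rightarrow> (nat \<Rightarrow> real) measure \<Rightarrow> real \<Rightarrow> ennreal" where
  "block_rdf n PY D = (INF K\<in>{K. admissible n PY D K}. kernel_information PY K (Rn n))"

definition rate_distortion :: "(nat \<Rightarrow> (nat \<Rightarrow> real) measure) \<Rightarrow> real \<Rightarrow> ennreal" where
  "rate_distortion PY D = (INF n\<in>{1..}. block_rdf n (PY n) D / of_nat n)"

text \<open>\<open>K\<close> is the minimizer provided by Assumption A-RD; kernels are identified when they agree
  for almost every input.\<close>

definition unique_optimal_kernel :: "nat \<Rightarrow> (nat \<Rightarrow> real) measure \<Rightarrow> real \<Rightarrow>
    ((nat \<Rightarrow> real) \<Rightarrow> (nat \<Rightarrow> real) measure) \<Rightarrow> bool" where
  "unique_optimal_kernel n PY D K \<longleftrightarrow>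
     admissible n PY D K \<and>
     kernel_information PY K (Rn n) = block_rdf n PY D \<and>
     (\<forall>K'. admissible n PY D K' \<and> kernel_information PY K' (Rn n) = block_rdf n PY D \<longrightarrow>
        (AE y in PY. K' y = K y)) \<and>
     (\<integral>(y, z). distortion n y z \<partial>joint_law PY K (Rn n)) = real n * D"

text \<open>The randomness of a code is a point of the probability space \<open>S\<close>, available to both the
  encoder and the decoder; private randomness is the case of a product space.\<close>

definition random_code :: "nat \<Rightarrow> nat \<Rightarrow> 's measure \<Rightarrow> ('s \<Rightarrow> (nat \<Rightarrow> real) \<Rightarrow> nat) \<Rightarrow>
    ('s \<Rightarrow> nat \<Rightarrow> (nat \<Rightarrow> real)) \<Rightarrow> bool" where
  "random_code n M S enc dec \<longleftrightarrow>
     prob_space S \<and>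
     (\<forall>s\<in>space S. \<forall>y\<in>space (Rn n). enc s y \<in> {1..M}) \<and>
     (\<forall>s\<in>space S. \<forall>m\<in>{1..M}. dec s m \<in> space (Rn n)) \<and>
     (\<lambda>(s, y). dec s (enc s y)) \<in> measurable (S \<Otimes>\<^sub>M Rn n) (Rn n)"

definition code_kernel :: "nat \<Rightarrow> 's measure \<Rightarrow> ('s \<Rightarrow> (nat \<Rightarrow> real) \<Rightarrow> nat) \<Rightarrow>
    ('s \<Rightarrow> nat \<Rightarrow> (nat \<Rightarrow> real)) \<Rightarrow> (nat \<Rightarrow> real) \<Rightarrow> (nat \<Rightarrow> real) measure" where
  "code_kernel n S enc dec y = distr S (Rn n) (\<lambda>s. dec s (enc s y))"

definition code_rate :: "nat \<Rightarrow> nat \<Rightarrow> real" where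
  "code_rate n M = log 2 (real M) / real n"


section \<open>Conditional ergodicity and estimation risk\<close>

definition seqM :: "(nat \<Rightarrow> real) measure" where
  "seqM = (\<Pi>\<^sub>M i\<in>UNIV. borel)"

definition shift_seq :: "(nat \<Rightarrow> real) \<Rightarrow> (nat \<Rightarrow> real)" where
  "shift_seq x = (\<lambda>i. x (Suc i))"

definition stationary_ergodic :: "(nat \<Rightarrow> real) measure \<Rightarrow> bool" where
  "stationary_ergodic Q \<longleftrightarrow>
     distr Q seqM shift_seq = Q \<and>
     (\<forall>A\<in>sets seqM. shift_seq -` A = A \<longrightarrow> measure Q A = 0 \<or> measure Q A = 1)"

text \<open>\<open>\<kappa>\<close> is a regular conditional law of the process given \<open>th\<close>; it exists and is unique up to
  null sets, because the process takes values in a standard Borel space.\<close>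

definition cond_stationary_ergodic ::
    "'w measure \<Rightarrow> 't measure \<Rightarrow> ('w \<Rightarrow> 't) \<Rightarrow> (nat \<Rightarrow> 'w \<Rightarrow> real) \<Rightarrow> bool" where
  "cond_stationary_ergodic P B th Y \<longleftrightarrow>
     (\<exists>\<kappa>\<in>kernels B seqM.
        distr P (B \<Otimes>\<^sub>M seqM) (\<lambda>\<omega>. (th \<omega>, \<lambda>i. Y i \<omega>)) = joint_law (distr P B th) \<kappa> seqM \<and>
        (AE t in distr P B th. stationary_ergodic (\<kappa> t)))"

text \<open>The mean of \<open>\<rho>\<^sup>2(\<theta>, \<phi>(Z))\<close>, where \<open>(\<theta>, Y)\<close> has law \<open>Q\<close> and \<open>\<theta>\<close>, \<open>Y\<close>, \<open>Z\<close> is a Markov chain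
  with kernel \<open>K\<close> from \<open>Y\<close> to \<open>Z\<close>.\<close>

definition risk :: "'t metric \<Rightarrow> nat \<Rightarrow> ('t \<times> (nat \<Rightarrow> real)) measure \<Rightarrow>
    ((nat \<Rightarrow> real) \<Rightarrow> (nat \<Rightarrow> real) measure) \<Rightarrow> ((nat \<Rightarrow> real) \<Rightarrow> 't) \<Rightarrow> ennreal" where
  "risk T n Q K \<phi> =
     (\<integral>\<^sup>+ ((t, y), z). ennreal ((mdist T t (\<phi> z))\<^sup>2) \<partial>joint_law Q (\<lambda>(t, y). K y) (Rn n))"

definition signal_block_law :: "'w measure \<Rightarrow> 't metric \<Rightarrow> ('w \<Rightarrow> 't) \<Rightarrow> (nat \<Rightarrow> 'w \<Rightarrow> real) \<Rightarrow> nat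
    \<Rightarrow> ('t \<times> (nat \<Rightarrow> real)) measure" where
  "signal_block_law P T th Y n =
     distr P (metric_borel T \<Otimes>\<^sub>M Rn n) (\<lambda>\<omega>. (th \<omega>, block Y n \<omega>))"

definition block_law :: "'w measure \<Rightarrow> (nat \<Rightarrow> 'w \<Rightarrow> real) \<Rightarrow> nat \<Rightarrow> (nat \<Rightarrow> real) measure" where
  "block_law P Y n = distr P (Rn n) (block Y n)"

end

theory Submission
  imports Defs
begin

text \<open>Fix \<open>n\<close> and rotate coordinates so that the covariance is diagonal with eigenvalues \<open>l\<close>. By
  uniqueness, the optimal kernel is the one given by reverse water-filling at a level \<open>w\<close>, and
  the logarithm of the density of its joint law is
  \<open>\<Phi>(y, z) = R - |y - z|\<^sup>2 / (2 w) + q(y)\<close>. The function \<open>\<Phi>\<close> satisfies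
  \<open>\<integral> exp \<Phi>(y, z) P\<^sub>Y(dy) \<le> 1\<close> for all \<open>z\<close>, and its mean under every admissible joint law is at
  least \<open>R\<close>, the value of the rate-distortion function in nats.

  Given \<open>(\<theta>, Y)\<close>, draw \<open>Z'\<close> from the optimal kernel, independently of the code output \<open>Z\<close>. For every
  \<open>F \<ge> 0\<close>, two applications of \<open>ln x \<le> x - 1\<close> bound the mean of \<open>F\<close> along the code by
  \<open>ln M - R + D(P\<^sub>Z || P\<^sub>Z\<^sub>*)\<close> plus the logarithm of the mean of \<open>exp F\<close> along the optimal kernel. Take
  \<open>F = c n (\<rho>(\<theta>, \<phi>(Z)) - \<rho>(\<theta>, \<phi>(Z')))\<^sup>2\<close>. The optimal kernel is Gaussian with covariance bounded by
  that of the data, so dimension-free Gaussian concentration for Lipschitz functions bounds the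
  last term by a constant. Hence the mean square of the difference vanishes after division by \<open>n\<close>.\<close>

section \<open>Gaussian concentration for Lipschitz functions\<close>

text \<open>The obstacle is that the loss is only known to have a finite mean, so it need not have
  exponential moments. The difference of the losses at two reconstructions does:
  \<open>\<theta>\<close> and \<open>Y\<close> are common to both, the distance to
  \<open>\<theta>\<close> is Lipschitz in the estimate, and given \<open>\<theta>\<close> and
  \<open>Y\<close> the Gaussian noise of the optimal kernel is all that remains random there. The
  metric on blocks carries \<open>1 / sqrt n\<close>, so a Lipschitz function of that noise has
  deviations of order \<open>1 / sqrt n\<close>. This is the origin of the factor \<open>n\<close>
  in \<open>F\<close>; it means that an information cost of order o(n) can be afforded, and the
  hypotheses on the rate and on the output divergence provide exactly that. For fixed
  \<open>z\<close>, let I(z) be the mean of \<open>exp (\<Phi> + F)\<close> over the source. It is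
  the normaliser in the first logarithm and the numerator in the second, so it cancels, and no
  regularity of the code is required beyond its number of codewords. Closeness in mean square gives
  closeness of the risks because the risk of the code stays bounded, which controls the cross
  term.\<close>

lemma nn_integral_layer_cake:
  fixes p :: "real \<Rightarrow> real"
  assumes [measurable]: "p \<in> borel_measurable borel"
  shows "(\<integral>\<^sup>+x. ennreal (p x) \<partial>lborel) =
    (\<integral>\<^sup>+t. emeasure lborel {x. t < p x} * indicator {0<..} t \<partial>lborel)"
proof -
  \<comment> \<open>Where \<open>p\<close> is negative, \<open>ennreal\<close> truncates to 0 and
    the interval is empty.\<close>
  have 1: "ennreal (p x) = (\<integral>\<^sup>+t. indicator {0<..<p x} t \<partial>lborel)" for x
    by (cases "0 \<le> p x") (auto simp: ennreal_neg)
  have "(\<integral>\<^sup>+x. ennreal (p x) \<partial>lborel)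
      = (\<integral>\<^sup>+x. \<integral>\<^sup>+t. indicator {z. 0 < snd z \<and> snd z < p (fst z)} (x, t) \<partial>lborel \<partial>lborel)"
    unfolding 1 by (intro nn_integral_cong) (auto split: split_indicator)
  also have "\<dots> = (\<integral>\<^sup>+t. \<integral>\<^sup>+x. indicator {z. 0 < snd z \<and> snd z < p (fst z)} (x, t) \<partial>lborel \<partial>lborel)"
  proof (rule lborel_pair.Fubini'[symmetric])
    have "{z \<in> space (borel \<Otimes>\<^sub>M borel). 0 < snd z \<and> snd z < p (fst z)} \<in> sets (borel \<Otimes>\<^sub>M borel)"
      by measurable
    then have "{z. 0 < snd z \<and> snd z < p (fst z)} \<in> sets (lborel \<Otimes>\<^sub>M lborel)"
      by (simp add: space_pair_measure)
    then show "(\<lambda>(x, t). indicator {z. 0 < snd z \<and> snd z < p (fst z)} (x, t) :: ennreal)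
        \<in> borel_measurable (lborel \<Otimes>\<^sub>M lborel)"
      by (simp add: split_def)
  qed
  also have "\<dots> = (\<integral>\<^sup>+t. emeasure lborel {x. t < p x} * indicator {0<..} t \<partial>lborel)"
  proof (intro nn_integral_cong)
    fix t :: real
    have "(\<integral>\<^sup>+x. indicator {z. 0 < snd z \<and> snd z < p (fst z)} (x, t) \<partial>lborel)
      = (\<integral>\<^sup>+x. indicator {x. t < p x} x * indicator {0<..} t \<partial>lborel)"
      by (intro nn_integral_cong) (auto split: split_indicator)
    also have "\<dots> = emeasure lborel {x. t < p x} * indicator {0<..} t"
      by (subst nn_integral_multc) auto
    finally show "(\<integral>\<^sup>+x. indicator {z. 0 < snd z \<and> snd z < p (fst z)} (x, t) \<partial>lborel)
      = emeasure lborel {x. t < p x} * indicator {0<..} t" .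
  qed
  finally show ?thesis .
qed

text \<open>Superlevel sets of the Gaussian density are intervals, so the one-dimensional Brunn--Minkowski
  inequality is only needed in this form, where it follows by comparing infima and suprema.\<close>

lemma emeasure_level_sets_le:
  fixes A B :: "real set"
  assumes ne: "A \<noteq> {}" "B \<noteq> {}" and [measurable]: "A \<in> sets borel" "B \<in> sets borel"
    and mid: "\<And>x y. x \<in> A \<Longrightarrow> y \<in> B \<Longrightarrow> \<bar>(x + y) / 2\<bar> < r"
  shows "emeasure lborel A + emeasure lborel B \<le> 2 * emeasure lborel {-r<..<r}"
proof -
  obtain x0 y0 where x0: "x0 \<in> A" and y0: "y0 \<in> B" using ne by blast
  have b: "- 2 * r < x + y \<and> x + y < 2 * r" if "x \<in> A" "y \<in> B" for x y
    using mid[OF that] by (auto simp: abs_less_iff)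
  have bA: "bdd_above A" "bdd_below A"
    using b[OF _ y0] by (auto intro!: bdd_aboveI[of _ "2 * r - y0"] bdd_belowI[of _ "- 2 * r - y0"]) (smt (verit))+
  have A: "A \<subseteq> {Inf A..Sup A}" using bA by (auto intro: cInf_lower cSup_upper)
  have AA: "Inf A \<le> Sup A" using A x0 by force
  \<comment> \<open>Each point of \<open>B\<close> bounds all of \<open>A\<close> from both sides.
    Whatever \<open>Inf A\<close> and \<open>Sup A\<close> are, the two enclosing intervals have
    total length \<open>4 * r\<close>.\<close>
  have B: "B \<subseteq> {-2*r - Inf A..2*r - Sup A}"
  proof
    fix y assume y: "y \<in> B"
    have "Sup A \<le> 2 * r - y" using b[OF _ y] by (intro cSup_least ne) (auto simp: less_imp_le algebra_simps)
    moreover have "- 2 * r - y \<le> Inf A" using b[OF _ y] by (intro cInf_greatest ne) (auto simp: less_imp_le algebra_simps)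
    ultimately show "y \<in> {-2*r - Inf A..2*r - Sup A}" by auto
  qed
  have BB: "-2*r - Inf A \<le> 2*r - Sup A" using B y0 by force
  have r: "0 < r" using mid[OF x0 y0] by auto
  have "emeasure lborel A + emeasure lborel B \<le>
      emeasure lborel {Inf A..Sup A} + emeasure lborel {-2*r - Inf A..2*r - Sup A}"
    using A B by (intro add_mono emeasure_mono) auto
  also have "\<dots> = ennreal (4 * r)"
    using AA BB r by (simp add: ennreal_plus[symmetric] del: ennreal_plus)
  also have "\<dots> = 2 * emeasure lborel {-r<..<r}"
  proof -
    have "2 * emeasure lborel {-r<..<r} = ennreal 2 * ennreal (2 * r)" using r by simp
    also have "\<dots> = ennreal (4 * r)" by (subst ennreal_mult[symmetric]) (use r in auto)
    finally show ?thesis ..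
  qed
  finally show ?thesis .
qed

text \<open>Levels are compared one at a time. Since \<open>p\<close> and \<open>q\<close> both have
  supremum 1, their superlevel sets are nonempty for the same positive levels, and \<open>pq\<close>
  puts all midpoints into the superlevel interval of the Gaussian function. Equal suprema are what
  allows the sum of the integrals on the left, which is stronger than a bound on their
  product.\<close>

lemma Prekopa_Leindler_gaussian_sum:
  fixes p q :: "real \<Rightarrow> real"
  assumes [measurable]: "p \<in> borel_measurable borel" "q \<in> borel_measurable borel"
    and p: "\<And>x. p x \<le> 1" "\<And>t. t < 1 \<Longrightarrow> \<exists>x. t < p x"
    and q: "\<And>x. q x \<le> 1" "\<And>t. t < 1 \<Longrightarrow> \<exists>x. t < q x"
    and C: "0 < C"
    and pq: "\<And>x y. p x * q y \<le> (C * exp (- ((x + y) / 2)\<^sup>2 / 2))\<^sup>2"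
  shows "(\<integral>\<^sup>+x. ennreal (p x) \<partial>lborel) + (\<integral>\<^sup>+x. ennreal (q x) \<partial>lborel)
    \<le> 2 * (\<integral>\<^sup>+x. ennreal (C * exp (- x\<^sup>2 / 2)) \<partial>lborel)"
proof -
  have *: "(emeasure lborel {x. t < p x} + emeasure lborel {x. t < q x}) * indicator {0<..} t
    \<le> 2 * (emeasure lborel {x. t < C * exp (- x\<^sup>2 / 2)} * indicator {0<..} t)" for t
  proof (cases "0 < t \<and> t < 1")
    case False
    then have "{x. t < p x} = {}" "{x. t < q x} = {}" if "t > 0"
      using p(1) q(1) that by (auto simp: not_less intro: order_trans)
    then show ?thesis by (auto split: split_indicator)
  next
    case True
    \<comment> \<open>The radius of the interval on which the Gaussian function exceeds
      \<open>t\<close>.\<close>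
    define r where "r = sqrt (2 * ln (C / t))"
    have mid: "t < C * exp (- ((x + y) / 2)\<^sup>2 / 2)" if "t < p x" "t < q y" for x y
    proof (rule power_less_imp_less_base)
      have "t\<^sup>2 < p x * q y"
        using that True unfolding power2_eq_square by (intro mult_strict_mono) auto
      also note pq
      finally show "t\<^sup>2 < (C * exp (- ((x + y) / 2)\<^sup>2 / 2))\<^sup>2" .
    qed (use C in simp)
    obtain x y where xy: "t < p x" "t < q y" using p(2)[of t] q(2)[of t] True by auto
    have "C * exp (- ((x + y) / 2)\<^sup>2 / 2) \<le> C * 1"
      using C by (intro mult_left_mono) auto
    then have tC: "t < C" using mid[OF xy] by simp
    have lev: "t < C * exp (- z\<^sup>2 / 2) \<longleftrightarrow> \<bar>z\<bar> < r" for z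
    proof -
      have "t < C * exp (- z\<^sup>2 / 2) \<longleftrightarrow> exp (z\<^sup>2 / 2) < C / t"
        using True by (simp add: exp_minus field_simps)
      also have "\<dots> \<longleftrightarrow> z\<^sup>2 / 2 < ln (C / t)"
        using True C by (metis divide_pos_pos exp_less_cancel_iff exp_ln)
      also have "\<dots> \<longleftrightarrow> \<bar>z\<bar>\<^sup>2 < 2 * ln (C / t)" by auto
      also have "\<dots> \<longleftrightarrow> \<bar>z\<bar> < r"
        unfolding r_def by (simp add: real_less_rsqrt real_sqrt_less_iff flip: real_sqrt_abs)
      finally show ?thesis .
    qed
    have "emeasure lborel {x. t < p x} + emeasure lborel {x. t < q x} \<le> 2 * emeasure lborel {-r<..<r}"
    proof (rule emeasure_level_sets_le)
      fix x y assume "x \<in> {x. t < p x}" "y \<in> {x. t < q x}"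
      then show "\<bar>(x + y) / 2\<bar> < r" using mid[of x y] lev by auto
    qed (use xy in auto)
    also have "{-r<..<r} = {x. t < C * exp (- x\<^sup>2 / 2)}" unfolding lev by auto
    finally show ?thesis using True by simp
  qed
  have "(\<integral>\<^sup>+x. ennreal (p x) \<partial>lborel) + (\<integral>\<^sup>+x. ennreal (q x) \<partial>lborel) =
    (\<integral>\<^sup>+t. (emeasure lborel {x. t < p x} + emeasure lborel {x. t < q x}) * indicator {0<..} t \<partial>lborel)"
    by (simp add: nn_integral_layer_cake nn_integral_add distrib_right)
  also have "\<dots> \<le> (\<integral>\<^sup>+t. 2 * (emeasure lborel {x. t < C * exp (- x\<^sup>2 / 2)} * indicator {0<..} t) \<partial>lborel)"
    by (intro nn_integral_mono *)
  also have "\<dots> = 2 * (\<integral>\<^sup>+x. ennreal (C * exp (- x\<^sup>2 / 2)) \<partial>lborel)"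
    by (subst nn_integral_cmult) (simp_all add: nn_integral_layer_cake)
  finally show ?thesis .
qed

section \<open>The standard Gaussian law and property (tau)\<close>

lemma nn_integral_normal_density: "0 < \<sigma> \<Longrightarrow> (\<integral>\<^sup>+x. ennreal (normal_density \<mu> \<sigma> x) \<partial>lborel) = 1"
  using integral_normal_density[of \<sigma> \<mu>] integrable_normal_density[of \<sigma> \<mu>]
  by (subst nn_integral_eq_integral) auto

definition std_gauss :: "real measure" where
  "std_gauss = density lborel (\<lambda>x. ennreal (std_normal_density x))"

lemma sets_std_gauss[measurable_cong, simp]: "sets std_gauss = sets borel"
  by (simp add: std_gauss_def)

lemma space_std_gauss[simp]: "space std_gauss = UNIV"
  by (simp add: std_gauss_def)

lemma prob_space_std_gauss: "prob_space std_gauss"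
  unfolding std_gauss_def by (rule prob_space_normal_density) simp

interpretation std_gauss: prob_space std_gauss by (rule prob_space_std_gauss)

lemma nn_integral_std_gauss:
  "f \<in> borel_measurable borel \<Longrightarrow>
    (\<integral>\<^sup>+x. f x \<partial>std_gauss) = (\<integral>\<^sup>+x. ennreal (std_normal_density x) * f x \<partial>lborel)"
  unfolding std_gauss_def by (subst nn_integral_density) auto

lemma nn_integral_exp_std_gauss: "(\<integral>\<^sup>+x. ennreal (exp (t * x)) \<partial>std_gauss) = ennreal (exp (t\<^sup>2 / 2))"
proof -
  have "std_normal_density x * exp (t * x) = exp (t\<^sup>2 / 2) * normal_density t 1 x" for x
    by (simp add: normal_density_def exp_add[symmetric] power2_eq_square field_simps)
  then have "(\<integral>\<^sup>+x. ennreal (exp (t * x)) \<partial>std_gauss)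
      = (\<integral>\<^sup>+x. ennreal (exp (t\<^sup>2 / 2)) * ennreal (normal_density t 1 x) \<partial>lborel)"
    by (subst nn_integral_std_gauss) (auto simp flip: ennreal_mult)
  also have "\<dots> = ennreal (exp (t\<^sup>2 / 2))"
    by (subst nn_integral_cmult) (auto simp: nn_integral_normal_density)
  finally show ?thesis .
qed

lemma nn_integral_exp_square_std_gauss:
  "(\<integral>\<^sup>+x. ennreal (exp (x\<^sup>2 / 4)) \<partial>std_gauss) = ennreal (sqrt 2)"
proof -
  have "std_normal_density x * exp (x\<^sup>2 / 4) = sqrt 2 * normal_density 0 (sqrt 2) x" for x
    by (simp add: normal_density_def exp_add[symmetric] real_sqrt_mult power2_eq_square field_simps)
  then have "(\<integral>\<^sup>+x. ennreal (exp (x\<^sup>2 / 4)) \<partial>std_gauss)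
      = (\<integral>\<^sup>+x. ennreal (sqrt 2) * ennreal (normal_density 0 (sqrt 2) x) \<partial>lborel)"
    by (subst nn_integral_std_gauss) (auto simp flip: ennreal_mult)
  also have "\<dots> = ennreal (sqrt 2)"
    by (subst nn_integral_cmult) (auto simp: nn_integral_normal_density)
  finally show ?thesis .
qed

text \<open>Maurey's property (tau) of the Gaussian law with quadratic cost, in two-function form.
  After multiplication by the Gaussian weights, \<open>uv\<close> becomes a Prekopa--Leindler
  condition, because \<open>x\<^sup>2 / 2 + y\<^sup>2 / 2 - (x - y)\<^sup>2 / 4 = (x + y)\<^sup>2 /
  4\<close>.\<close>

lemma std_gauss_property_tau:
  fixes u v :: "real \<Rightarrow> ennreal"
  assumes [measurable]: "u \<in> borel_measurable borel" "v \<in> borel_measurable borel"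
    and uv: "\<And>x y. u x * v y \<le> ennreal (exp ((x - y)\<^sup>2 / 4))"
  shows "(\<integral>\<^sup>+x. u x \<partial>std_gauss) * (\<integral>\<^sup>+x. v x \<partial>std_gauss) \<le> 1"
proof (cases "(\<forall>x. u x = 0) \<or> (\<forall>x. v x = 0)")
  case True
  then show ?thesis by auto
next
  case False
  then obtain x0 y0 where x0: "u x0 \<noteq> 0" and y0: "v y0 \<noteq> 0" by auto
  \<comment> \<open>In \<open>ennreal\<close> the product of 0 and infinity is 0, so finiteness of
    one function needs a point where the other is nonzero; this is why the identically vanishing
    case was split off.\<close>
  have fin: "u x < \<infinity>" "v x < \<infinity>" for x
  proof -
    have "u x * v y0 \<noteq> \<infinity>" "u x0 * v x \<noteq> \<infinity>"
      using uv[of x y0] uv[of x0 x] by (auto simp: top_unique)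
    then show "u x < \<infinity>" "v x < \<infinity>"
      using x0 y0 by (auto simp: ennreal_mult_eq_top_iff less_top)
  qed
  define F where "F x = enn2real (u x) * exp (- x\<^sup>2 / 2)" for x
  define G where "G x = enn2real (v x) * exp (- x\<^sup>2 / 2)" for x
  have [measurable]: "F \<in> borel_measurable borel" "G \<in> borel_measurable borel"
    unfolding F_def G_def by auto
  have FG: "F x * G y \<le> (exp (- ((x + y) / 2)\<^sup>2 / 2))\<^sup>2" for x y
  proof -
    have "enn2real (u x) * enn2real (v y) \<le> exp ((x - y)\<^sup>2 / 4)"
      using uv[of x y] by (metis enn2real_mult enn2real_leI exp_ge_zero)
    then have "F x * G y \<le> exp ((x - y)\<^sup>2 / 4) * (exp (- x\<^sup>2 / 2) * exp (- y\<^sup>2 / 2))"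
      unfolding F_def G_def by (simp add: mult.commute mult.left_commute mult_right_mono mult_left_mono)
    also have "\<dots> = (exp (- ((x + y) / 2)\<^sup>2 / 2))\<^sup>2"
      by (simp add: exp_add[symmetric] exp_of_nat_mult[symmetric] power2_eq_square field_simps)
    finally show ?thesis .
  qed
  have F0: "0 \<le> F x" "0 \<le> G x" for x by (auto simp: F_def G_def)
  have Fx0: "0 < F x0" and Gy0: "0 < G y0"
    using x0 y0 fin by (auto simp: F_def G_def enn2real_positive_iff zero_less_iff_neq_zero)
  have bF: "bdd_above (range F)"
  proof (rule bdd_aboveI)
    fix z assume "z \<in> range F"
    then obtain x where z: "z = F x" by auto
    have "F x * G y0 \<le> 1" using FG[of x y0] by (rule order_trans) (simp add: power_le_one)
    then show "z \<le> 1 / G y0" using Gy0 z by (simp add: field_simps)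
  qed
  have bG: "bdd_above (range G)"
  proof (rule bdd_aboveI)
    fix z assume "z \<in> range G"
    then obtain x where z: "z = G x" by auto
    have "F x0 * G x \<le> 1" using FG[of x0 x] by (rule order_trans) (simp add: power_le_one)
    then show "z \<le> 1 / F x0" using Fx0 z by (simp add: field_simps)
  qed
  define a where "a = (SUP x. F x)"
  define b where "b = (SUP x. G x)"
  have Fa: "F x \<le> a" and Gb: "G x \<le> b" for x
    unfolding a_def b_def using bF bG by (auto intro: cSUP_upper)
  have a: "0 < a" and b: "0 < b" using Fa[of x0] Gb[of y0] Fx0 Gy0 by auto
  \<comment> \<open>Dividing \<open>F\<close> and \<open>G\<close> by their suprema divides the
    right side of \<open>FG\<close> by \<open>a * b\<close>, which is the factor
    \<open>C\<^sup>2\<close>.\<close>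
  define C where "C = 1 / sqrt (a * b)"
  have C: "0 < C" "C\<^sup>2 * (a * b) = 1" using a b by (auto simp: C_def power_divide)
  define p where "p x = F x / a" for x
  define q where "q x = G x / b" for x
  have [measurable]: "p \<in> borel_measurable borel" "q \<in> borel_measurable borel"
    unfolding p_def q_def by auto
  let ?p = "(\<integral>\<^sup>+x. ennreal (p x) \<partial>lborel)"
  let ?q = "(\<integral>\<^sup>+x. ennreal (q x) \<partial>lborel)"
  let ?N = "(\<integral>\<^sup>+x. ennreal (C * exp (- x\<^sup>2 / 2)) \<partial>lborel)"
  have PL: "?p + ?q
    \<le> 2 * ?N"
  proof (rule Prekopa_Leindler_gaussian_sum)
    fix t :: real assume "t < 1"
    then have "t * a < a" "t * b < b" using a b by auto
    then show "\<exists>x. t < p x" "\<exists>x. t < q x"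
      using less_cSUP_iff[OF _ bF, of "t * a"] less_cSUP_iff[OF _ bG, of "t * b"] a b
      by (auto simp: a_def[symmetric] b_def[symmetric] p_def q_def field_simps)
  next
    fix x y
    have "p x * q y = F x * G y * C\<^sup>2"
      using C(2) a b by (simp add: p_def q_def field_simps)
    also have "\<dots> \<le> (exp (- ((x + y) / 2)\<^sup>2 / 2))\<^sup>2 * C\<^sup>2"
      by (intro mult_right_mono FG) simp
    finally show "p x * q y \<le> (C * exp (- ((x + y) / 2)\<^sup>2 / 2))\<^sup>2"
      by (simp add: power_mult_distrib mult.commute)
  qed (use C Fa Gb a b in \<open>auto simp: p_def q_def\<close>)
  define N where "N = C * sqrt (2 * pi)"
  have N: "?N = ennreal N"
  proof -
    have *: "ennreal (C * exp (- x\<^sup>2 / 2)) = ennreal N * ennreal (std_normal_density x)" for x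
      using C by (subst ennreal_mult[symmetric]) (auto simp: N_def std_normal_density_def)
    have "?N
        = (\<integral>\<^sup>+x. ennreal N * ennreal (std_normal_density x) \<partial>lborel)"
      unfolding * ..
    then show ?thesis by (simp add: nn_integral_cmult nn_integral_normal_density)
  qed
  have "?p + ?q < \<infinity>"
    using PL unfolding N by (rule le_less_trans) (simp add: ennreal_mult_less_top)
  then have "?p < \<infinity>" "?q < \<infinity>"
    by auto
  then obtain i j where i: "?p = ennreal i" "0 \<le> i"
    and j: "?q = ennreal j" "0 \<le> j"
    by (metis ennreal_cases less_irrefl infinity_ennreal_def)
  have "ennreal (i + j) \<le> ennreal (2 * N)"
    using PL i j C unfolding N by (simp add: ennreal_mult N_def)
  then have ij: "i + j \<le> 2 * N"
    using C by (subst (asm) ennreal_le_iff) (auto simp: N_def)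
  \<comment> \<open>The inequality of arithmetic and geometric means turns the bound on the sum into
    one on the product.\<close>
  have "i * j \<le> ((i + j) / 2)\<^sup>2"
    using zero_le_power2[of "i - j"] by (simp add: power2_eq_square field_simps)
  also have "\<dots> \<le> N\<^sup>2" using ij i j by (intro power_mono) auto
  finally have ijN: "i * j \<le> N\<^sup>2" .
  have U: "(\<integral>\<^sup>+x. u x \<partial>std_gauss) = ennreal (a / sqrt (2 * pi) * i)"
  proof -
    have "ennreal (std_normal_density x) * u x = ennreal (a / sqrt (2 * pi)) * ennreal (p x)" for x
    proof -
      have "ennreal (std_normal_density x) * u x = ennreal (std_normal_density x * enn2real (u x))"
        using fin by (simp add: ennreal_mult)
      also have "std_normal_density x * enn2real (u x) = a / sqrt (2 * pi) * p x"
        using a by (simp add: p_def F_def std_normal_density_def)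
      also have "ennreal (a / sqrt (2 * pi) * p x) = ennreal (a / sqrt (2 * pi)) * ennreal (p x)"
        by (rule ennreal_mult) (use a F0 in \<open>auto simp: p_def\<close>)
      finally show ?thesis .
    qed
    then show ?thesis using i a
      by (simp add: nn_integral_std_gauss nn_integral_cmult ennreal_mult[symmetric])
  qed
  have V: "(\<integral>\<^sup>+x. v x \<partial>std_gauss) = ennreal (b / sqrt (2 * pi) * j)"
  proof -
    have "ennreal (std_normal_density x) * v x = ennreal (b / sqrt (2 * pi)) * ennreal (q x)" for x
    proof -
      have "ennreal (std_normal_density x) * v x = ennreal (std_normal_density x * enn2real (v x))"
        using fin by (simp add: ennreal_mult)
      also have "std_normal_density x * enn2real (v x) = b / sqrt (2 * pi) * q x"
        using b by (simp add: q_def G_def std_normal_density_def)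
      also have "ennreal (b / sqrt (2 * pi) * q x) = ennreal (b / sqrt (2 * pi)) * ennreal (q x)"
        by (rule ennreal_mult) (use b F0 in \<open>auto simp: q_def\<close>)
      finally show ?thesis .
    qed
    then show ?thesis using j b
      by (simp add: nn_integral_std_gauss nn_integral_cmult ennreal_mult[symmetric])
  qed
  have "a / sqrt (2 * pi) * i * (b / sqrt (2 * pi) * j) = a * b * (i * j) / (2 * pi)"
    by (simp add: field_simps)
  also have "\<dots> \<le> a * b * N\<^sup>2 / (2 * pi)"
    using ijN a b by (intro divide_right_mono mult_left_mono) auto
  also have "\<dots> = 1" using C by (simp add: N_def power_mult_distrib field_simps)
  finally show ?thesis
    unfolding U V using a b i j by (subst ennreal_mult[symmetric]) auto
qed

definition std_gauss_n :: "nat \<Rightarrow> (nat \<Rightarrow> real) measure" where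
  "std_gauss_n n = (\<Pi>\<^sub>M i\<in>{..<n}. std_gauss)"

interpretation std_gauss_prod: product_sigma_finite "\<lambda>_::nat. std_gauss"
  by unfold_locales

text \<open>Property (tau) tensorises without loss. With the new coordinate frozen at
  \<open>y\<close> and \<open>y'\<close>, the induction hypothesis bounds the product of the partial
  integrals \<open>U y\<close> and \<open>V y'\<close> by the cost of moving that coordinate, which
  is the hypothesis of the one-dimensional case.\<close>

lemma PiM_std_gauss_property_tau:
  fixes u v :: "(nat \<Rightarrow> real) \<Rightarrow> ennreal"
  assumes "finite I" "u \<in> borel_measurable (PiM I (\<lambda>_. borel))" "v \<in> borel_measurable (PiM I (\<lambda>_. borel))"
    and "\<And>x y. x \<in> space (PiM I (\<lambda>_. borel :: real measure)) \<Longrightarrow> y \<in> space (PiM I (\<lambda>_. borel :: real measure)) \<Longrightarrow>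
      u x * v y \<le> ennreal (exp ((\<Sum>i\<in>I. (x i - y i)\<^sup>2) / 4))"
  shows "(\<integral>\<^sup>+x. u x \<partial>PiM I (\<lambda>_. std_gauss)) * (\<integral>\<^sup>+x. v x \<partial>PiM I (\<lambda>_. std_gauss)) \<le> 1"
  using assms
proof (induction I arbitrary: u v rule: finite_induct)
  case empty
  then show ?case by (simp add: std_gauss_prod.nn_integral_empty space_PiM)
next
  case (insert i I)
  note [measurable] = insert.prems(1,2)
  have sg: "sets (PiM J (\<lambda>_. std_gauss)) = sets (PiM J (\<lambda>_. borel))" for J :: "nat set"
    by (intro sets_PiM_cong) auto
  note [measurable_cong] = sg
  interpret I: finite_product_sigma_finite "\<lambda>_. std_gauss" I by standard fact
  define U where "U y = (\<integral>\<^sup>+x. u (x(i := y)) \<partial>PiM I (\<lambda>_. std_gauss))" for y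
  define V where "V y = (\<integral>\<^sup>+x. v (x(i := y)) \<partial>PiM I (\<lambda>_. std_gauss))" for y
  have [measurable]: "U \<in> borel_measurable borel" "V \<in> borel_measurable borel"
    unfolding U_def V_def by measurable
  have "(\<integral>\<^sup>+x. u x \<partial>PiM (insert i I) (\<lambda>_. std_gauss)) = (\<integral>\<^sup>+y. U y \<partial>std_gauss)"
    unfolding U_def by (rule std_gauss_prod.product_nn_integral_insert_rev) (use insert in measurable)
  moreover have "(\<integral>\<^sup>+x. v x \<partial>PiM (insert i I) (\<lambda>_. std_gauss)) = (\<integral>\<^sup>+y. V y \<partial>std_gauss)"
    unfolding V_def by (rule std_gauss_prod.product_nn_integral_insert_rev) (use insert in measurable)
  moreover have "(\<integral>\<^sup>+y. U y \<partial>std_gauss) * (\<integral>\<^sup>+y. V y \<partial>std_gauss) \<le> 1"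
  proof (rule std_gauss_property_tau)
    fix y y' :: real
    \<comment> \<open>The cost of the new coordinate. Dividing one function by it leaves just the
      cost of the old coordinates, as the induction hypothesis requires.\<close>
    let ?e = "exp ((y - y')\<^sup>2 / 4)"
    have "(\<integral>\<^sup>+x. u (x(i := y)) * ennreal (1 / ?e) \<partial>PiM I (\<lambda>_. std_gauss)) *
      (\<integral>\<^sup>+x. v (x(i := y')) \<partial>PiM I (\<lambda>_. std_gauss)) \<le> 1"
    proof (rule insert.IH)
      fix x x' assume x: "x \<in> space (PiM I (\<lambda>_. borel :: real measure))" "x' \<in> space (PiM I (\<lambda>_. borel :: real measure))"
      have "u (x(i := y)) * v (x'(i := y')) \<le>
        ennreal (exp ((\<Sum>j\<in>insert i I. ((x(i := y)) j - (x'(i := y')) j)\<^sup>2) / 4))"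
        using x by (intro insert.prems(3)) (auto simp: space_PiM PiE_iff extensional_def)
      also have "(\<Sum>j\<in>insert i I. ((x(i := y)) j - (x'(i := y')) j)\<^sup>2) = (y - y')\<^sup>2 + (\<Sum>j\<in>I. (x j - x' j)\<^sup>2)"
        using insert.hyps by (auto intro!: sum.cong)
      finally have "u (x(i := y)) * v (x'(i := y')) * ennreal (1 / ?e) \<le>
          ennreal (exp (((y - y')\<^sup>2 + (\<Sum>j\<in>I. (x j - x' j)\<^sup>2)) / 4)) * ennreal (1 / ?e)"
        by (rule mult_right_mono) simp
      also have "\<dots> = ennreal (exp ((\<Sum>j\<in>I. (x j - x' j)\<^sup>2) / 4))"
        by (simp add: ennreal_mult[symmetric] add_divide_distrib exp_add)
      finally show "u (x(i := y)) * ennreal (1 / ?e) * v (x'(i := y')) \<le> ennreal (exp ((\<Sum>j\<in>I. (x j - x' j)\<^sup>2) / 4))"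
        by (simp add: ac_simps)
    qed (use insert.hyps in measurable)
    also have "(\<integral>\<^sup>+x. u (x(i := y)) * ennreal (1 / ?e) \<partial>PiM I (\<lambda>_. std_gauss)) = U y * ennreal (1 / ?e)"
      unfolding U_def by (rule nn_integral_multc) (use insert.hyps in measurable)
    finally have 1: "U y * ennreal (1 / ?e) * V y' \<le> 1" unfolding V_def .
    have 2: "ennreal (1 / ?e) * ennreal ?e = 1"
      by (subst ennreal_mult[symmetric]) auto
    have "U y * V y' = U y * V y' * (ennreal (1 / ?e) * ennreal ?e)" unfolding 2 by simp
    also have "\<dots> = U y * ennreal (1 / ?e) * V y' * ennreal ?e" by (simp only: ac_simps)
    also have "\<dots> \<le> 1 * ennreal ?e" using 1 by (rule mult_right_mono) simp
    finally show "U y * V y' \<le> ennreal ?e" by simp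
  qed measurable
  ultimately show ?case by simp
qed

lemma sets_std_gauss_n[measurable_cong, simp]: "sets (std_gauss_n n) = sets (\<Pi>\<^sub>M i\<in>{..<n}. borel)"
  unfolding std_gauss_n_def by (intro sets_PiM_cong) auto

lemma space_std_gauss_n: "space (std_gauss_n n) = space (\<Pi>\<^sub>M i\<in>{..<n}. (borel :: real measure))"
  by (intro sets_eq_imp_space_eq) simp

lemma prob_space_std_gauss_n: "prob_space (std_gauss_n n)"
  unfolding std_gauss_n_def by (intro prob_space_PiM prob_space_std_gauss)

text \<open>Property (tau) for \<open>exp (s * h)\<close> and \<open>exp (- s * h)\<close>, the
  second scaled by \<open>?E\<close>. For points at distance \<open>r\<close>, completing the square
  in \<open>\<bar>s\<bar> * l * r \<le> s\<^sup>2 * l\<^sup>2 + r\<^sup>2 / 4\<close> shows that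
  this scaling meets the hypothesis. The bound is free of \<open>n\<close>.\<close>

lemma std_gauss_n_Lipschitz_mgf:
  fixes h :: "(nat \<Rightarrow> real) \<Rightarrow> real"
  assumes [measurable]: "h \<in> borel_measurable (\<Pi>\<^sub>M i\<in>{..<n}. borel)"
    and lip: "\<And>x y. x \<in> space (std_gauss_n n) \<Longrightarrow> y \<in> space (std_gauss_n n) \<Longrightarrow>
      \<bar>h x - h y\<bar> \<le> l * L2_set (\<lambda>i. x i - y i) {..<n}"
  shows "(\<integral>\<^sup>+x. \<integral>\<^sup>+y. ennreal (exp (s * (h x - h y))) \<partial>std_gauss_n n \<partial>std_gauss_n n) \<le> ennreal (exp (s\<^sup>2 * l\<^sup>2))"
proof -
  let ?g = "std_gauss_n n"
  let ?u = "\<lambda>x. ennreal (exp (s * h x))" and ?v = "\<lambda>x. ennreal (exp (- s * h x))"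
  let ?E = "exp (- (s\<^sup>2 * l\<^sup>2))"
  have "(\<integral>\<^sup>+x. ?u x \<partial>?g) * (\<integral>\<^sup>+x. ?v x * ennreal ?E \<partial>?g) \<le> 1"
    unfolding std_gauss_n_def
  proof (rule PiM_std_gauss_property_tau)
    fix x y assume "x \<in> space (\<Pi>\<^sub>M i\<in>{..<n}. (borel :: real measure))" "y \<in> space (\<Pi>\<^sub>M i\<in>{..<n}. (borel :: real measure))"
    then have x: "x \<in> space ?g" "y \<in> space ?g" by (auto simp: space_std_gauss_n)
    let ?r = "L2_set (\<lambda>i. x i - y i) {..<n}"
    have "s * (h x - h y) \<le> \<bar>s\<bar> * \<bar>h x - h y\<bar>" by (simp add: abs_mult[symmetric])
    also have "\<dots> \<le> \<bar>s\<bar> * (l * ?r)" using lip[OF x] by (intro mult_left_mono) auto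
    also have "\<dots> \<le> (\<bar>s\<bar> * l)\<^sup>2 + ?r\<^sup>2 / 4"
      using zero_le_power2[of "\<bar>s\<bar> * l - ?r / 2"] by (simp add: power2_eq_square field_simps)
    finally have "s * (h x - h y) - s\<^sup>2 * l\<^sup>2 \<le> ?r\<^sup>2 / 4" by (simp add: power_mult_distrib)
    also have "?r\<^sup>2 = (\<Sum>i<n. (x i - y i)\<^sup>2)" by (simp add: L2_set_def sum_nonneg)
    finally have "exp (s * h x) * (exp (- s * h y) * ?E) \<le> exp ((\<Sum>i<n. (x i - y i)\<^sup>2) / 4)"
      by (simp add: exp_add[symmetric] algebra_simps)
    then show "?u x * (?v y * ennreal ?E) \<le> ennreal (exp ((\<Sum>i<n. (x i - y i)\<^sup>2) / 4))"
      by (simp add: ennreal_mult[symmetric] ennreal_leI)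
  qed auto
  also have "(\<integral>\<^sup>+x. ?v x * ennreal ?E \<partial>?g) = (\<integral>\<^sup>+x. ?v x \<partial>?g) * ennreal ?E"
    by (rule nn_integral_multc) measurable
  finally have 1: "(\<integral>\<^sup>+x. ?u x \<partial>?g) * (\<integral>\<^sup>+x. ?v x \<partial>?g) * ennreal ?E * ennreal (exp (s\<^sup>2 * l\<^sup>2))
      \<le> 1 * ennreal (exp (s\<^sup>2 * l\<^sup>2))"
    by (intro mult_right_mono) (auto simp: mult.assoc)
  have 2: "ennreal ?E * ennreal (exp (s\<^sup>2 * l\<^sup>2)) = 1"
    by (subst ennreal_mult[symmetric]) (auto simp flip: exp_add)
  have "(\<integral>\<^sup>+x. \<integral>\<^sup>+y. ennreal (exp (s * (h x - h y))) \<partial>?g \<partial>?g)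
    = (\<integral>\<^sup>+x. \<integral>\<^sup>+y. ?u x * ?v y \<partial>?g \<partial>?g)"
    by (intro nn_integral_cong) (auto simp: ennreal_mult[symmetric] exp_add[symmetric] algebra_simps)
  also have "\<dots> = (\<integral>\<^sup>+x. ?u x \<partial>?g) * (\<integral>\<^sup>+y. ?v y \<partial>?g)"
    by (simp add: nn_integral_cmult nn_integral_multc)
  also have "\<dots> \<le> ennreal (exp (s\<^sup>2 * l\<^sup>2))"
    using 1 2 by (simp add: mult.assoc)
  finally show ?thesis .
qed

text \<open>The square in the exponent is linearised by an independent Gaussian variable.\<close>

lemma std_gauss_n_Lipschitz_exp_square:
  fixes h :: "(nat \<Rightarrow> real) \<Rightarrow> real"
  assumes [measurable]: "h \<in> borel_measurable (\<Pi>\<^sub>M i\<in>{..<n}. borel)"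
    and lip: "\<And>x y. x \<in> space (std_gauss_n n) \<Longrightarrow> y \<in> space (std_gauss_n n) \<Longrightarrow>
      \<bar>h x - h y\<bar> \<le> l * L2_set (\<lambda>i. x i - y i) {..<n}"
    and l: "0 < l"
  shows "(\<integral>\<^sup>+x. \<integral>\<^sup>+y. ennreal (exp ((h x - h y)\<^sup>2 / (8 * l\<^sup>2))) \<partial>std_gauss_n n \<partial>std_gauss_n n) \<le> 2"
proof -
  let ?g = "std_gauss_n n"
  interpret n: prob_space "?g" by (rule prob_space_std_gauss_n)
  interpret n1: pair_prob_space "?g" std_gauss ..
  interpret nn: pair_prob_space "?g" "?g" ..
  \<comment> \<open>With \<open>a = (h x - h y) / (2 * l)\<close>, the Gaussian mean of
    \<open>exp (a * \<xi>)\<close> is \<open>exp (a\<^sup>2 / 2)\<close>, which is the integrand.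
    The scale \<open>2 * l\<close> makes the bound for fixed \<open>\<xi>\<close> equal to
    \<open>exp (\<xi>\<^sup>2 / 4)\<close>, which is still integrable, with mean
    \<open>sqrt 2\<close>.\<close>
  let ?f = "\<lambda>x y \<xi>. ennreal (exp (\<xi> / (2 * l) * (h x - h y)))"
  have "(\<integral>\<^sup>+x. \<integral>\<^sup>+y. ennreal (exp ((h x - h y)\<^sup>2 / (8 * l\<^sup>2))) \<partial>?g \<partial>?g)
    = (\<integral>\<^sup>+x. \<integral>\<^sup>+y. \<integral>\<^sup>+\<xi>. ?f x y \<xi> \<partial>std_gauss \<partial>?g \<partial>?g)"
  proof (intro nn_integral_cong)
    fix x y
    show "ennreal (exp ((h x - h y)\<^sup>2 / (8 * l\<^sup>2))) = (\<integral>\<^sup>+\<xi>. ?f x y \<xi> \<partial>std_gauss)"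
      using nn_integral_exp_std_gauss[of "(h x - h y) / (2 * l)"]
      by (simp add: power_divide power_mult_distrib mult.commute)
  qed
  also have "\<dots> = (\<integral>\<^sup>+x. \<integral>\<^sup>+\<xi>. \<integral>\<^sup>+y. ?f x y \<xi> \<partial>?g \<partial>std_gauss \<partial>?g)"
    by (intro nn_integral_cong n1.Fubini'[symmetric]) measurable
  also have "\<dots> = (\<integral>\<^sup>+\<xi>. \<integral>\<^sup>+x. \<integral>\<^sup>+y. ?f x y \<xi> \<partial>?g \<partial>?g \<partial>std_gauss)"
    by (intro n1.Fubini'[symmetric]) measurable
  also have "\<dots> \<le> (\<integral>\<^sup>+\<xi>. ennreal (exp (\<xi>\<^sup>2 / 4)) \<partial>std_gauss)"
  proof (intro nn_integral_mono)
    fix \<xi> :: real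
    have "(\<integral>\<^sup>+x. \<integral>\<^sup>+y. ?f x y \<xi> \<partial>?g \<partial>?g) \<le> ennreal (exp ((\<xi> / (2 * l))\<^sup>2 * l\<^sup>2))"
      by (rule std_gauss_n_Lipschitz_mgf) (use lip in auto)
    also have "(\<xi> / (2 * l))\<^sup>2 * l\<^sup>2 = \<xi>\<^sup>2 / 4"
      using l by (simp add: power_divide power_mult_distrib)
    finally show "(\<integral>\<^sup>+x. \<integral>\<^sup>+y. ?f x y \<xi> \<partial>?g \<partial>?g) \<le> ennreal (exp (\<xi>\<^sup>2 / 4))" .
  qed
  also have "\<dots> = ennreal (sqrt 2)" by (rule nn_integral_exp_square_std_gauss)
  also have "\<dots> \<le> ennreal 2" by (intro ennreal_leI real_le_lsqrt) auto
  finally show ?thesis by simp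
qed

section \<open>The spectral theorem for symmetric matrices\<close>

text \<open>Vectors are functions of which only the coordinates below \<open>n\<close> matter. This
  agrees with the encoding of blocks and lets the product topology supply compactness; determinants
  are reached by conversion to matrices.\<close>

definition matv :: "nat \<Rightarrow> real mat \<Rightarrow> (nat \<Rightarrow> real) \<Rightarrow> nat \<Rightarrow> real" where
  "matv n S x i = (\<Sum>j<n. S $$ (i, j) * x j)"

definition dotn :: "nat \<Rightarrow> (nat \<Rightarrow> real) \<Rightarrow> (nat \<Rightarrow> real) \<Rightarrow> real" where
  "dotn n x y = (\<Sum>i<n. x i * y i)"

lemma dotn_commute: "dotn n x y = dotn n y x"
  by (simp add: dotn_def mult.commute)

lemma dotn_self_nonneg: "0 \<le> dotn n x x"
  by (simp add: dotn_def sum_nonneg)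

lemma dotn_self_eq_0: "dotn n x x = 0 \<longleftrightarrow> (\<forall>i<n. x i = 0)"
  by (auto simp: dotn_def sum_nonneg_eq_0_iff)

lemma dotn_linear:
  "dotn n (\<lambda>i. x i + y i) z = dotn n x z + dotn n y z"
  "dotn n (\<lambda>i. x i - y i) z = dotn n x z - dotn n y z"
  "dotn n (\<lambda>i. c * x i) z = c * dotn n x z"
  "dotn n z (\<lambda>i. x i + y i) = dotn n z x + dotn n z y"
  "dotn n z (\<lambda>i. x i - y i) = dotn n z x - dotn n z y"
  "dotn n z (\<lambda>i. c * x i) = c * dotn n z x"
  by (simp_all add: dotn_def sum.distrib sum_subtractf sum_distrib_left algebra_simps)

lemma matv_linear:
  "matv n S (\<lambda>i. x i + y i) = (\<lambda>i. matv n S x i + matv n S y i)"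
  "matv n S (\<lambda>i. c * x i) = (\<lambda>i. c * matv n S x i)"
  by (intro ext, simp add: matv_def sum.distrib sum_distrib_left algebra_simps)+

lemma dotn_matv_symmetric:
  assumes "\<And>i j. i < n \<Longrightarrow> j < n \<Longrightarrow> S $$ (i, j) = S $$ (j, i)"
  shows "dotn n x (matv n S y) = dotn n (matv n S x) y"
proof -
  have "dotn n x (matv n S y) = (\<Sum>i<n. \<Sum>j<n. x i * S $$ (i, j) * y j)"
    by (simp add: dotn_def matv_def sum_distrib_left mult.assoc)
  also have "\<dots> = (\<Sum>j<n. \<Sum>i<n. x i * S $$ (i, j) * y j)" by (rule sum.swap)
  also have "\<dots> = (\<Sum>j<n. \<Sum>i<n. S $$ (j, i) * x i * y j)"
    by (intro sum.cong refl) (auto simp: assms)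
  also have "\<dots> = dotn n (matv n S x) y"
    by (simp add: dotn_def matv_def sum_distrib_right)
  finally show ?thesis .
qed

text \<open>The \<open>k\<close> constraints, padded by zero rows, form a square matrix. As
  \<open>k < n\<close>, it has a zero row, so its determinant vanishes and it has a nonzero kernel
  vector.\<close>

lemma exists_orthogonal_unit:
  assumes "k < n"
  shows "\<exists>x. (\<forall>i\<ge>n. x i = 0) \<and> dotn n x x = 1 \<and> (\<forall>j<k. dotn n (v j) x = 0)"
proof -
  define A where "A = mat n n (\<lambda>(i, j). if i < k then v i j else 0 :: real)"
  have A: "A \<in> carrier_mat n n" by (simp add: A_def)
  have "row A k = 0\<^sub>v n" using assms by (intro eq_vecI) (auto simp: A_def)
  have "det A = 0"
  proof -
    \<comment> \<open>Row \<open>k\<close> is zero, so scaling it by 0 changes nothing, yet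
      multiplies the determinant by 0.\<close>
    have "A = multrow k 0 A" using assms by (intro eq_matI) (auto simp: A_def mat_multrow_gen_def)
    then show ?thesis using det_multrow[OF assms A, of 0] by simp
  qed
  then obtain w where w: "w \<in> carrier_vec n" "w \<noteq> 0\<^sub>v n" "A *\<^sub>v w = 0\<^sub>v n"
    using det_0_iff_vec_prod_zero_field[OF A] by auto
  define x where "x i = (if i < n then w $ i else 0)" for i
  have "\<exists>i<n. x i \<noteq> 0"
  proof (rule ccontr)
    assume "\<not> (\<exists>i<n. x i \<noteq> 0)"
    then have "w = 0\<^sub>v n" using w(1) by (intro eq_vecI) (auto simp: x_def)
    then show False using w(2) by simp
  qed
  then have "dotn n x x \<noteq> 0" using dotn_self_eq_0[of n x] by blast
  then have pos: "0 < dotn n x x" using dotn_self_nonneg[of n x] by linarith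
  have orth: "dotn n (v j) x = 0" if "j < k" for j
  proof -
    have "0 = (A *\<^sub>v w) $ j" using w(3) that assms by simp
    also have "\<dots> = (\<Sum>i<n. A $$ (j, i) * w $ i)"
      using that assms w(1) A by (auto simp: scalar_prod_def atLeast0LessThan intro!: sum.cong)
    also have "\<dots> = dotn n (v j) x"
      using that assms by (auto simp: dotn_def x_def A_def intro!: sum.cong)
    finally show ?thesis by simp
  qed
  define y where "y i = (1 / sqrt (dotn n x x)) * x i" for i
  have "dotn n y y = 1" unfolding y_def dotn_linear using pos by (simp add: field_simps)
  moreover have "dotn n (v j) y = 0" if "j < k" for j
    unfolding y_def dotn_linear using orth[OF that] by simp
  moreover have "\<forall>i\<ge>n. y i = 0" by (simp add: y_def x_def)
  ultimately show ?thesis by blast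
qed

text \<open>With the coordinates from \<open>n\<close> on pinned at 0, the constraint set is closed
  in a compact box, and the continuous quadratic form attains its maximum there.\<close>

lemma exists_max_on_orthogonal_unit:
  assumes "k < n"
  shows "\<exists>x. dotn n x x = 1 \<and> (\<forall>j<k. dotn n (v j) x = 0) \<and>
    (\<forall>y. dotn n y y = 1 \<and> (\<forall>j<k. dotn n (v j) y = 0) \<longrightarrow> dotn n y (matv n S y) \<le> dotn n x (matv n S x))"
proof -
  define B where "B = (\<lambda>i. if i < n then {-1..1} else {0::real})"
  define C where "C = PiE UNIV B \<inter> {x. dotn n x x = 1} \<inter> (\<Inter>j\<in>{..<k}. {x. dotn n (v j) x = 0})"
  have cont: "continuous_on UNIV (\<lambda>x::nat \<Rightarrow> real. x i)" for i by (rule continuous_on_product_coordinates)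
  have "compact (PiE UNIV B)"
  proof -
    have "compactin (product_topology (\<lambda>_. euclidean) UNIV) (PiE UNIV B)"
      by (subst compactin_PiE) (auto simp: B_def)
    then show ?thesis by (simp add: euclidean_product_topology)
  qed
  moreover have "closed {x. dotn n x x = 1}"
    unfolding dotn_def by (intro closed_Collect_eq continuous_intros cont)
  moreover have "closed (\<Inter>j\<in>{..<k}. {x. dotn n (v j) x = 0})"
    unfolding dotn_def by (intro closed_INT ballI closed_Collect_eq continuous_intros cont)
  ultimately have comp: "compact C" unfolding C_def by (intro compact_Int_closed)
  \<comment> \<open>The form and the constraints read only coordinates below \<open>n\<close>, so
    any competitor may be replaced by its truncation, which lies in \<open>C\<close>.\<close>
  have inC: "\<exists>z\<in>C. \<forall>i<n. z i = y i" if y: "dotn n y y = 1" "\<And>j. j < k \<Longrightarrow> dotn n (v j) y = 0" for y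
  proof (intro bexI[of _ "\<lambda>i. if i < n then y i else 0"] allI impI)
    let ?z = "\<lambda>i. if i < n then y i else 0"
    have d: "dotn n u ?z = dotn n u y" "dotn n ?z ?z = 1" for u using y(1) by (auto simp: dotn_def)
    have "\<bar>y i\<bar> \<le> 1" if "i < n" for i
    proof -
      have "(y i)\<^sup>2 \<le> dotn n y y"
        unfolding dotn_def power2_eq_square using that by (intro member_le_sum) auto
      then show ?thesis using y(1) by (simp add: abs_square_le_1)
    qed
    then have "?z \<in> PiE UNIV B" by (auto simp: B_def abs_le_iff)
    then show "?z \<in> C" unfolding C_def using y(2) d by simp
  qed auto
  obtain x0 where x0: "dotn n x0 x0 = 1" "\<forall>j<k. dotn n (v j) x0 = 0"
    using exists_orthogonal_unit[OF assms, of v] by blast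
  then have ne: "C \<noteq> {}" using inC[of x0] by auto
  have "continuous_on C (\<lambda>x. dotn n x (matv n S x))"
    unfolding dotn_def matv_def
    by (intro continuous_intros continuous_on_subset[OF cont]) auto
  then obtain x where x: "x \<in> C" "\<And>y. y \<in> C \<Longrightarrow> dotn n y (matv n S y) \<le> dotn n x (matv n S x)"
    using continuous_attains_sup[OF comp ne] by blast
  show ?thesis
  proof (intro exI[of _ x] conjI allI impI)
    fix y assume "dotn n y y = 1 \<and> (\<forall>j<k. dotn n (v j) y = 0)"
    then obtain z where z: "z \<in> C" "\<forall>i<n. z i = y i" using inC[of y] by blast
    have "dotn n y (matv n S y) = dotn n z (matv n S z)"
      using z(2) by (simp add: dotn_def matv_def)
    then show "dotn n y (matv n S y) \<le> dotn n x (matv n S x)" using x(2)[OF z(1)] by simp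
  qed (use x(1) in \<open>auto simp: C_def\<close>)
qed

text \<open>First-order condition at an extremum. Replacing \<open>c\<close> by a positive
  \<open>e\<close> gives an upper bound whose minimum, at \<open>- b / (2 * e)\<close>, is
  \<open>- b\<^sup>2 / (4 * e)\<close>.\<close>

lemma nonneg_quadratic_linear_coeff:
  fixes b c :: real
  assumes "\<And>t. 0 \<le> b * t + c * t\<^sup>2"
  shows "b = 0"
proof (rule ccontr)
  assume b: "b \<noteq> 0"
  define e where "e = \<bar>c\<bar> + 1"
  have e: "0 < e" "c \<le> e" by (auto simp: e_def)
  have "0 \<le> b * (- b / (2 * e)) + c * (- b / (2 * e))\<^sup>2" by (rule assms)
  also have "\<dots> \<le> b * (- b / (2 * e)) + e * (- b / (2 * e))\<^sup>2"
    using e by (intro add_left_mono mult_right_mono) auto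
  also have "\<dots> = - (b\<^sup>2 / (4 * e))" using e by (simp add: power2_eq_square field_simps)
  finally have "b\<^sup>2 / (4 * e) \<le> 0" by simp
  then show False using b e by (simp add: divide_le_0_iff)
qed

text \<open>Rayleigh's principle: \<open>x\<close> maximises the quadratic form among unit vectors
  orthogonal to the earlier eigenvectors, and \<open>m\<close> is the maximum. The residual
  \<open>w\<close> of the eigenvalue equation is orthogonal to those eigenvectors and to
  \<open>x\<close>, hence an allowed direction of variation; the first variation along it is a
  multiple of \<open>dotn n w w\<close>, which must therefore vanish.\<close>

lemma exists_next_eigenvector:
  assumes sym: "\<And>i j. i < n \<Longrightarrow> j < n \<Longrightarrow> S $$ (i, j) = S $$ (j, i)"
    and "k < n"
    and eig: "\<And>j i. j < k \<Longrightarrow> i < n \<Longrightarrow> matv n S (v j) i = l j * v j i"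
  shows "\<exists>x m. dotn n x x = 1 \<and> (\<forall>j<k. dotn n (v j) x = 0) \<and> (\<forall>i<n. matv n S x i = m * x i)"
proof -
  obtain x where x: "dotn n x x = 1" "\<And>j. j < k \<Longrightarrow> dotn n (v j) x = 0"
    and max: "\<And>y. dotn n y y = 1 \<Longrightarrow> (\<And>j. j < k \<Longrightarrow> dotn n (v j) y = 0) \<Longrightarrow>
      dotn n y (matv n S y) \<le> dotn n x (matv n S x)"
    using exists_max_on_orthogonal_unit[OF assms(2), of v S] by metis
  define m where "m = dotn n x (matv n S x)"
  have q: "dotn n y (matv n S y) \<le> m * dotn n y y" if y: "\<And>j. j < k \<Longrightarrow> dotn n (v j) y = 0" for y
  proof (cases "dotn n y y = 0")
    case True
    then have "\<forall>i<n. y i = 0" by (simp add: dotn_self_eq_0)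
    then show ?thesis by (simp add: dotn_def)
  next
    case False
    then have pos: "0 < dotn n y y" using dotn_self_nonneg[of n y] by simp
    define c where "c = 1 / sqrt (dotn n y y)"
    have cc: "c * c = 1 / dotn n y y" using pos by (simp add: c_def)
    then have c2: "c * c * dotn n y y = 1" using pos by simp
    have "dotn n (\<lambda>i. c * y i) (matv n S (\<lambda>i. c * y i)) \<le> m"
      unfolding m_def by (rule max) (use y c2 in \<open>simp_all add: dotn_linear mult.assoc\<close>)
    then have "c * c * dotn n y (matv n S y) \<le> m"
      by (simp add: dotn_linear matv_linear mult.assoc)
    then show ?thesis using pos unfolding cc by (simp add: field_simps)
  qed
  define w where "w i = matv n S x i - m * x i" for i
  have vS: "dotn n (v j) (matv n S y) = l j * dotn n (v j) y" if "j < k" for j y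
  proof -
    have "dotn n (v j) (matv n S y) = dotn n (matv n S (v j)) y" by (rule dotn_matv_symmetric[OF sym])
    also have "\<dots> = dotn n (\<lambda>i. l j * v j i) y" using eig that by (simp add: dotn_def)
    finally show ?thesis by (simp add: dotn_linear)
  qed
  have vw: "dotn n (v j) w = 0" if "j < k" for j
    unfolding w_def dotn_linear using vS[OF that, of x] x(2)[OF that] by simp
  have xw: "dotn n x w = 0" unfolding w_def dotn_linear using x(1) by (simp add: m_def)
  have wSx: "dotn n w (matv n S x) = dotn n w w"
  proof -
    have "dotn n w (\<lambda>i. matv n S x i - m * x i) = dotn n w (matv n S x) - m * dotn n w x"
      by (simp only: dotn_linear)
    then show ?thesis using xw unfolding w_def[symmetric] by (simp add: dotn_commute[of n w x])
  qed
  have xSw: "dotn n x (matv n S w) = dotn n w w"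
    using dotn_matv_symmetric[OF sym, of n x w] dotn_commute[of n "matv n S x" w] wSx by (simp only:)
  \<comment> \<open>Maximality tested at \<open>x + t * w\<close>. The constant terms cancel, and
    \<open>wSx\<close> and \<open>xSw\<close> each contribute one \<open>dotn n w w\<close> to the
    linear coefficient.\<close>
  have "0 \<le> - 2 * dotn n w w * t + (m * dotn n w w - dotn n w (matv n S w)) * t\<^sup>2" for t
  proof -
    have "dotn n (\<lambda>i. x i + t * w i) (matv n S (\<lambda>i. x i + t * w i))
      \<le> m * dotn n (\<lambda>i. x i + t * w i) (\<lambda>i. x i + t * w i)"
      by (rule q) (use x(2) vw in \<open>simp add: dotn_linear\<close>)
    then have "dotn n x (matv n S x) + t * dotn n x (matv n S w) + t * (dotn n w (matv n S x) + t * dotn n w (matv n S w))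
      \<le> m * (dotn n x x + t * dotn n x w + t * (dotn n w x + t * dotn n w w))"
      by (simp only: dotn_linear matv_linear)
    then have "m + t * dotn n w w + t * (dotn n w w + t * dotn n w (matv n S w)) \<le> m * (1 + t * (t * dotn n w w))"
      using xw xSw wSx x(1) dotn_commute[of n w x] by (simp add: m_def)
    then show ?thesis
      by (simp add: power2_eq_square algebra_simps)
  qed
  then have "- 2 * dotn n w w = 0" by (rule nonneg_quadratic_linear_coeff)
  then have "\<forall>i<n. matv n S x i = m * x i" by (simp add: dotn_self_eq_0 w_def)
  with x show ?thesis by blast
qed

lemma symmetric_matrix_spectral:
  assumes sym: "\<And>i j. i < n \<Longrightarrow> j < n \<Longrightarrow> S $$ (i, j) = (S $$ (j, i) :: real)"
  shows "\<exists>v l. (\<forall>j<n. \<forall>k<n. dotn n (v j) (v k) = (if j = k then 1 else 0)) \<and>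
    (\<forall>j<n. \<forall>i<n. matv n S (v j) i = l j * v j i)"
proof -
  have "k \<le> n \<Longrightarrow> \<exists>v l. (\<forall>j<k. \<forall>i<k. dotn n (v j) (v i) = (if j = i then 1 else 0)) \<and>
    (\<forall>j<k. \<forall>i<n. matv n S (v j) i = l j * v j i)" for k
  proof (induction k)
    case 0
    then show ?case by simp
  next
    case (Suc k)
    then have "k \<le> n" by simp
    from Suc.IH[OF this] obtain v l
      where v: "\<forall>j<k. \<forall>i<k. dotn n (v j) (v i) = (if j = i then 1 else 0)"
      and l: "\<forall>j<k. \<forall>i<n. matv n S (v j) i = l j * v j i" by blast
    have "\<exists>x m. dotn n x x = 1 \<and> (\<forall>j<k. dotn n (v j) x = 0) \<and> (\<forall>i<n. matv n S x i = m * x i)"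
    proof (rule exists_next_eigenvector)
      show "S $$ (i, j) = S $$ (j, i)" if "i < n" "j < n" for i j using that by (rule sym)
      show "matv n S (v j) i = l j * v j i" if "j < k" "i < n" for j i using l that by blast
    qed (use Suc.prems in simp)
    then obtain x m where x: "dotn n x x = 1" "\<And>j. j < k \<Longrightarrow> dotn n (v j) x = 0"
      "\<And>i. i < n \<Longrightarrow> matv n S x i = m * x i" by blast
    show ?case
    proof (intro exI[of _ "v(k := x)"] exI[of _ "l(k := m)"] conjI allI impI)
      fix j i assume "j < Suc k" "i < Suc k"
      then show "dotn n ((v(k := x)) j) ((v(k := x)) i) = (if j = i then 1 else 0)"
        using v x(1,2) dotn_commute[of n x "v i"] by (cases "j = k"; cases "i = k") auto
    next
      fix j i assume "j < Suc k" "i < n"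
      then show "matv n S ((v(k := x)) j) i = (l(k := m)) j * (v(k := x)) j i"
        using l x(3) by (cases "j = k") auto
    qed
  qed
  from this[of n] show ?thesis by simp
qed

section \<open>Rotation invariance and the law of the data\<close>

lemma nn_integral_PiM_lborel_translate:
  fixes y :: "nat \<Rightarrow> real"
  assumes [measurable]: "f \<in> borel_measurable (PiM I (\<lambda>_. borel))" and I: "finite I"
  shows "(\<integral>\<^sup>+x. f (\<lambda>i\<in>I. x i + y i) \<partial>PiM I (\<lambda>_. lborel)) = (\<integral>\<^sup>+x. f x \<partial>PiM I (\<lambda>_. lborel))"
proof -
  interpret product_sigma_finite "\<lambda>_::nat. lborel :: real measure" by unfold_locales
  have s: "sets (PiM I (\<lambda>_. lborel)) = sets (PiM I (\<lambda>_. borel :: real measure))"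
    by (intro sets_PiM_cong) auto
  note [measurable_cong] = s
  let ?T = "\<lambda>x. \<lambda>i\<in>I. x i + y i"
  let ?D = "distr (PiM I (\<lambda>_. lborel)) (PiM I (\<lambda>_. borel)) ?T"
  have T[measurable]: "?T \<in> PiM I (\<lambda>_. lborel) \<rightarrow>\<^sub>M PiM I (\<lambda>_. borel)"
    by measurable
  have "?D = PiM I (\<lambda>_. lborel)"
  proof (rule PiM_eqI[OF I])
    fix A assume A: "\<And>i. i \<in> I \<Longrightarrow> A i \<in> sets (lborel :: real measure)"
    have A2: "(\<lambda>t. t + y i) -` A i \<in> sets borel" if "i \<in> I" for i
    proof -
      have [measurable]: "A i \<in> sets borel" using A[OF that] by simp
      have "(\<lambda>t. t + y i) -` A i \<inter> space borel \<in> sets borel" by measurable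
      then show ?thesis by simp
    qed
    have "emeasure ?D (Pi\<^sub>E I A)
      = emeasure (PiM I (\<lambda>_. lborel)) (?T -` Pi\<^sub>E I A \<inter> space (PiM I (\<lambda>_. lborel :: real measure)))"
      using A I by (intro emeasure_distr T sets_PiM_I_finite) auto
    also have "?T -` Pi\<^sub>E I A \<inter> space (PiM I (\<lambda>_. lborel :: real measure)) = Pi\<^sub>E I (\<lambda>i. (\<lambda>t. t + y i) -` A i)"
      by (auto simp: space_PiM PiE_iff)
    also have "emeasure (PiM I (\<lambda>_. lborel)) \<dots> = (\<Prod>i\<in>I. emeasure lborel ((\<lambda>t. t + y i) -` A i))"
      using A2 by (intro emeasure_PiM I) auto
    also have "\<dots> = (\<Prod>i\<in>I. emeasure lborel (A i))"
    proof (intro prod.cong refl)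
      fix i assume i: "i \<in> I"
      have "emeasure lborel (A i) = emeasure (distr lborel borel ((+) (y i))) (A i)"
        by (subst lborel_distr_plus) simp
      also have "\<dots> = emeasure lborel ((\<lambda>t. t + y i) -` A i)"
        using A[OF i] by (subst emeasure_distr) (auto simp: vimage_def add.commute)
      finally show "emeasure lborel ((\<lambda>t. t + y i) -` A i) = emeasure lborel (A i)" ..
    qed
    finally show "emeasure ?D (Pi\<^sub>E I A) =
      (\<Prod>i\<in>I. emeasure lborel (A i))" .
  qed (simp add: s)
  then have "(\<integral>\<^sup>+x. f x \<partial>PiM I (\<lambda>_. lborel)) = (\<integral>\<^sup>+x. f x \<partial>?D)"
    by simp
  also have "\<dots> = (\<integral>\<^sup>+x. f (?T x) \<partial>PiM I (\<lambda>_. lborel))"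
    by (rule nn_integral_distr) measurable
  finally show ?thesis ..
qed

section \<open>Orthonormal coordinates\<close>

definition orthonormal :: "nat \<Rightarrow> (nat \<Rightarrow> nat \<Rightarrow> real) \<Rightarrow> bool" where
  "orthonormal n v \<longleftrightarrow> (\<forall>j<n. \<forall>k<n. dotn n (v j) (v k) = (if j = k then 1 else 0))"

text \<open>For square matrices a right inverse is also a left inverse.\<close>

lemma orthonormal_transpose:
  assumes "orthonormal n v" "i < n" "k < n"
  shows "(\<Sum>j<n. v j i * v j k) = (if i = k then 1 else 0)"
proof -
  define A where "A = mat n n (\<lambda>(i, j). v i j)"
  have A: "A \<in> carrier_mat n n" by (simp add: A_def)
  have "A * transpose_mat A = 1\<^sub>m n"
    using assms(1) by (intro eq_matI)
      (auto simp: A_def orthonormal_def dotn_def scalar_prod_def atLeast0LessThan)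
  then have "transpose_mat A * A = 1\<^sub>m n"
    by (intro mat_mult_left_right_inverse[of A n]) (auto simp: A)
  then have "(transpose_mat A * A) $$ (i, k) = (if i = k then 1 else 0)"
    using assms by simp
  then show ?thesis using assms by (simp add: A_def scalar_prod_def atLeast0LessThan)
qed

text \<open>\<open>v j\<close> is the \<open>j\<close>-th basis vector and \<open>x\<close> lists
  coordinates relative to the centre \<open>m\<close>. The restriction makes the result extensional,
  so that \<open>unrot\<close> is a true inverse on points of \<open>Rn n\<close>.\<close>

definition rot :: "nat \<Rightarrow> (nat \<Rightarrow> nat \<Rightarrow> real) \<Rightarrow> (nat \<Rightarrow> real) \<Rightarrow> (nat \<Rightarrow> real) \<Rightarrow> nat \<Rightarrow> real" where
  "rot n v m x = (\<lambda>i\<in>{..<n}. m i + (\<Sum>j<n. v j i * x j))"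

definition unrot :: "nat \<Rightarrow> (nat \<Rightarrow> nat \<Rightarrow> real) \<Rightarrow> (nat \<Rightarrow> real) \<Rightarrow> (nat \<Rightarrow> real) \<Rightarrow> nat \<Rightarrow> real" where
  "unrot n v m y = (\<lambda>j\<in>{..<n}. \<Sum>i<n. v j i * (y i - m i))"

lemma rot_unrot:
  assumes "orthonormal n v" "y \<in> extensional {..<n}"
  shows "rot n v m (unrot n v m y) = y"
proof (rule extensionalityI[OF _ assms(2)])
  fix i assume i: "i \<in> {..<n}"
  have "(\<Sum>j<n. v j i * (\<Sum>k<n. v j k * (y k - m k))) = (\<Sum>k<n. (\<Sum>j<n. v j i * v j k) * (y k - m k))"
    unfolding sum_distrib_left sum_distrib_right by (subst sum.swap) (simp add: mult.assoc)
  also have "\<dots> = (\<Sum>k<n. (if i = k then 1 else 0) * (y k - m k))"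
    using i by (intro sum.cong refl) (simp add: orthonormal_transpose[OF assms(1)])
  also have "\<dots> = (\<Sum>k<n. if i = k then y k - m k else 0)" by (intro sum.cong) auto
  also have "\<dots> = y i - m i" using i by simp
  finally show "rot n v m (unrot n v m y) i = y i" using i by (simp add: rot_def unrot_def)
qed (simp add: rot_def)

lemma Parseval:
  assumes "orthonormal n v"
  shows "dotn n (\<lambda>i. \<Sum>j<n. v j i * x j) (\<lambda>i. \<Sum>j<n. v j i * z j) = (\<Sum>j<n. x j * z j)"
proof -
  have "dotn n (\<lambda>i. \<Sum>j<n. v j i * x j) (\<lambda>i. \<Sum>k<n. v k i * z k)
    = (\<Sum>i<n. \<Sum>j<n. \<Sum>k<n. v j i * x j * (v k i * z k))"
    by (simp add: dotn_def sum_product)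
  also have "\<dots> = (\<Sum>j<n. \<Sum>i<n. \<Sum>k<n. v j i * x j * (v k i * z k))" by (rule sum.swap)
  also have "\<dots> = (\<Sum>j<n. \<Sum>k<n. \<Sum>i<n. v j i * x j * (v k i * z k))" by (intro sum.cong refl sum.swap)
  also have "\<dots> = (\<Sum>j<n. \<Sum>k<n. x j * z k * dotn n (v j) (v k))"
    by (simp add: dotn_def sum_distrib_left ac_simps)
  also have "\<dots> = (\<Sum>j<n. \<Sum>k<n. if j = k then x j * z k else 0)"
    using assms by (intro sum.cong refl) (auto simp: orthonormal_def)
  also have "\<dots> = (\<Sum>j<n. x j * z j)" by simp
  finally show ?thesis .
qed

lemma unrot_rot:
  assumes "orthonormal n v" "x \<in> extensional {..<n}"
  shows "unrot n v m (rot n v m x) = x"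
proof (rule extensionalityI[OF _ assms(2)])
  fix j assume j: "j \<in> {..<n}"
  have "(\<Sum>i<n. v j i * (\<Sum>k<n. v k i * x k)) = (\<Sum>k<n. x k * dotn n (v j) (v k))"
    unfolding dotn_def sum_distrib_left by (subst sum.swap) (simp add: ac_simps)
  also have "\<dots> = (\<Sum>k<n. if j = k then x k else 0)"
    using assms(1) j by (intro sum.cong refl) (auto simp: orthonormal_def)
  also have "\<dots> = x j" using j by simp
  finally show "unrot n v m (rot n v m x) j = x j" using j by (simp add: rot_def unrot_def)
qed (simp add: unrot_def)

lemma rot_measurable[measurable]:
  "rot n v m \<in> (\<Pi>\<^sub>M i\<in>{..<n}. borel) \<rightarrow>\<^sub>M (\<Pi>\<^sub>M i\<in>{..<n}. borel)"
  unfolding rot_def by measurable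

lemma unrot_measurable[measurable]:
  "unrot n v m \<in> (\<Pi>\<^sub>M i\<in>{..<n}. borel) \<rightarrow>\<^sub>M (\<Pi>\<^sub>M i\<in>{..<n}. borel)"
  unfolding unrot_def by measurable

lemma distortion_eq_dotn: "distortion n y z = dotn n (\<lambda>i. y i - z i) (\<lambda>i. y i - z i)"
  by (simp add: distortion_def L2_set_def dotn_def sum_nonneg power2_eq_square)

lemma distortion_rot:
  assumes "orthonormal n v"
  shows "distortion n (rot n v m x) (rot n v m z) = (\<Sum>i<n. (x i - z i)\<^sup>2)"
proof -
  have "distortion n (rot n v m x) (rot n v m z)
    = dotn n (\<lambda>i. \<Sum>j<n. v j i * (x j - z j)) (\<lambda>i. \<Sum>j<n. v j i * (x j - z j))"
    unfolding distortion_eq_dotn by (simp add: dotn_def rot_def right_diff_distrib sum_subtractf)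
  then show ?thesis using Parseval[OF assms, of "\<lambda>j. x j - z j" "\<lambda>j. x j - z j"] by (simp add: power2_eq_square)
qed

text \<open>Comparing with a rotation-invariant probability density \<open>g\<close> of known total mass
  replaces an argument about the uniqueness of Haar measure.\<close>

lemma nn_integral_PiM_lborel_rot:
  assumes o: "orthonormal n v" and [measurable]: "f \<in> borel_measurable (\<Pi>\<^sub>M i\<in>{..<n}. borel)"
  shows "(\<integral>\<^sup>+x. f (rot n v m x) \<partial>(\<Pi>\<^sub>M i\<in>{..<n}. lborel)) = (\<integral>\<^sup>+x. f x \<partial>(\<Pi>\<^sub>M i\<in>{..<n}. lborel))"
proof -
  let ?I = "{..<n}" and ?L = "\<Pi>\<^sub>M i\<in>{..<n}. (lborel :: real measure)"
  let ?U = "rot n v (\<lambda>_. 0)"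
  interpret product_sigma_finite "\<lambda>_::nat. lborel :: real measure" by unfold_locales
  interpret finite_product_sigma_finite "\<lambda>_::nat. lborel :: real measure" ?I by standard simp
  have s: "sets ?L = sets (\<Pi>\<^sub>M i\<in>{..<n}. borel :: real measure)"
    by (intro sets_PiM_cong) auto
  note [measurable_cong] = s
  interpret LL: pair_sigma_finite ?L ?L ..
  define g where "g x = (\<Prod>i<n. ennreal (std_normal_density (x i)))" for x :: "nat \<Rightarrow> real"
  have [measurable]: "g \<in> borel_measurable (\<Pi>\<^sub>M i\<in>{..<n}. borel)" unfolding g_def by measurable
  have gx: "g x = ennreal ((1 / sqrt (2 * pi)) ^ n * exp (- (\<Sum>i<n. (x i)\<^sup>2) / 2))" for x
    unfolding g_def std_normal_density_def
    by (simp add: prod_ennreal prod.distrib exp_sum[symmetric] sum_divide_distrib sum_negf power_divide prod_dividef)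
  have g1: "(\<integral>\<^sup>+x. g x \<partial>?L) = 1"
    unfolding g_def by (subst product_nn_integral_prod) (auto simp: nn_integral_normal_density)
  have gU: "g (\<lambda>i\<in>?I. 0 + - ?U x i) = g x" for x
  proof -
    have "(\<Sum>i<n. ((\<lambda>i\<in>?I. 0 + - ?U x i) i)\<^sup>2) = distortion n (rot n v (\<lambda>_. 0) (\<lambda>_. 0)) (?U x)"
      by (simp add: distortion_eq_dotn dotn_def rot_def power2_eq_square)
    also have "\<dots> = (\<Sum>i<n. (x i)\<^sup>2)" by (subst distortion_rot[OF o]) simp
    finally show ?thesis unfolding gx by simp
  qed
  have fm: "f (rot n v m x) = f (\<lambda>i\<in>?I. ?U x i + m i)" for x
    by (rule arg_cong[of _ _ f]) (auto simp: rot_def)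
  \<comment> \<open>After insertion of the mass of \<open>g\<close>, translating \<open>y\<close> by
    \<open>- ?U x\<close> and then \<open>x\<close> by the preimage of \<open>y\<close> moves the
    rotation out of the argument of \<open>f\<close>: it survives as a translation of
    \<open>f\<close>, which Lebesgue measure ignores, and inside \<open>g\<close>, which is
    invariant under it by \<open>gU\<close>.\<close>
  have main: "(\<integral>\<^sup>+x. f (?U x) \<partial>?L) = (\<integral>\<^sup>+x. f x \<partial>?L)" if [measurable]: "f \<in> borel_measurable (\<Pi>\<^sub>M i\<in>{..<n}. borel)" for f
  proof -
    have "(\<integral>\<^sup>+x. f (?U x) \<partial>?L) = (\<integral>\<^sup>+x. \<integral>\<^sup>+y. f (?U x) * g y \<partial>?L \<partial>?L)"
      by (simp add: nn_integral_cmult g1)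
    also have "\<dots> = (\<integral>\<^sup>+x. \<integral>\<^sup>+y. f (?U x) * g (\<lambda>i\<in>?I. y i + - ?U x i) \<partial>?L \<partial>?L)"
    proof (rule nn_integral_cong)
      fix x
      show "(\<integral>\<^sup>+y. f (?U x) * g y \<partial>?L) = (\<integral>\<^sup>+y. f (?U x) * g (\<lambda>i\<in>?I. y i + - ?U x i) \<partial>?L)"
        by (rule nn_integral_PiM_lborel_translate[symmetric]) measurable
    qed
    also have "\<dots> = (\<integral>\<^sup>+y. \<integral>\<^sup>+x. f (?U x) * g (\<lambda>i\<in>?I. y i + - ?U x i) \<partial>?L \<partial>?L)"
      by (rule LL.Fubini'[symmetric]) measurable
    also have "\<dots> = (\<integral>\<^sup>+y. \<integral>\<^sup>+x. f (\<lambda>i\<in>?I. y i + ?U x i) * g (\<lambda>i\<in>?I. 0 + - ?U x i) \<partial>?L \<partial>?L)"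
    proof (rule nn_integral_cong)
      fix y assume "y \<in> space ?L"
      then have y: "y \<in> extensional ?I" by (auto simp: space_PiM PiE_iff)
      let ?h = "\<lambda>x. f (?U x) * g (\<lambda>i\<in>?I. y i + - ?U x i)"
      let ?w = "unrot n v (\<lambda>_. 0) y"
      have Uw: "?U (\<lambda>i\<in>?I. x i + ?w i) = (\<lambda>i\<in>?I. y i + ?U x i)" for x
      proof (rule extensionalityI[of _ ?I])
        fix i assume i: "i \<in> ?I"
        have "y i = ?U ?w i" using rot_unrot[OF o y, of "\<lambda>_. 0"] by simp
        then show "?U (\<lambda>i\<in>?I. x i + ?w i) i = (\<lambda>i\<in>?I. y i + ?U x i) i"
          using i by (simp add: rot_def distrib_left sum.distrib)
      qed (auto simp: rot_def)
      have "(\<integral>\<^sup>+x. ?h x \<partial>?L) = (\<integral>\<^sup>+x. ?h (\<lambda>i\<in>?I. x i + ?w i) \<partial>?L)"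
        by (rule nn_integral_PiM_lborel_translate[symmetric]) measurable
      also have "\<dots> = (\<integral>\<^sup>+x. f (\<lambda>i\<in>?I. y i + ?U x i) * g (\<lambda>i\<in>?I. 0 + - ?U x i) \<partial>?L)"
        unfolding Uw by (intro nn_integral_cong arg_cong2[of _ _ _ _ "(*)"] refl arg_cong[of _ _ g]) auto
      finally show "(\<integral>\<^sup>+x. ?h x \<partial>?L) = (\<integral>\<^sup>+x. f (\<lambda>i\<in>?I. y i + ?U x i) * g (\<lambda>i\<in>?I. 0 + - ?U x i) \<partial>?L)" .
    qed
    also have "\<dots> = (\<integral>\<^sup>+x. \<integral>\<^sup>+y. f (\<lambda>i\<in>?I. y i + ?U x i) * g x \<partial>?L \<partial>?L)"
      unfolding gU by (rule LL.Fubini') measurable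
    also have "\<dots> = (\<integral>\<^sup>+x. (\<integral>\<^sup>+y. f y \<partial>?L) * g x \<partial>?L)"
    proof (rule nn_integral_cong)
      fix x
      have "(\<integral>\<^sup>+y. f (\<lambda>i\<in>?I. y i + ?U x i) * g x \<partial>?L) = (\<integral>\<^sup>+y. f (\<lambda>i\<in>?I. y i + ?U x i) \<partial>?L) * g x"
        by (rule nn_integral_multc) measurable
      then show "(\<integral>\<^sup>+y. f (\<lambda>i\<in>?I. y i + ?U x i) * g x \<partial>?L) = (\<integral>\<^sup>+y. f y \<partial>?L) * g x"
        by (simp add: nn_integral_PiM_lborel_translate)
    qed
    also have "\<dots> = (\<integral>\<^sup>+y. f y \<partial>?L)" by (simp add: nn_integral_cmult g1)
    finally show ?thesis .
  qed
  have "(\<integral>\<^sup>+x. f (rot n v m x) \<partial>?L) = (\<integral>\<^sup>+x. f (\<lambda>i\<in>?I. x i + m i) \<partial>?L)"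
    unfolding fm by (rule main[of "\<lambda>x. f (\<lambda>i\<in>?I. x i + m i)"]) measurable
  also have "\<dots> = (\<integral>\<^sup>+x. f x \<partial>?L)" by (rule nn_integral_PiM_lborel_translate) auto
  finally show ?thesis .
qed

section \<open>Densities and coordinatewise images of product measures\<close>

lemma PiM_density:
  assumes "finite I" "product_sigma_finite N" "product_sigma_finite (\<lambda>i. density (N i) (w i))"
    and w: "\<And>i. i \<in> I \<Longrightarrow> w i \<in> borel_measurable (N i)"
  shows "PiM I (\<lambda>i. density (N i) (w i)) = density (PiM I N) (\<lambda>x. \<Prod>i\<in>I. w i (x i))"
proof -
  interpret N: product_sigma_finite N by fact
  interpret W: product_sigma_finite "\<lambda>i. density (N i) (w i)" by fact
  note w[measurable]
  have wm[measurable]: "(\<lambda>x. \<Prod>i\<in>I. w i (x i)) \<in> borel_measurable (PiM I N)"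
    by measurable
  show ?thesis
  proof (rule sym, rule W.PiM_eqI)
    fix A assume A: "\<And>i. i \<in> I \<Longrightarrow> A i \<in> sets (density (N i) (w i))"
    then have [measurable]: "A i \<in> sets (N i)" if "i \<in> I" for i using that by auto
    have "emeasure (density (PiM I N) (\<lambda>x. \<Prod>i\<in>I. w i (x i))) (Pi\<^sub>E I A)
      = (\<integral>\<^sup>+x. (\<Prod>i\<in>I. w i (x i)) * indicator (Pi\<^sub>E I A) x \<partial>PiM I N)"
      by (rule emeasure_density) (use assms(1) in \<open>auto intro!: sets_PiM_I_finite\<close>)
    also have "\<dots> = (\<integral>\<^sup>+x. (\<Prod>i\<in>I. w i (x i) * indicator (A i) (x i)) \<partial>PiM I N)"
    proof (intro nn_integral_cong)
      fix x assume "x \<in> space (PiM I N)"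
      then have "x \<in> extensional I" by (auto simp: space_PiM PiE_iff)
      then have "indicator (Pi\<^sub>E I A) x = (\<Prod>i\<in>I. indicator (A i) (x i) :: ennreal)"
        using assms(1) by (cases "x \<in> Pi\<^sub>E I A") (force simp: PiE_iff indicator_eq_0_iff)+
      then show "(\<Prod>i\<in>I. w i (x i)) * indicator (Pi\<^sub>E I A) x = (\<Prod>i\<in>I. w i (x i) * indicator (A i) (x i))"
        by (simp add: prod.distrib)
    qed
    also have "\<dots> = (\<Prod>i\<in>I. \<integral>\<^sup>+x. w i x * indicator (A i) x \<partial>N i)"
      by (rule N.product_nn_integral_prod) (use assms(1) in auto)
    also have "\<dots> = (\<Prod>i\<in>I. emeasure (density (N i) (w i)) (A i))"
      by (intro prod.cong refl) (simp add: emeasure_density)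
    finally show "emeasure (density (PiM I N) (\<lambda>x. \<Prod>i\<in>I. w i (x i))) (Pi\<^sub>E I A) =
      (\<Prod>i\<in>I. emeasure (density (N i) (w i)) (A i))" .
  qed (use assms(1) in \<open>auto intro!: sets_PiM_cong\<close>)
qed

text \<open>\<open>f i\<close> is measurable only for \<open>i\<close> in \<open>I\<close>, but the
  locale for product measures asks for a sigma-finite measure at every index; a point mass fills the
  remaining ones.\<close>

lemma distr_PiM_componentwise:
  assumes I: "finite I" and N: "\<And>i. prob_space (N i)"
    and f[measurable]: "\<And>i. i \<in> I \<Longrightarrow> f i \<in> N i \<rightarrow>\<^sub>M B"
  shows "distr (PiM I N) (PiM I (\<lambda>_. B)) (\<lambda>x. \<lambda>i\<in>I. f i (x i))
    = PiM I (\<lambda>i. if i \<in> I then distr (N i) B (f i) else return (count_space UNIV) undefined)" (is "_ = PiM I ?D")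
proof -
  let ?f = "\<lambda>x. \<lambda>i\<in>I. f i (x i)"
  let ?P = "distr (PiM I N) (PiM I (\<lambda>_. B)) ?f"
  interpret N: prob_space "N i" for i by (rule N)
  interpret N: product_sigma_finite N by unfold_locales
  have "prob_space (?D i)" for i
    by (auto intro!: N.prob_space_distr prob_space_return)
  then interpret D: prob_space "?D i" for i .
  interpret D: product_sigma_finite ?D by unfold_locales
  have T: "?f \<in> PiM I N \<rightarrow>\<^sub>M PiM I (\<lambda>_. B)" by measurable
  show ?thesis
  proof (rule D.PiM_eqI[OF I])
    show "sets ?P = PiM I ?D"
      by (auto intro!: sets_PiM_cong)
  next
    fix A assume A: "\<And>i. i \<in> I \<Longrightarrow> A i \<in> sets (?D i)"
    then have AB[measurable]: "A i \<in> sets B" if "i \<in> I" for i using that by force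
    have "emeasure ?P (Pi\<^sub>E I A)
      = emeasure (PiM I N) (?f -` Pi\<^sub>E I A \<inter> space (PiM I N))"
      using AB I by (intro emeasure_distr T sets_PiM_I_finite) auto
    also have "?f -` Pi\<^sub>E I A \<inter> space (PiM I N) = Pi\<^sub>E I (\<lambda>i. f i -` A i \<inter> space (N i))"
      by (auto simp: space_PiM PiE_iff)
    also have "emeasure (PiM I N) \<dots> = (\<Prod>i\<in>I. emeasure (N i) (f i -` A i \<inter> space (N i)))"
      by (intro N.emeasure_PiM I) measurable
    also have "\<dots> = (\<Prod>i\<in>I. emeasure (?D i) (A i))"
      by (intro prod.cong refl) (simp add: emeasure_distr)
    finally show "emeasure ?P (Pi\<^sub>E I A) = (\<Prod>i\<in>I. emeasure (?D i) (A i))" .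
  qed
qed

definition normal_prod :: "nat \<Rightarrow> (nat \<Rightarrow> real) \<Rightarrow> (nat \<Rightarrow> real) measure" where
  "normal_prod n l = (\<Pi>\<^sub>M i\<in>{..<n}. density lborel (\<lambda>x. ennreal (normal_density 0 (sqrt (l i)) x)))"

lemma normal_prod_eq_density:
  assumes l: "\<And>i. 0 < l i"
  shows "normal_prod n l = density (\<Pi>\<^sub>M i\<in>{..<n}. lborel) (\<lambda>x. \<Prod>i<n. ennreal (normal_density 0 (sqrt (l i)) (x i)))"
  unfolding normal_prod_def
proof (rule PiM_density)
  show "product_sigma_finite (\<lambda>_::nat. lborel :: real measure)" by unfold_locales
  have "prob_space (density lborel (\<lambda>x. ennreal (normal_density 0 (sqrt (l i)) x)))" for i
    by (rule prob_space_normal_density) (simp add: l)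
  then interpret prob_space "density lborel (\<lambda>x. ennreal (normal_density 0 (sqrt (l i)) x))" for i .
  show "product_sigma_finite (\<lambda>i. density lborel (\<lambda>x. ennreal (normal_density 0 (sqrt (l i)) x)))"
    by unfold_locales
qed auto

section \<open>The normal law in eigenvector coordinates\<close>

lemma vec_mult_eq:
  assumes "S \<in> carrier_mat n n"
  shows "S *\<^sub>v vec n x = vec n (matv n S x)"
  using assms by (intro eq_vecI) (auto simp: scalar_prod_def matv_def atLeast0LessThan intro!: sum.cong)

text \<open>With the eigenvectors as columns of \<open>A\<close> and the eigenvalues on the diagonal
  of \<open>L\<close>, \<open>S * A = A * L\<close>; in determinants \<open>det A\<close> cancels,
  being nonzero by orthonormality.\<close>

lemma det_eq_prod_eigenvalues:
  assumes S: "S \<in> carrier_mat n n" and o: "orthonormal n v"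
    and eig: "\<And>j i. j < n \<Longrightarrow> i < n \<Longrightarrow> matv n S (v j) i = l j * v j i"
  shows "det S = (\<Prod>i<n. l i)"
proof -
  define A where "A = mat n n (\<lambda>(i, j). v j i)"
  define L where "L = mat n n (\<lambda>(i, j). if i = j then l i else 0)"
  have A: "A \<in> carrier_mat n n" and L: "L \<in> carrier_mat n n" by (auto simp: A_def L_def)
  have "transpose_mat A * A = 1\<^sub>m n"
    using o by (intro eq_matI)
      (auto simp: A_def orthonormal_def dotn_def scalar_prod_def atLeast0LessThan)
  then have "det (transpose_mat A) * det A = 1"
    using det_mult[of "transpose_mat A" n A] A by simp
  then have dA: "det A \<noteq> 0" by auto
  have "S * A = A * L"
  proof (rule eq_matI)
    fix i j assume ij: "i < dim_row (A * L)" "j < dim_col (A * L)"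
    then have ij: "i < n" "j < n" using A L by auto
    have "(S * A) $$ (i, j) = matv n S (v j) i"
      using ij S A by (auto simp: scalar_prod_def A_def matv_def atLeast0LessThan intro!: sum.cong)
    also have "\<dots> = l j * v j i" using eig ij by simp
    also have "\<dots> = (\<Sum>k<n. if k = j then v k i * l k else 0)" using ij by simp
    also have "\<dots> = (\<Sum>k<n. v k i * (if k = j then l k else 0))" by (intro sum.cong) auto
    also have "\<dots> = (A * L) $$ (i, j)"
      using ij by (auto simp: scalar_prod_def A_def L_def atLeast0LessThan intro!: sum.cong)
    finally show "(S * A) $$ (i, j) = (A * L) $$ (i, j)" .
  qed (use S A L in auto)
  then have "det S * det A = det A * det L"
    using det_mult[OF S A] det_mult[OF A L] by metis
  then have "det S = det L" using dA by auto
  also have "\<dots> = prod_list (diag_mat L)"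
    by (rule det_upper_triangular[OF _ L]) (auto simp: L_def)
  also have "\<dots> = (\<Prod>i<n. l i)"
    using L by (simp add: prod_list_diag_prod atLeast0LessThan) (simp add: L_def)
  finally show ?thesis .
qed

text \<open>The inverse covariance only has to be known at one vector. The vector \<open>u\<close>
  with eigenbasis coordinates \<open>x j / l j\<close> is mapped by \<open>S\<close> to the centred
  point \<open>w\<close>, so the inverse maps \<open>w\<close> to \<open>u\<close>, and Parseval's
  identity evaluates the exponent.\<close>

lemma gauss_density_rot:
  assumes S: "S \<in> carrier_mat n n" and o: "orthonormal n v" and m: "m \<in> carrier_vec n"
    and eig: "\<And>j i. j < n \<Longrightarrow> i < n \<Longrightarrow> matv n S (v j) i = l j * v j i"
    and l: "\<And>i. 0 < l i"
  shows "ennreal (gauss_density n m S (rot n v (vec_index m) x)) = (\<Prod>i<n. ennreal (normal_density 0 (sqrt (l i)) (x i)))"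
proof -
  have dS: "det S = (\<Prod>i<n. l i)" by (rule det_eq_prod_eigenvalues[OF S o eig])
  then have "det S \<noteq> 0" using l by (metis less_numeral_extra(3) prod_pos)
  then have "S \<in> Units (ring_mat TYPE(real) n ())" by (rule det_non_zero_imp_unit[OF S])
  then obtain B where B: "mat_inverse S = Some B"
    using mat_inverse(1)[OF S, of "()"] by (cases "mat_inverse S") auto
  then have BS: "B * S = 1\<^sub>m n" and Bc: "B \<in> carrier_mat n n" using mat_inverse(2)[OF S] by auto
  define w where "w i = (\<Sum>j<n. v j i * x j)" for i
  define u where "u i = (\<Sum>j<n. v j i * (x j / l j))" for i
  have wv: "vec n (rot n v (vec_index m) x) - m = vec n w"
    using m by (intro eq_vecI) (auto simp: rot_def w_def)
  have Su: "S *\<^sub>v vec n u = vec n w"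
  proof -
    have "matv n S u i = w i" if i: "i < n" for i
    proof -
      have "matv n S u i = (\<Sum>k<n. \<Sum>j<n. S $$ (i, k) * v j k * (x j / l j))"
        by (simp add: matv_def u_def sum_distrib_left mult.assoc)
      also have "\<dots> = (\<Sum>j<n. \<Sum>k<n. S $$ (i, k) * v j k * (x j / l j))" by (rule sum.swap)
      also have "\<dots> = (\<Sum>j<n. matv n S (v j) i * (x j / l j))"
        by (simp add: matv_def sum_distrib_right sum_divide_distrib)
      also have "\<dots> = (\<Sum>j<n. v j i * x j)"
      proof (intro sum.cong refl)
        fix j assume "j \<in> {..<n}"
        then show "matv n S (v j) i * (x j / l j) = v j i * x j"
          using l[of j] i by (simp add: eig)
      qed
      finally show ?thesis by (simp add: w_def)
    qed
    then show ?thesis unfolding vec_mult_eq[OF S] by (intro eq_vecI) auto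
  qed
  have "B *\<^sub>v vec n w = (B * S) *\<^sub>v vec n u"
    unfolding Su[symmetric] using Bc S by (simp add: assoc_mult_mat_vec[of B n n S n])
  also have "\<dots> = vec n u" unfolding BS by simp
  finally have Bw: "B *\<^sub>v vec n w = vec n u" .
  have "scalar_prod (vec n w) (vec n u) = dotn n w u"
    by (auto simp: scalar_prod_def dotn_def atLeast0LessThan)
  also have "\<dots> = (\<Sum>j<n. x j * (x j / l j))"
    unfolding w_def u_def by (rule Parseval[OF o])
  finally have sp: "scalar_prod (vec n w) (vec n u) = (\<Sum>j<n. (x j)\<^sup>2 / l j)" by (simp add: power2_eq_square)
  have "gauss_density n m S (rot n v (vec_index m) x) = exp (- (\<Sum>j<n. (x j)\<^sup>2 / l j) / 2) / sqrt ((2 * pi) ^ n * (\<Prod>i<n. l i))"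
    by (simp add: gauss_density_def wv B Bw sp dS)
  also have "\<dots> = (\<Prod>i<n. exp (- (x i)\<^sup>2 / (2 * l i)) / sqrt (2 * pi * l i))"
  proof -
    have "(2 * pi) ^ n * (\<Prod>i<n. l i) = (\<Prod>i<n. 2 * pi * l i)" by (simp add: prod.distrib)
    moreover have "sqrt (\<Prod>i<n. 2 * pi * l i) = (\<Prod>i<n. sqrt (2 * pi * l i))"
      by (induction n) (auto simp: real_sqrt_mult)
    moreover have "exp (- (\<Sum>j<n. (x j)\<^sup>2 / l j) / 2) = (\<Prod>i<n. exp (- (x i)\<^sup>2 / (2 * l i)))"
      by (simp add: exp_sum[symmetric] sum_negf sum_divide_distrib mult.commute)
    ultimately show ?thesis by (simp add: prod_dividef)
  qed
  also have "\<dots> = (\<Prod>i<n. normal_density 0 (sqrt (l i)) (x i))"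
    using l by (intro prod.cong refl) (simp add: normal_density_def less_imp_le)
  finally show ?thesis by (simp add: prod_ennreal)
qed

text \<open>From here on the data are independent centred normals moved by an isometry, so that
  water-filling can work on one coordinate at a time.\<close>

lemma gaussian_eq_rot_normal_prod:
  assumes g: "gaussian P n X m S"
    and S: "S \<in> carrier_mat n n" and o: "orthonormal n v" and m: "m \<in> carrier_vec n"
    and eig: "\<And>j i. j < n \<Longrightarrow> i < n \<Longrightarrow> matv n S (v j) i = l j * v j i"
    and l: "\<And>i. 0 < l i"
  shows "distr P (Rn n) X = distr (normal_prod n l) (Rn n) (rot n v (vec_index m))"
proof -
  let ?T = "rot n v (vec_index m)"
  let ?D = "distr (normal_prod n l) (Rn n) ?T"
  let ?L = "\<Pi>\<^sub>M i\<in>{..<n}. (lborel :: real measure)"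
  let ?p = "\<lambda>y. ennreal (gauss_density n m S y)"
  have pm: "(\<lambda>x. \<Prod>i<n. ennreal (normal_density 0 (sqrt (l i)) (x i))) \<in> borel_measurable ?L"
    by measurable
  have s: "sets ?L = sets (Rn n)" unfolding Rn_def
    by (intro sets_PiM_cong) auto
  then have sp: "space ?L = space (Rn n)" by (rule sets_eq_imp_space_eq)
  note [measurable_cong] = s
  have [measurable]: "?T \<in> Rn n \<rightarrow>\<^sub>M Rn n" unfolding Rn_def by measurable
  have p: "?p \<in> borel_measurable ?L" and X: "X \<in> P \<rightarrow>\<^sub>M ?L" and d: "distr P ?L X = density ?L ?p"
    using g by (auto simp: gaussian_def distributed_def)
  have [measurable]: "?p \<in> borel_measurable (Rn n)" using p by (simp add: measurable_cong_sets[OF s refl])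
  have "distr P (Rn n) X = distr P ?L X" by (intro distr_cong) (auto simp: s)
  also have "\<dots> = density ?L ?p" by (rule d)
  also have "\<dots> = ?D"
  proof (rule measure_eqI)
    fix A assume "A \<in> sets (density ?L ?p)"
    then have [measurable]: "A \<in> sets (Rn n)" by (simp add: s)
    have AL[measurable]: "A \<in> sets ?L" using s by simp
    have AT: "?T -` A \<inter> space (Rn n) \<in> sets ?L" unfolding s by measurable
    have "emeasure (density ?L ?p) A = (\<integral>\<^sup>+y. ?p y * indicator A y \<partial>?L)"
      by (rule emeasure_density) (use p AL in auto)
    also have "\<dots> = (\<integral>\<^sup>+x. ?p (?T x) * indicator A (?T x) \<partial>?L)"
      by (rule nn_integral_PiM_lborel_rot[OF o, symmetric]) (unfold Rn_def[symmetric], measurable)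
    also have "\<dots> = (\<integral>\<^sup>+x. (\<Prod>i<n. ennreal (normal_density 0 (sqrt (l i)) (x i))) * indicator (?T -` A \<inter> space (Rn n)) x \<partial>?L)"
      by (intro nn_integral_cong) (auto simp: gauss_density_rot[OF S o m eig l] sp split: split_indicator)
    also have "\<dots> = emeasure (normal_prod n l) (?T -` A \<inter> space (Rn n))"
      unfolding normal_prod_eq_density[OF l] by (rule emeasure_density[OF pm AT, symmetric])
    also have "\<dots> = emeasure ?D A"
      unfolding normal_prod_eq_density[OF l] by (subst emeasure_distr) (auto simp: sp)
    finally show "emeasure (density ?L ?p) A = emeasure ?D A" .
  qed (simp add: s)
  finally show ?thesis .
qed

section \<open>Eigenvalues and the operator norm\<close>

text \<open>A real supremum is known to be an upper bound only if the set is bounded; a crude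
  entrywise estimate suffices for that.\<close>

lemma mat_opnorm_bdd:
  assumes S: "S \<in> carrier_mat n n"
  shows "bdd_above ((\<lambda>v. sqrt (scalar_prod (S *\<^sub>v v) (S *\<^sub>v v))) ` {v \<in> carrier_vec (dim_col S). scalar_prod v v \<le> 1})"
proof (rule bdd_aboveI2)
  fix v assume "v \<in> {v \<in> carrier_vec (dim_col S). scalar_prod v v \<le> (1::real)}"
  then have v: "v \<in> carrier_vec n" and v1: "scalar_prod v v \<le> 1" using S by auto
  have vi: "\<bar>v $ i\<bar> \<le> 1" if "i < n" for i
  proof -
    have "v $ i * v $ i \<le> (\<Sum>j<n. v $ j * v $ j)" using that by (intro member_le_sum) auto
    also have "\<dots> \<le> 1" using v1 v by (simp add: scalar_prod_def atLeast0LessThan)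
    finally show ?thesis by (simp add: abs_square_le_1 power2_eq_square[symmetric])
  qed
  have Sv: "\<bar>(S *\<^sub>v v) $ i\<bar> \<le> (\<Sum>j<n. \<bar>S $$ (i, j)\<bar>)" if "i < n" for i
  proof -
    have "\<bar>(S *\<^sub>v v) $ i\<bar> = \<bar>\<Sum>j<n. S $$ (i, j) * v $ j\<bar>"
      using that S v by (auto simp: scalar_prod_def atLeast0LessThan intro!: arg_cong[of _ _ abs] sum.cong)
    also have "\<dots> \<le> (\<Sum>j<n. \<bar>S $$ (i, j) * v $ j\<bar>)" by (rule sum_abs)
    also have "\<dots> \<le> (\<Sum>j<n. \<bar>S $$ (i, j)\<bar>)"
      using vi by (intro sum_mono) (simp add: abs_mult mult_left_le)
    finally show ?thesis .
  qed
  have "scalar_prod (S *\<^sub>v v) (S *\<^sub>v v) = (\<Sum>i<n. ((S *\<^sub>v v) $ i)\<^sup>2)"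
    using S by (simp add: scalar_prod_def atLeast0LessThan power2_eq_square)
  also have "\<dots> \<le> (\<Sum>i<n. (\<Sum>j<n. \<bar>S $$ (i, j)\<bar>)\<^sup>2)"
    using Sv by (intro sum_mono) (metis abs_ge_zero lessThan_iff power2_abs power_mono)
  finally show "sqrt (scalar_prod (S *\<^sub>v v) (S *\<^sub>v v)) \<le> sqrt (\<Sum>i<n. (\<Sum>j<n. \<bar>S $$ (i, j)\<bar>)\<^sup>2)" by simp
qed

lemma eigenvalue_le_opnorm:
  assumes S: "S \<in> carrier_mat n n" and x: "dotn n x x = 1"
    and eig: "\<And>i. i < n \<Longrightarrow> matv n S x i = l * x i"
  shows "\<bar>l\<bar> \<le> mat_opnorm S"
proof -
  have vx: "vec n x \<in> {v \<in> carrier_vec (dim_col S). scalar_prod v v \<le> (1::real)}"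
    using S x by (auto simp: scalar_prod_def dotn_def atLeast0LessThan)
  have "S *\<^sub>v vec n x = vec n (\<lambda>i. l * x i)"
    unfolding vec_mult_eq[OF S] using eig by (intro eq_vecI) auto
  then have "scalar_prod (S *\<^sub>v vec n x) (S *\<^sub>v vec n x) = l\<^sup>2 * dotn n x x"
    by (simp add: scalar_prod_def dotn_def atLeast0LessThan sum_distrib_left power2_eq_square ac_simps)
  then have "\<bar>l\<bar> = sqrt (scalar_prod (S *\<^sub>v vec n x) (S *\<^sub>v vec n x))" using x by simp
  also have "\<dots> \<le> mat_opnorm S"
    unfolding mat_opnorm_def by (rule cSUP_upper[OF vx mat_opnorm_bdd[OF S]])
  finally show ?thesis .
qed

lemma pos_def_spectral:
  assumes "pos_def_mat n S"
  obtains v l where "orthonormal n v" "\<And>j i. j < n \<Longrightarrow> i < n \<Longrightarrow> matv n S (v j) i = l j * v j i"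
    "\<And>i. 0 < l i" "\<And>j. j < n \<Longrightarrow> l j \<le> mat_opnorm S"
proof -
  have S: "S \<in> carrier_mat n n" and t: "transpose_mat S = S"
    and pos: "\<And>v. v \<in> carrier_vec n \<Longrightarrow> v \<noteq> 0\<^sub>v n \<Longrightarrow> 0 < scalar_prod v (S *\<^sub>v v)"
    using assms by (auto simp: pos_def_mat_def)
  have sym: "S $$ (i, j) = S $$ (j, i)" if "i < n" "j < n" for i j
    using arg_cong[OF t, of "\<lambda>A. A $$ (i, j)"] that S by simp
  obtain v l where o: "orthonormal n v"
    and eig: "\<And>j i. j < n \<Longrightarrow> i < n \<Longrightarrow> matv n S (v j) i = l j * v j i"
    using symmetric_matrix_spectral[of n S, OF sym] unfolding orthonormal_def by blast
  have vv: "dotn n (v j) (v j) = 1" if "j < n" for j using o that by (simp add: orthonormal_def)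
  have lpos: "0 < l j" if j: "j < n" for j
  proof -
    have "scalar_prod (vec n (v j)) (vec n (v j)) = 1"
      using vv[OF j] by (simp add: scalar_prod_def dotn_def atLeast0LessThan)
    then have "vec n (v j) \<noteq> 0\<^sub>v n" by (metis scalar_prod_left_zero vec_carrier zero_neq_one)
    then have "0 < scalar_prod (vec n (v j)) (vec n (matv n S (v j)))"
      using pos[of "vec n (v j)"] by (simp add: vec_mult_eq[OF S])
    also have "\<dots> = dotn n (v j) (\<lambda>i. l j * v j i)"
      using eig j by (simp add: scalar_prod_def dotn_def atLeast0LessThan)
    also have "\<dots> = l j" using vv[OF j] by (simp add: dotn_linear)
    finally show ?thesis .
  qed
  show ?thesis
  proof (rule that)
    show "orthonormal n v" by (rule o)
    \<comment> \<open>The eigenvalues are continued by 1 beyond \<open>n\<close>, so that positivity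
      holds at every index and needs no side condition later.\<close>
    show "matv n S (v j) i = (if j < n then l j else 1) * v j i" if "j < n" "i < n" for j i
      using eig that by simp
    show "0 < (if i < n then l i else 1)" for i using lpos by simp
    show "(if j < n then l j else 1) \<le> mat_opnorm S" if j: "j < n" for j
      using eigenvalue_le_opnorm[OF S vv[OF j], of "l j"] eig j by auto
  qed
qed

section \<open>Joint laws and relative entropy\<close>

lemma joint_law_kernel:
  assumes "K \<in> Q \<rightarrow>\<^sub>M prob_algebra N"
  shows "(\<lambda>x. distr (K x) (Q \<Otimes>\<^sub>M N) (\<lambda>z. (x, z))) \<in> Q \<rightarrow>\<^sub>M subprob_algebra (Q \<Otimes>\<^sub>M N)"
  by (rule measurable_distr2[OF _ measurable_prob_algebraD[OF assms]]) simp

lemma space_prob_kernel: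
  assumes "K \<in> Q \<rightarrow>\<^sub>M prob_algebra N" "x \<in> space Q"
  shows "prob_space (K x)" "sets (K x) = sets N" "space (K x) = space N"
proof -
  show "prob_space (K x)" and s: "sets (K x) = sets N"
    using measurable_space[OF assms] by (auto simp: space_prob_algebra)
  show "space (K x) = space N" by (rule sets_eq_imp_space_eq[OF s])
qed

lemma sets_joint_law:
  assumes "K \<in> Q \<rightarrow>\<^sub>M prob_algebra N" "space Q \<noteq> {}"
  shows "sets (joint_law Q K N) = sets (Q \<Otimes>\<^sub>M N)"
  unfolding joint_law_def by (rule sets_bind) (use assms in auto)

lemma nn_integral_joint_law:
  assumes K: "K \<in> Q \<rightarrow>\<^sub>M prob_algebra N" and f[measurable]: "f \<in> borel_measurable (Q \<Otimes>\<^sub>M N)"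
  shows "(\<integral>\<^sup>+p. f p \<partial>joint_law Q K N) = (\<integral>\<^sup>+x. \<integral>\<^sup>+z. f (x, z) \<partial>K x \<partial>Q)"
proof -
  have "(\<integral>\<^sup>+p. f p \<partial>joint_law Q K N) = (\<integral>\<^sup>+x. \<integral>\<^sup>+p. f p \<partial>distr (K x) (Q \<Otimes>\<^sub>M N) (\<lambda>z. (x, z)) \<partial>Q)"
    unfolding joint_law_def by (rule nn_integral_bind[OF f joint_law_kernel[OF K]])
  also have "\<dots> = (\<integral>\<^sup>+x. \<integral>\<^sup>+z. f (x, z) \<partial>K x \<partial>Q)"
  proof (rule nn_integral_cong)
    fix x assume x: "x \<in> space Q"
    note [measurable_cong] = space_prob_kernel(2)[OF K x]
    show "(\<integral>\<^sup>+p. f p \<partial>distr (K x) (Q \<Otimes>\<^sub>M N) (\<lambda>z. (x, z))) = (\<integral>\<^sup>+z. f (x, z) \<partial>K x)"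
      by (rule nn_integral_distr) (use x in measurable)
  qed
  finally show ?thesis .
qed

lemma prob_space_joint_law:
  assumes Q: "prob_space Q" and K: "K \<in> Q \<rightarrow>\<^sub>M prob_algebra N"
  shows "prob_space (joint_law Q K N)"
proof (rule prob_spaceI)
  interpret Q: prob_space Q by fact
  have "emeasure (joint_law Q K N) (space (joint_law Q K N)) = (\<integral>\<^sup>+p. 1 \<partial>joint_law Q K N)" by simp
  also have "\<dots> = (\<integral>\<^sup>+x. \<integral>\<^sup>+z. 1 \<partial>K x \<partial>Q)" by (rule nn_integral_joint_law[OF K]) simp
  also have "\<dots> = (\<integral>\<^sup>+x. 1 \<partial>Q)"
    by (intro nn_integral_cong) (simp add: prob_space.emeasure_space_1[OF space_prob_kernel(1)[OF K]])
  finally show "emeasure (joint_law Q K N) (space (joint_law Q K N)) = 1" by (simp add: Q.emeasure_space_1)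
qed

lemma sets_bind_kernel:
  assumes "K \<in> Q \<rightarrow>\<^sub>M prob_algebra N" "space Q \<noteq> {}"
  shows "sets (Q \<bind> K) = sets N"
  by (rule sets_bind) (use assms space_prob_kernel(2)[OF assms(1)] in auto)

lemma prob_space_bind_kernel:
  assumes Q: "prob_space Q" and K: "K \<in> Q \<rightarrow>\<^sub>M prob_algebra N"
  shows "prob_space (Q \<bind> K)"
  by (rule prob_space_bind'[where M = Q]) (use assms in \<open>auto simp: space_prob_algebra\<close>)

text \<open>Only an inequality holds: where the density is 0 or infinite, density times quotient is
  0 in \<open>ennreal\<close>, while \<open>f\<close> still counts under \<open>Q\<close>.\<close>

lemma nn_integral_divide_RN_deriv_le:
  assumes Q: "sigma_finite_measure Q" and ac: "absolutely_continuous Q P" and s: "sets P = sets Q"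
    and [measurable]: "f \<in> borel_measurable Q"
  shows "(\<integral>\<^sup>+x. f x / RN_deriv Q P x \<partial>P) \<le> (\<integral>\<^sup>+x. f x \<partial>Q)"
proof -
  interpret Q: sigma_finite_measure Q by fact
  have P: "P = density Q (RN_deriv Q P)" using Q.density_RN_deriv[OF ac s] by simp
  have "(\<integral>\<^sup>+x. f x / RN_deriv Q P x \<partial>P) = (\<integral>\<^sup>+x. RN_deriv Q P x * (f x / RN_deriv Q P x) \<partial>Q)"
  proof -
    have "(\<integral>\<^sup>+x. f x / RN_deriv Q P x \<partial>density Q (RN_deriv Q P))
      = (\<integral>\<^sup>+x. RN_deriv Q P x * (f x / RN_deriv Q P x) \<partial>Q)"
      by (rule nn_integral_density) auto
    then show ?thesis by (simp only: P[symmetric])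
  qed
  also have "\<dots> \<le> (\<integral>\<^sup>+x. f x \<partial>Q)"
  proof (intro nn_integral_mono)
    fix x
    show "RN_deriv Q P x * (f x / RN_deriv Q P x) \<le> f x"
    proof (cases "RN_deriv Q P x = 0 \<or> RN_deriv Q P x = \<infinity>")
      case True
      then show ?thesis by (auto simp: divide_ennreal_def)
    next
      case False
      then show ?thesis
        by (auto simp: ennreal_times_divide ennreal_mult_divide_eq mult.commute[of _ "f x"])
    qed
  qed
  finally show ?thesis .
qed

lemma AE_RN_deriv_pos_finite:
  assumes Q: "sigma_finite_measure Q" and P: "sigma_finite_measure P"
    and ac: "absolutely_continuous Q P" and s: "sets P = sets Q"
  shows "AE x in P. 0 < RN_deriv Q P x \<and> RN_deriv Q P x < \<infinity>"
proof -
  interpret Q: sigma_finite_measure Q by fact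
  have Pd: "P = density Q (RN_deriv Q P)" using Q.density_RN_deriv[OF ac s] by simp
  have "AE x in P. 0 < RN_deriv Q P x"
    by (subst Pd, subst AE_density) auto
  moreover have "AE x in P. RN_deriv Q P x \<noteq> \<infinity>"
    by (rule absolutely_continuous_AE[OF s ac Q.RN_deriv_finite[OF P ac s]])
  ultimately show ?thesis by eventually_elim (auto simp: less_top)
qed

text \<open>The Donsker--Varadhan inequality, from \<open>ln x \<le> x - 1\<close>.\<close>

lemma integral_le_relative_entropy:
  assumes Q: "prob_space Q" and P: "prob_space P" and s: "sets P = sets Q"
    and int: "integrable P \<psi>" and exp1: "(\<integral>\<^sup>+x. ennreal (exp (\<psi> x)) \<partial>Q) \<le> 1"
  shows "ennreal (integral\<^sup>L P \<psi> / ln 2) \<le> relative_entropy P Q"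
proof (cases "absolutely_continuous Q P \<and> integrable P (entropy_density 2 Q P)")
  case False
  then have "relative_entropy P Q = \<infinity>" unfolding relative_entropy_def by (rule if_not_P)
  then show ?thesis by simp
next
  case True
  then have ac: "absolutely_continuous Q P" and ied: "integrable P (entropy_density 2 Q P)" by auto
  interpret Q: prob_space Q by fact
  interpret P: prob_space P by fact
  have [measurable]: "\<psi> \<in> borel_measurable P" using int by auto
  then have [measurable]: "\<psi> \<in> borel_measurable Q" by (simp add: measurable_cong_sets[OF s refl])
  note [measurable_cong] = s
  define r where "r x = RN_deriv Q P x" for x
  have [measurable]: "r \<in> borel_measurable P" unfolding r_def by (simp add: measurable_cong_sets[OF s refl])
  \<comment> \<open>\<open>q\<close> has \<open>P\<close>-mean at most 1, so the right side of
    \<open>ln q \<le> q - 1\<close> is nonpositive in the mean, and \<open>ln q\<close> is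
    \<open>\<psi>\<close> minus the log-density.\<close>
  define q where "q x = enn2real (ennreal (exp (\<psi> x)) / r x)" for x
  have q1: "(\<integral>\<^sup>+x. ennreal (exp (\<psi> x)) / r x \<partial>P) \<le> 1"
    using nn_integral_divide_RN_deriv_le[OF Q.sigma_finite_measure_axioms ac s, of "\<lambda>x. ennreal (exp (\<psi> x))"] exp1
    unfolding r_def by simp
  have fin: "AE x in P. 0 < r x \<and> r x < \<infinity>"
    unfolding r_def by (rule AE_RN_deriv_pos_finite[OF Q.sigma_finite_measure_axioms P.sigma_finite_measure_axioms ac s])
  have qe: "AE x in P. ennreal (exp (\<psi> x)) / r x = ennreal (q x)"
    using fin by eventually_elim (auto simp: q_def ennreal_divide_eq_top_iff less_top[symmetric])
  have qint: "integrable P q" and q1': "integral\<^sup>L P q \<le> 1"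
  proof -
    have [measurable]: "q \<in> borel_measurable P" unfolding q_def by measurable
    have le: "(\<integral>\<^sup>+x. ennreal (q x) \<partial>P) \<le> 1"
      using q1 nn_integral_cong_AE[OF qe] by simp
    have q0: "0 \<le> q x" for x by (simp add: q_def)
    show i: "integrable P q"
      by (rule integrableI_nonneg) (use le q0 in \<open>auto intro: le_less_trans\<close>)
    show "integral\<^sup>L P q \<le> 1"
      using le nn_integral_eq_integral[OF i] q0 by simp
  qed
  have "AE x in P. \<psi> x \<le> q x - 1 + ln 2 * entropy_density 2 Q P x"
    using fin
  proof eventually_elim
    case (elim x)
    define t where "t = enn2real (r x)"
    have t: "0 < t" "r x = ennreal t" using elim by (auto simp: t_def enn2real_positive_iff)
    have "q x = exp (\<psi> x) / t" using t by (simp add: q_def divide_ennreal)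
    moreover have "ln (exp (\<psi> x) / t) \<le> exp (\<psi> x) / t - 1" using t by (intro ln_le_minus_one) simp
    moreover have "ln (exp (\<psi> x) / t) = \<psi> x - ln t" using t by (simp add: ln_div)
    moreover have "ln 2 * entropy_density 2 Q P x = ln t"
      by (simp add: entropy_density_def t_def r_def log_def)
    ultimately show ?case by simp
  qed
  then have "integral\<^sup>L P \<psi> \<le> integral\<^sup>L P (\<lambda>x. q x - 1 + ln 2 * entropy_density 2 Q P x)"
    by (intro integral_mono_AE) (use int qint ied in auto)
  also have "\<dots> = integral\<^sup>L P q - 1 + ln 2 * KL_divergence 2 Q P"
    using qint ied by (simp add: KL_divergence_def P.prob_space)
  also have "\<dots> \<le> ln 2 * KL_divergence 2 Q P" using q1' by simp
  finally have "integral\<^sup>L P \<psi> / ln 2 \<le> KL_divergence 2 Q P" by (simp add: field_simps)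
  then show ?thesis using True by (simp add: relative_entropy_def ennreal_leI)
qed

text \<open>Integrability of \<open>f\<close> keeps the divergence out of the infinite branch of its
  definition; almost sure uniqueness of densities identifies \<open>entropy_density\<close> with
  \<open>f / ln 2\<close>.\<close>

lemma relative_entropy_density:
  assumes Q: "prob_space Q" and [measurable]: "f \<in> borel_measurable Q"
    and P: "prob_space (density Q (\<lambda>x. ennreal (exp (f x))))"
    and int: "integrable (density Q (\<lambda>x. ennreal (exp (f x)))) f"
  shows "relative_entropy (density Q (\<lambda>x. ennreal (exp (f x)))) Q
    = ennreal (integral\<^sup>L (density Q (\<lambda>x. ennreal (exp (f x)))) f / ln 2)"
proof -
  interpret Q: prob_space Q by fact
  let ?P = "density Q (\<lambda>x. ennreal (exp (f x)))"
  have ac: "absolutely_continuous Q ?P"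
    unfolding absolutely_continuous_def null_sets_density_iff by (auto simp: null_sets_density_iff AE_not_in)
  have "AE x in Q. ennreal (exp (f x)) = RN_deriv Q ?P x"
    by (rule Q.RN_deriv_unique) auto
  then have "AE x in ?P. ennreal (exp (f x)) = RN_deriv Q ?P x"
    by (subst AE_density) auto
  then have ed: "AE x in ?P. entropy_density 2 Q ?P x = f x / ln 2"
  proof eventually_elim
    case (elim x)
    then show ?case by (simp add: entropy_density_def log_def flip: elim)
  qed
  have "integrable ?P (entropy_density 2 Q ?P)"
    using int by (subst integrable_cong_AE[OF _ _ ed]) auto
  moreover have "KL_divergence 2 Q ?P = integral\<^sup>L ?P f / ln 2"
    unfolding KL_divergence_def by (subst integral_cong_AE[OF _ _ ed]) auto
  ultimately show ?thesis using ac by (simp add: relative_entropy_def)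
qed

section \<open>Reverse water-filling\<close>

lemma distr_std_gauss_affine:
  assumes "0 < s"
  shows "distr std_gauss borel (\<lambda>g. t + s * g) = density lborel (\<lambda>x. ennreal (normal_density t s x))"
proof -
  have "distributed std_gauss lborel (\<lambda>x. x) (\<lambda>x. ennreal (std_normal_density x))"
    unfolding distributed_def
    by (auto simp: std_gauss_def intro!: distr_id2)
  then have "distributed std_gauss lborel (\<lambda>x. t + s * x) (\<lambda>x. ennreal (normal_density (t + s * 0) (\<bar>s\<bar> * 1) x))"
    by (rule std_gauss.normal_density_affine) (use assms in auto)
  then have "distr std_gauss lborel (\<lambda>x. t + s * x) = density lborel (\<lambda>x. ennreal (normal_density t s x))"
    using assms by (simp add: distributed_def)
  moreover have "distr std_gauss borel (\<lambda>g. t + s * g) = distr std_gauss lborel (\<lambda>x. t + s * x)"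
    by (intro distr_cong) auto
  ultimately show ?thesis by simp
qed

lemma nn_integral_std_gauss_affine_square:
  "(\<integral>\<^sup>+g. ennreal ((t + s * g)\<^sup>2) \<partial>std_gauss) = ennreal (t\<^sup>2 + s\<^sup>2)"
proof -
  have 1: "has_bochner_integral lborel std_normal_density 1"
    using std_normal_moment_even[of 0] by simp
  have 2: "has_bochner_integral lborel (\<lambda>x. std_normal_density x * x) 0"
    using std_normal_moment_odd[of 0] by simp
  have 3: "has_bochner_integral lborel (\<lambda>x. std_normal_density x * x\<^sup>2) 1"
    using std_normal_moment_even[of 1] by (simp add: numeral_2_eq_2[symmetric] fact_numeral)
  have "has_bochner_integral lborel (\<lambda>x. t\<^sup>2 * std_normal_density x + (2 * t * s * (std_normal_density x * x) + s\<^sup>2 * (std_normal_density x * x\<^sup>2)))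
    (t\<^sup>2 * 1 + (2 * t * s * 0 + s\<^sup>2 * 1))"
    by (intro has_bochner_integral_add has_bochner_integral_mult_right 1 2 3)
  also have "(\<lambda>x. t\<^sup>2 * std_normal_density x + (2 * t * s * (std_normal_density x * x) + s\<^sup>2 * (std_normal_density x * x\<^sup>2)))
    = (\<lambda>x. std_normal_density x * (t + s * x)\<^sup>2)"
    by (intro ext) (simp add: power2_eq_square algebra_simps)
  finally have "(\<integral>\<^sup>+x. ennreal (std_normal_density x * (t + s * x)\<^sup>2) \<partial>lborel) = ennreal (t\<^sup>2 + s\<^sup>2)"
    by (subst nn_integral_eq_integral) (auto simp: has_bochner_integral_iff)
  then show ?thesis by (subst nn_integral_std_gauss) (auto simp: ennreal_mult)
qed

lemma nn_integral_normal_square: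
  assumes "0 < l"
  shows "(\<integral>\<^sup>+x. ennreal (x\<^sup>2) \<partial>density lborel (\<lambda>x. ennreal (normal_density 0 (sqrt l) x))) = ennreal l"
proof -
  have "(\<integral>\<^sup>+x. ennreal (x\<^sup>2) \<partial>density lborel (\<lambda>x. ennreal (normal_density 0 (sqrt l) x)))
    = (\<integral>\<^sup>+g. ennreal ((0 + sqrt l * g)\<^sup>2) \<partial>std_gauss)"
    using assms by (subst distr_std_gauss_affine[symmetric]) (auto simp: nn_integral_distr)
  then show ?thesis using assms nn_integral_std_gauss_affine_square[of 0 "sqrt l"] by simp
qed

lemma nn_integral_PiM_component:
  assumes "\<And>i. i \<in> I \<Longrightarrow> prob_space (M i)" "i \<in> I" and [measurable]: "f \<in> borel_measurable (M i)"
  shows "(\<integral>\<^sup>+x. f (x i) \<partial>PiM I M) = (\<integral>\<^sup>+x. f x \<partial>M i)"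
proof -
  have "distr (PiM I M) (M i) (\<lambda>x. x i) = M i"
    by (rule distr_PiM_component) (use assms in auto)
  then have "(\<integral>\<^sup>+x. f x \<partial>M i) = (\<integral>\<^sup>+x. f x \<partial>distr (PiM I M) (M i) (\<lambda>x. x i))" by simp
  also have "\<dots> = (\<integral>\<^sup>+x. f (x i) \<partial>PiM I M)"
    by (rule nn_integral_distr) (use assms(2) in measurable)
  finally show ?thesis ..
qed

text \<open>One coordinate of the logarithm of the density of the optimal joint law with respect to
  the product of its marginals. The Lagrange multiplier \<open>1 / (2 * w)\<close> belongs to the water level
  \<open>w\<close>.\<close>

definition wf_phi :: "real \<Rightarrow> real \<Rightarrow> real \<Rightarrow> real \<Rightarrow> real" where
  "wf_phi w l x z = ln (l / min l w) / 2 - (x - z)\<^sup>2 / (2 * w) + x\<^sup>2 / (2 * max l w)"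

lemma wf_phi_measurable[measurable]:
  "(\<lambda>p. wf_phi w l (f p) (g p)) \<in> borel_measurable M"
  if "f \<in> borel_measurable M" "g \<in> borel_measurable M"
  using that unfolding wf_phi_def by measurable

lemma exp_wf_phi_high:
  assumes "0 < w" "w < l"
  shows "exp (wf_phi w l x z) = sqrt (l / w) * exp (x\<^sup>2 / (2 * l) - (x - z)\<^sup>2 / (2 * w))"
proof -
  have "exp (ln (l / w) / 2) = sqrt (l / w)"
    using assms by (simp add: powr_half_sqrt[symmetric] powr_def)
  then show ?thesis using assms
    by (simp add: wf_phi_def exp_add exp_diff min_def max_def)
qed

text \<open>Below the water level the logarithm vanishes and the squares of \<open>x\<close> cancel,
  which leaves a function affine in \<open>x\<close>.\<close>

lemma wf_phi_low:
  assumes "0 < l" "l \<le> w"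
  shows "wf_phi w l x z = x * z / w - z\<^sup>2 / (2 * w)"
  using assms by (simp add: wf_phi_def power2_eq_square field_simps)

text \<open>The Kuhn--Tucker condition for one coordinate. Above the water level the integrand over
  Lebesgue measure is the density of the backward channel, \<open>x\<close> normal around
  \<open>z\<close> with variance \<open>w\<close>, and has integral 1. Below it, completing the
  square leaves a constant factor that is at most 1 because \<open>l \<le> w\<close>.\<close>

lemma nn_integral_exp_wf_phi_le_1:
  assumes w: "0 < w" and l: "0 < l"
  shows "(\<integral>\<^sup>+x. ennreal (exp (wf_phi w l x z)) \<partial>density lborel (\<lambda>x. ennreal (normal_density 0 (sqrt l) x))) \<le> 1"
proof -
  have eq: "(\<integral>\<^sup>+x. ennreal (exp (wf_phi w l x z)) \<partial>density lborel (\<lambda>x. ennreal (normal_density 0 (sqrt l) x)))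
    = (\<integral>\<^sup>+x. ennreal (normal_density 0 (sqrt l) x * exp (wf_phi w l x z)) \<partial>lborel)"
    by (subst nn_integral_density) (auto simp: ennreal_mult)
  show ?thesis
  proof (cases "w < l")
    case True
    have "normal_density 0 (sqrt l) x * exp (wf_phi w l x z) = normal_density z (sqrt w) x" for x
    proof -
      have "normal_density 0 (sqrt l) x * exp (wf_phi w l x z)
        = 1 / sqrt (2 * pi * l) * sqrt (l / w) * (exp (- x\<^sup>2 / (2 * l)) * exp (x\<^sup>2 / (2 * l) - (x - z)\<^sup>2 / (2 * w)))"
        using l by (simp add: normal_density_def exp_wf_phi_high[OF w True])
      also have "exp (- x\<^sup>2 / (2 * l)) * exp (x\<^sup>2 / (2 * l) - (x - z)\<^sup>2 / (2 * w)) = exp (- (x - z)\<^sup>2 / (2 * w))"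
        by (simp flip: exp_add)
      also have "1 / sqrt (2 * pi * l) * sqrt (l / w) = 1 / sqrt (2 * pi * w)"
        using w l by (simp add: real_sqrt_mult real_sqrt_divide)
      finally show ?thesis using w by (simp add: normal_density_def)
    qed
    then show ?thesis unfolding eq using w by (simp add: nn_integral_normal_density)
  next
    case False
    then have lw: "l \<le> w" by simp
    \<comment> \<open>The first term is half the square of the mean \<open>l * z / w\<close> divided
      by the variance \<open>l\<close>, which completing the square produces.\<close>
    define c where "c = exp (l * z\<^sup>2 / (2 * w\<^sup>2) - z\<^sup>2 / (2 * w))"
    have "l * z\<^sup>2 / (2 * w\<^sup>2) \<le> w * z\<^sup>2 / (2 * w\<^sup>2)"
      using lw by (intro divide_right_mono mult_right_mono) auto
    also have "\<dots> = z\<^sup>2 / (2 * w)" using w by (simp add: power2_eq_square)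
    finally have c1: "c \<le> 1" by (simp add: c_def)
    have "normal_density 0 (sqrt l) x * exp (wf_phi w l x z) = c * normal_density (l * z / w) (sqrt l) x" for x
    proof -
      have "- x\<^sup>2 / (2 * l) + (x * z / w - z\<^sup>2 / (2 * w)) = (l * z\<^sup>2 / (2 * w\<^sup>2) - z\<^sup>2 / (2 * w)) + - (x - l * z / w)\<^sup>2 / (2 * l)"
        using w l by (simp add: power2_eq_square field_simps)
      then show ?thesis using l
        by (simp add: normal_density_def c_def wf_phi_low[OF l lw] flip: exp_add)
    qed
    then have "(\<integral>\<^sup>+x. ennreal (normal_density 0 (sqrt l) x * exp (wf_phi w l x z)) \<partial>lborel)
      = (\<integral>\<^sup>+x. ennreal c * ennreal (normal_density (l * z / w) (sqrt l) x) \<partial>lborel)"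
      by (simp add: c_def flip: ennreal_mult)
    also have "\<dots> = ennreal c"
      using l by (subst nn_integral_cmult) (auto simp: nn_integral_normal_density)
    finally show ?thesis unfolding eq using c1 by (simp add: ennreal_le_1)
  qed
qed

text \<open>Bayes' rule: the forward channel relative to its own output law, which has variance
  \<open>l * a\<close>. Above the water level two normal densities are compared. Below it
  \<open>a = 0\<close>, both laws are the point mass at 0, and \<open>wf_phi\<close> vanishes at
  \<open>z = 0\<close>.\<close>

lemma wf_kernel_density:
  assumes w: "0 < w" and l: "0 < l" and a: "a = 1 - min l w / l"
  shows "distr std_gauss borel (\<lambda>g. a * x + sqrt (min l w * a) * g)
    = density (distr std_gauss borel (\<lambda>g. sqrt (l * a) * g)) (\<lambda>z. ennreal (exp (wf_phi w l x z)))"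
proof (cases "w < l")
  case True
  \<comment> \<open>\<open>b2\<close> is the variance of the channel noise and \<open>c2\<close>
    that of the output.\<close>
  define b2 where "b2 = w * (l - w) / l"
  define c2 where "c2 = l - w"
  have a': "a = c2 / l" using True l by (simp add: a c2_def field_simps)
  have b: "min l w * a = b2" using True by (simp add: a' b2_def c2_def)
  have c: "l * a = c2" using l by (simp add: a')
  have pos: "0 < b2" "0 < c2" using True w l by (auto simp: b2_def c2_def)
  have D1: "distr std_gauss borel (\<lambda>g. sqrt c2 * g) = density lborel (\<lambda>x. ennreal (normal_density 0 (sqrt c2) x))"
    using distr_std_gauss_affine[of "sqrt c2" 0] pos by simp
  have D2: "distr std_gauss borel (\<lambda>g. a * x + sqrt b2 * g) = density lborel (\<lambda>z. ennreal (normal_density (a * x) (sqrt b2) z))"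
    using pos by (intro distr_std_gauss_affine) simp
  have P: "normal_density (a * x) (sqrt b2) z = normal_density 0 (sqrt c2) z * exp (wf_phi w l x z)" for z
  proof -
    have e: "- (z - a * x)\<^sup>2 / (2 * b2) = - z\<^sup>2 / (2 * c2) + (x\<^sup>2 / (2 * l) - (x - z)\<^sup>2 / (2 * w))"
    proof -
      have "(z - a * x)\<^sup>2 / (2 * b2) = (l * z - c2 * x)\<^sup>2 / (2 * l * w * c2)"
        using pos w l by (simp add: a' b2_def c2_def[symmetric] power2_eq_square field_simps)
      also have "\<dots> = z\<^sup>2 / (2 * c2) - x\<^sup>2 / (2 * l) + (x - z)\<^sup>2 / (2 * w)"
      proof -
        \<comment> \<open>Eliminating \<open>l\<close> turns the completion of the square into a
          polynomial identity in \<open>c2\<close> and \<open>w\<close>.\<close>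
        have lw: "l = c2 + w" by (simp add: c2_def)
        have "(l * z - c2 * x)\<^sup>2 = l * w * z\<^sup>2 - w * c2 * x\<^sup>2 + l * c2 * (x - z)\<^sup>2"
          unfolding lw by (simp add: power2_eq_square algebra_simps)
        then show ?thesis using pos w l by (simp add: add_divide_distrib diff_divide_distrib)
      qed
      finally show ?thesis by simp
    qed
    have f: "1 / sqrt (2 * pi * b2) = 1 / sqrt (2 * pi * c2) * sqrt (l / w)"
      using w l pos by (simp add: b2_def c2_def[symmetric] real_sqrt_mult real_sqrt_divide)
    have "normal_density (a * x) (sqrt b2) z = 1 / sqrt (2 * pi * b2) * exp (- (z - a * x)\<^sup>2 / (2 * b2))"
      using pos by (simp add: normal_density_def)
    also have "\<dots> = 1 / sqrt (2 * pi * c2) * sqrt (l / w) * (exp (- z\<^sup>2 / (2 * c2)) * exp (x\<^sup>2 / (2 * l) - (x - z)\<^sup>2 / (2 * w)))"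
      unfolding e f exp_add ..
    also have "\<dots> = normal_density 0 (sqrt c2) z * exp (wf_phi w l x z)"
      using pos by (simp add: normal_density_def exp_wf_phi_high[OF w True])
    finally show ?thesis .
  qed
  show ?thesis
    unfolding b c D1 D2 P by (subst density_density_eq) (auto simp: ennreal_mult)
next
  case False
  then have lw: "l \<le> w" by simp
  then have a0: "a = 0" using l by (simp add: a)
  let ?L = "distr std_gauss borel (\<lambda>g. a * x + sqrt (min l w * a) * g)"
  show ?thesis
  proof (rule measure_eqI)
    fix A assume "A \<in> sets ?L"
    then have [measurable]: "A \<in> sets borel" by simp
    show "emeasure ?L A =
      emeasure (density (distr std_gauss borel (\<lambda>g. sqrt (l * a) * g)) (\<lambda>z. ennreal (exp (wf_phi w l x z)))) A"
      by (simp add: emeasure_density nn_integral_distr a0 wf_phi_low[OF l lw] nn_integral_return split: split_indicator)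
  qed simp
qed

lemma prod_le_1_ennreal:
  fixes f :: "'a \<Rightarrow> ennreal"
  assumes "\<And>i. i \<in> I \<Longrightarrow> f i \<le> 1"
  shows "prod f I \<le> 1"
  using assms
proof (induction I rule: infinite_finite_induct)
  case (insert i I)
  then show ?case using mult_mono[of "f i" 1 "prod f I" 1] by simp
qed auto

section \<open>Measurability on the space of blocks\<close>

lemma sets_Rn[measurable_cong]: "sets (Rn n) = sets (\<Pi>\<^sub>M i\<in>{..<n}. borel)"
  by (simp add: Rn_def)

lemma space_Rn: "space (Rn n) = extensional {..<n}"
  by (rule Set.set_eqI) (simp add: Rn_def space_PiM PiE_iff)

lemma component_measurable_Rn:
  "f \<in> M \<rightarrow>\<^sub>M Rn n \<Longrightarrow> i < n \<Longrightarrow> (\<lambda>x. f x i) \<in> borel_measurable M"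
  unfolding Rn_def by (rule measurable_compose[OF _ measurable_component_singleton]) auto

lemma rot_measurable_Rn[measurable]: "rot n v m \<in> Rn n \<rightarrow>\<^sub>M Rn n"
  unfolding Rn_def by measurable

lemma unrot_measurable_Rn[measurable]: "unrot n v m \<in> Rn n \<rightarrow>\<^sub>M Rn n"
  unfolding Rn_def by measurable

lemma distortion_measurable[measurable (raw)]:
  assumes [measurable]: "f \<in> M \<rightarrow>\<^sub>M Rn n" "g \<in> M \<rightarrow>\<^sub>M Rn n"
  shows "(\<lambda>x. distortion n (f x) (g x)) \<in> borel_measurable M"
  unfolding distortion_eq_dotn dotn_def
  by (intro borel_measurable_sum borel_measurable_times borel_measurable_diff component_measurable_Rn) auto

lemma distortion_nonneg: "0 \<le> distortion n y z"
  by (simp add: distortion_def)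

section \<open>The water-filling kernel in dimension \<open>n\<close>\<close>

text \<open>No assumption ties \<open>w\<close> to a distortion level. The source law
  \<open>PY\<close> does not depend on \<open>w\<close>, so one source can be studied at several
  levels, as the search for the right level does.\<close>

locale waterfilling =
  fixes n :: nat and v :: "nat \<Rightarrow> nat \<Rightarrow> real" and m l :: "nat \<Rightarrow> real" and w :: real
  assumes orthonormal: "orthonormal n v" and l: "\<And>i. 0 < l i" and w: "0 < w"
begin

text \<open>\<open>l\<close> are the variances of the source in rotated coordinates, \<open>w\<close> is the water level and \<open>dd\<close> the
  distortions. An input coordinate \<open>x\<close> is mapped to \<open>aa * x + bb * g\<close> with \<open>g\<close> standard Gaussian,
  which has the law of \<open>cc * g\<close> when \<open>x\<close> is averaged out. All three coefficients vanish below the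
  water level.\<close>

definition "dd i = min (l i) w"
definition "aa i = 1 - dd i / l i"
definition "bb i = sqrt (dd i * aa i)"
definition "cc i = sqrt (l i * aa i)"

definition "PX = normal_prod n l"
definition "PY = distr PX (Rn n) (rot n v m)"
definition "KX x = distr (std_gauss_n n) (Rn n) (\<lambda>g. \<lambda>i\<in>{..<n}. aa i * x i + bb i * g i)"
definition "PZX = distr (std_gauss_n n) (Rn n) (\<lambda>g. \<lambda>i\<in>{..<n}. cc i * g i)"
definition "opt_out y g = rot n v m (\<lambda>i\<in>{..<n}. aa i * unrot n v m y i + bb i * g i)"
definition "opt_kernel y = distr (std_gauss_n n) (Rn n) (opt_out y)"
definition "PZ = distr PZX (Rn n) (rot n v m)"
definition "rate = (\<Sum>i<n. ln (l i / dd i) / 2)"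
definition "quad y = (\<Sum>i<n. (unrot n v m y i)\<^sup>2 / (2 * max (l i) w))"
definition "Phi y z = rate - distortion n y z / (2 * w) + quad y"

lemma dd: "0 < dd i" "dd i \<le> l i" "dd i \<le> w" using l[of i] w by (auto simp: dd_def)
lemma aa: "0 \<le> aa i" "aa i \<le> 1" using dd[of i] l[of i] by (auto simp: aa_def)

lemma rate_nonneg: "0 \<le> rate"
  unfolding rate_def using dd l by (intro sum_nonneg divide_nonneg_pos) auto

lemma bb_square: "(bb i)\<^sup>2 = dd i * aa i" using dd[of i] aa[of i] by (simp add: bb_def)

lemma quad_nonneg: "0 \<le> quad y"
  unfolding quad_def using l w by (intro sum_nonneg divide_nonneg_nonneg) (auto simp: le_max_iff_disj less_imp_le)

lemma quad_measurable[measurable]: "quad \<in> borel_measurable (Rn n)"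
  unfolding quad_def
  by (intro borel_measurable_sum borel_measurable_divide borel_measurable_power component_measurable_Rn[OF unrot_measurable_Rn]) auto

lemma Phi_measurable[measurable (raw)]:
  assumes [measurable]: "f \<in> M \<rightarrow>\<^sub>M Rn n" "g \<in> M \<rightarrow>\<^sub>M Rn n"
  shows "(\<lambda>x. Phi (f x) (g x)) \<in> borel_measurable M"
  unfolding Phi_def by measurable

lemma Phi_rot:
  assumes "x \<in> extensional {..<n}"
  shows "Phi (rot n v m x) (rot n v m z) = (\<Sum>i<n. wf_phi w (l i) (x i) (z i))"
  by (simp add: Phi_def rate_def quad_def distortion_rot[OF orthonormal] unrot_rot[OF orthonormal assms]
    wf_phi_def dd_def sum.distrib sum_subtractf sum_divide_distrib)

lemma prob_normal: "prob_space (density lborel (\<lambda>x. ennreal (normal_density 0 (sqrt (l i)) x)))"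
  by (rule prob_space_normal_density) (simp add: l)

lemma sets_PX[measurable_cong, simp]: "sets PX = sets (Rn n)"
  unfolding PX_def normal_prod_def Rn_def by (intro sets_PiM_cong) auto
lemma space_PX[simp]: "space PX = space (Rn n)" by (rule sets_eq_imp_space_eq) simp
lemma prob_PX: "prob_space PX"
  unfolding PX_def normal_prod_def by (intro prob_space_PiM prob_normal)
lemma sets_PY[measurable_cong, simp]: "sets PY = sets (Rn n)" by (simp add: PY_def)
lemma space_PY[simp]: "space PY = space (Rn n)" by (simp add: PY_def)
lemma prob_PY: "prob_space PY"
  unfolding PY_def by (rule prob_space.prob_space_distr[OF prob_PX]) measurable

lemma kernel_map_measurable[measurable]: "(\<lambda>g. \<lambda>i\<in>{..<n}. aa i * x i + bb i * g i) \<in> std_gauss_n n \<rightarrow>\<^sub>M Rn n"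
  unfolding Rn_def by measurable
lemma out_map_measurable[measurable]: "(\<lambda>g. \<lambda>i\<in>{..<n}. cc i * g i) \<in> std_gauss_n n \<rightarrow>\<^sub>M Rn n"
  unfolding Rn_def by measurable

lemma sets_PZX[measurable_cong, simp]: "sets PZX = sets (Rn n)" by (simp add: PZX_def)
lemma space_PZX[simp]: "space PZX = space (Rn n)" by (simp add: PZX_def)
lemma sets_PZ[measurable_cong, simp]: "sets PZ = sets (Rn n)" by (simp add: PZ_def)
lemma space_PZ[simp]: "space PZ = space (Rn n)" by (simp add: PZ_def)
lemma prob_PZX: "prob_space PZX"
  unfolding PZX_def by (rule prob_space.prob_space_distr[OF prob_space_std_gauss_n]) measurable
lemma prob_PZ: "prob_space PZ"
  unfolding PZ_def by (rule prob_space.prob_space_distr[OF prob_PZX]) measurable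

lemma std_gauss_n_sets_Rn[measurable_cong]: "sets (std_gauss_n n) = sets (Rn n)"
  by (simp add: Rn_def)

lemma opt_out_measurable2[measurable (raw)]:
  assumes [measurable]: "f \<in> M \<rightarrow>\<^sub>M Rn n" "g \<in> M \<rightarrow>\<^sub>M Rn n"
  shows "(\<lambda>x. opt_out (f x) (g x)) \<in> M \<rightarrow>\<^sub>M Rn n"
proof -
  have "(\<lambda>x. \<lambda>i\<in>{..<n}. aa i * unrot n v m (f x) i + bb i * g x i) \<in> M \<rightarrow>\<^sub>M Rn n"
    unfolding Rn_def
    by (intro measurable_restrict borel_measurable_add borel_measurable_times borel_measurable_const
      component_measurable_Rn[OF measurable_compose[OF _ unrot_measurable_Rn]] component_measurable_Rn) auto
  then show ?thesis unfolding opt_out_def by measurable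
qed

lemma KX_density: "KX x = density PZX (\<lambda>z. ennreal (exp (\<Sum>i<n. wf_phi w (l i) (x i) (z i))))"
proof -
  \<comment> \<open>A point mass at the indices from \<open>n\<close> on, as in
    \<open>distr_PiM_componentwise\<close>; its density factor is 1.\<close>
  let ?R = "return (count_space UNIV) undefined :: real measure"
  let ?N = "\<lambda>i. if i \<in> {..<n} then distr std_gauss borel (\<lambda>g. cc i * g) else ?R"
  let ?D = "\<lambda>i. if i \<in> {..<n} then distr std_gauss borel (\<lambda>g. aa i * x i + bb i * g) else ?R"
  let ?w = "\<lambda>i z. if i \<in> {..<n} then ennreal (exp (wf_phi w (l i) (x i) z)) else 1"
  have N: "PZX = PiM {..<n} ?N"
    unfolding PZX_def Rn_def std_gauss_n_def
    by (rule distr_PiM_componentwise) (simp, rule prob_space_std_gauss, measurable)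
  have D: "KX x = PiM {..<n} ?D"
    unfolding KX_def Rn_def std_gauss_n_def
    by (rule distr_PiM_componentwise) (simp, rule prob_space_std_gauss, measurable)
  have DN: "?D i = density (?N i) (?w i)" for i
  proof (cases "i < n")
    case True
    then show ?thesis
      using wf_kernel_density[OF w l, of "aa i" i "x i"] by (simp add: aa_def bb_def cc_def dd_def)
  next
    case False
    have "density ?R (\<lambda>_. 1) = ?R" by (rule density_1)
    then show ?thesis using False by simp
  qed
  have pN: "prob_space (?N i)" for i
    by (auto intro!: std_gauss.prob_space_distr prob_space_return)
  have pD: "prob_space (?D i)" for i
    by (auto intro!: std_gauss.prob_space_distr prob_space_return)
  have psN: "product_sigma_finite ?N"
    unfolding product_sigma_finite_def using pN by (metis prob_space_imp_sigma_finite)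
  have psD: "product_sigma_finite (\<lambda>i. density (?N i) (?w i))"
    unfolding product_sigma_finite_def DN[symmetric] using pD by (metis prob_space_imp_sigma_finite)
  have "KX x = PiM {..<n} (\<lambda>i. density (?N i) (?w i))" unfolding D DN ..
  also have "\<dots> = density (PiM {..<n} ?N) (\<lambda>z. \<Prod>i<n. ?w i (z i))"
    by (rule PiM_density[OF _ psN psD]) auto
  also have "\<dots> = density PZX (\<lambda>z. ennreal (exp (\<Sum>i<n. wf_phi w (l i) (x i) (z i))))"
    unfolding N[symmetric]
    by (intro arg_cong[of _ _ "density PZX"] ext) (simp add: exp_sum prod_ennreal)
  finally show ?thesis .
qed

lemma opt_kernel_eq_distr_KX: "opt_kernel y = distr (KX (unrot n v m y)) (Rn n) (rot n v m)"
  unfolding opt_kernel_def KX_def opt_out_def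
  by (subst distr_distr) (auto simp: comp_def)

lemma opt_kernel_density:
  assumes y: "y \<in> space (Rn n)"
  shows "opt_kernel y = density PZ (\<lambda>z. ennreal (exp (Phi y z)))"
proof -
  let ?x = "unrot n v m y"
  have y': "y \<in> extensional {..<n}" using y by (simp add: space_Rn)
  have x: "?x \<in> extensional {..<n}" by (simp add: unrot_def)
  have "(\<lambda>z. ennreal (exp (Phi y (rot n v m z)))) = (\<lambda>z. ennreal (exp (\<Sum>i<n. wf_phi w (l i) (?x i) (z i))))"
    using Phi_rot[OF x] rot_unrot[OF orthonormal y'] by simp
  moreover have "density (distr PZX (Rn n) (rot n v m)) (\<lambda>z. ennreal (exp (Phi y z)))
    = distr (density PZX (\<lambda>z. ennreal (exp (Phi y (rot n v m z))))) (Rn n) (rot n v m)"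
    by (rule density_distr) (use y in measurable)
  ultimately show ?thesis unfolding opt_kernel_eq_distr_KX KX_density PZ_def by simp
qed

text \<open>The Kuhn--Tucker condition factorises over the rotated coordinates. It holds at every
  \<open>z\<close>, not just almost everywhere for \<open>PZ\<close>, so it applies to the output
  laws of arbitrary kernels and codes.\<close>

lemma nn_integral_exp_Phi_le_1:
  assumes z: "z \<in> space (Rn n)"
  shows "(\<integral>\<^sup>+y. ennreal (exp (Phi y z)) \<partial>PY) \<le> 1"
proof -
  let ?z = "unrot n v m z"
  let ?N = "\<lambda>i. density lborel (\<lambda>x. ennreal (normal_density 0 (sqrt (l i)) x))"
  interpret product_sigma_finite ?N
    unfolding product_sigma_finite_def using prob_normal by (metis prob_space_imp_sigma_finite)
  have z': "rot n v m ?z = z" using z by (intro rot_unrot[OF orthonormal]) (simp add: space_Rn)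
  have "(\<integral>\<^sup>+y. ennreal (exp (Phi y z)) \<partial>PY) = (\<integral>\<^sup>+x. ennreal (exp (Phi (rot n v m x) (rot n v m ?z))) \<partial>PX)"
    unfolding PY_def z' by (rule nn_integral_distr) (use z in measurable)
  also have "\<dots> = (\<integral>\<^sup>+x. (\<Prod>i<n. ennreal (exp (wf_phi w (l i) (x i) (?z i)))) \<partial>PX)"
    by (intro nn_integral_cong) (simp add: Phi_rot space_Rn exp_sum prod_ennreal)
  also have "\<dots> = (\<Prod>i<n. \<integral>\<^sup>+x. ennreal (exp (wf_phi w (l i) x (?z i))) \<partial>?N i)"
    unfolding PX_def normal_prod_def by (rule product_nn_integral_prod) auto
  also have "\<dots> \<le> 1"
    by (intro prod_le_1_ennreal nn_integral_exp_wf_phi_le_1 w l)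
  finally show ?thesis .
qed

lemma opt_kernel_measurable: "opt_kernel \<in> Rn n \<rightarrow>\<^sub>M prob_algebra (Rn n)"
  unfolding opt_kernel_def
proof (rule measurable_distr_prob_space2)
  show "(\<lambda>_. std_gauss_n n) \<in> Rn n \<rightarrow>\<^sub>M prob_algebra (Rn n)"
    by (rule measurable_const) (simp add: space_prob_algebra prob_space_std_gauss_n sets_Rn)
  show "case_prod opt_out \<in> Rn n \<Otimes>\<^sub>M Rn n \<rightarrow>\<^sub>M Rn n"
    unfolding split_def by measurable
qed

lemma opt_kernel_measurable_PY: "opt_kernel \<in> PY \<rightarrow>\<^sub>M prob_algebra (Rn n)"
  using opt_kernel_measurable by (simp add: measurable_cong_sets[OF sets_PY refl])

lemma space_PY_nonempty: "space PY \<noteq> {}"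
  using prob_space.not_empty[OF prob_PY] .

text \<open>No convolution is computed. The function \<open>I\<close> is the density of the output
  law with respect to \<open>PZ\<close>; it is at most 1 and both laws are probability measures, so
  it is 1 almost everywhere.\<close>

lemma PY_bind_opt_kernel: "PY \<bind> opt_kernel = PZ"
proof -
  interpret PY: prob_space PY by (rule prob_PY)
  interpret PZ: prob_space PZ by (rule prob_PZ)
  interpret P: pair_prob_space PY PZ ..
  define I where "I z = (\<integral>\<^sup>+y. ennreal (exp (Phi y z)) \<partial>PY)" for z
  have Im[measurable]: "I \<in> borel_measurable PZ" unfolding I_def by measurable
  have I1: "I z \<le> 1" if "z \<in> space PZ" for z unfolding I_def using that by (intro nn_integral_exp_Phi_le_1) simp
  have key: "emeasure (PY \<bind> opt_kernel) A = (\<integral>\<^sup>+z. I z * indicator A z \<partial>PZ)" if A[measurable]: "A \<in> sets (Rn n)" for A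
  proof -
    have "emeasure (PY \<bind> opt_kernel) A = (\<integral>\<^sup>+y. emeasure (opt_kernel y) A \<partial>PY)"
      by (rule emeasure_bind[OF space_PY_nonempty measurable_prob_algebraD[OF opt_kernel_measurable_PY] A])
    also have "\<dots> = (\<integral>\<^sup>+y. \<integral>\<^sup>+z. ennreal (exp (Phi y z)) * indicator A z \<partial>PZ \<partial>PY)"
      by (rule nn_integral_cong) (simp add: opt_kernel_density emeasure_density)
    also have "\<dots> = (\<integral>\<^sup>+z. \<integral>\<^sup>+y. ennreal (exp (Phi y z)) * indicator A z \<partial>PY \<partial>PZ)"
      by (rule P.Fubini'[symmetric]) measurable
    also have "\<dots> = (\<integral>\<^sup>+z. I z * indicator A z \<partial>PZ)"
      unfolding I_def by (intro nn_integral_cong nn_integral_multc) measurable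
    finally show ?thesis .
  qed
  have "(\<integral>\<^sup>+z. I z \<partial>PZ) = (\<integral>\<^sup>+z. I z * indicator (space (Rn n)) z \<partial>PZ)"
    by (intro nn_integral_cong) auto
  also have "\<dots> = emeasure (PY \<bind> opt_kernel) (space (PY \<bind> opt_kernel))"
    using key[of "space (Rn n)"] sets_eq_imp_space_eq[OF sets_bind_kernel[OF opt_kernel_measurable_PY space_PY_nonempty]] by simp
  also have "\<dots> = 1"
    by (rule prob_space.emeasure_space_1[OF prob_space_bind_kernel[OF prob_PY opt_kernel_measurable_PY]])
  finally have tot: "(\<integral>\<^sup>+z. I z \<partial>PZ) = 1" .
  have "(\<integral>\<^sup>+z. 1 - I z \<partial>PZ) = (\<integral>\<^sup>+z. 1 \<partial>PZ) - (\<integral>\<^sup>+z. I z \<partial>PZ)"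
    by (rule nn_integral_diff) (use I1 tot in auto)
  also have "\<dots> = 0" using PZ.emeasure_space_1 by (simp add: tot)
  finally have "AE z in PZ. 1 - I z = 0" by (subst (asm) nn_integral_0_iff_AE) auto
  then have AE1: "AE z in PZ. I z = 1"
    using AE_space
  proof eventually_elim
    case (elim z)
    then have "1 \<le> I z" by (intro ennreal_minus_eq_0)
    then show ?case using I1[OF elim(2)] by (rule antisym[rotated])
  qed
  show ?thesis
  proof (rule measure_eqI)
    show s: "sets (PY \<bind> opt_kernel) = sets PZ"
      using sets_bind_kernel[OF opt_kernel_measurable_PY space_PY_nonempty] by simp
    fix A assume "A \<in> sets (PY \<bind> opt_kernel)"
    then have A[measurable]: "A \<in> sets (Rn n)" using s by simp
    have "(\<integral>\<^sup>+z. I z * indicator A z \<partial>PZ) = (\<integral>\<^sup>+z. indicator A z \<partial>PZ)"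
      using AE1 by (intro nn_integral_cong_AE) auto
    then show "emeasure (PY \<bind> opt_kernel) A = emeasure PZ A" using key[OF A] by simp
  qed
qed

lemma joint_law_opt_kernel:
  "joint_law PY opt_kernel (Rn n) = density (PY \<Otimes>\<^sub>M PZ) (\<lambda>p. ennreal (exp (Phi (fst p) (snd p))))"
proof (rule measure_eqI)
  let ?J = "joint_law PY opt_kernel (Rn n)"
  let ?D = "density (PY \<Otimes>\<^sub>M PZ) (\<lambda>p. ennreal (exp (Phi (fst p) (snd p))))"
  interpret PY: prob_space PY by (rule prob_PY)
  interpret PZ: prob_space PZ by (rule prob_PZ)
  interpret P: pair_prob_space PY PZ ..
  have s: "sets (PY \<Otimes>\<^sub>M Rn n) = sets (PY \<Otimes>\<^sub>M PZ)" by (intro sets_pair_measure_cong) auto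
  show st: "sets ?J = sets ?D"
    using sets_joint_law[OF opt_kernel_measurable_PY space_PY_nonempty] s by simp
  fix A assume "A \<in> sets ?J"
  then have A[measurable]: "A \<in> sets (PY \<Otimes>\<^sub>M PZ)" using st by simp
  have A2[measurable]: "A \<in> sets (PY \<Otimes>\<^sub>M Rn n)" using A s by simp
  have Phm: "(\<lambda>p. ennreal (exp (Phi (fst p) (snd p)))) \<in> borel_measurable (PY \<Otimes>\<^sub>M PZ)"
    by measurable
  have "emeasure ?J A = (\<integral>\<^sup>+p. indicator A p \<partial>?J)"
    using A st by simp
  also have "\<dots> = (\<integral>\<^sup>+y. \<integral>\<^sup>+z. indicator A (y, z) \<partial>opt_kernel y \<partial>PY)"
    by (rule nn_integral_joint_law[OF opt_kernel_measurable_PY]) measurable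
  also have "\<dots> = (\<integral>\<^sup>+y. \<integral>\<^sup>+z. ennreal (exp (Phi y z)) * indicator A (y, z) \<partial>PZ \<partial>PY)"
  proof (rule nn_integral_cong)
    fix y assume y: "y \<in> space PY"
    show "(\<integral>\<^sup>+z. indicator A (y, z) \<partial>opt_kernel y) = (\<integral>\<^sup>+z. ennreal (exp (Phi y z)) * indicator A (y, z) \<partial>PZ)"
    proof -
      have yR: "y \<in> space (Rn n)" using y by simp
      have "(\<lambda>z. ennreal (exp (Phi y z))) \<in> borel_measurable PZ" using yR by measurable
      moreover have "(\<lambda>z. indicator A (y, z) :: ennreal) \<in> borel_measurable PZ" using y by measurable
      ultimately show ?thesis unfolding opt_kernel_density[OF yR] by (rule nn_integral_density)
    qed
  qed
  also have "\<dots> = (\<integral>\<^sup>+p. ennreal (exp (Phi (fst p) (snd p))) * indicator A p \<partial>(PY \<Otimes>\<^sub>M PZ))"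
    by (subst PZ.nn_integral_fst[symmetric]) auto
  also have "\<dots> = emeasure ?D A"
    by (rule emeasure_density[symmetric, OF Phm A])
  finally show "emeasure ?J A = emeasure ?D A" .
qed

end

lemma joint_law_cong_AE:
  assumes K: "K \<in> Q \<rightarrow>\<^sub>M prob_algebra N" and K': "K' \<in> Q \<rightarrow>\<^sub>M prob_algebra N"
    and ae: "AE x in Q. K x = K' x"
  shows "joint_law Q K N = joint_law Q K' N"
  unfolding joint_law_def
proof (rule bind_cong_AE[OF refl joint_law_kernel[OF K] joint_law_kernel[OF K']])
  show "AE x in Q. distr (K x) (Q \<Otimes>\<^sub>M N) (\<lambda>z. (x, z)) = distr (K' x) (Q \<Otimes>\<^sub>M N) (\<lambda>z. (x, z))"
    using ae by eventually_elim simp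
qed

section \<open>Optimality of the water-filling kernel\<close>

context waterfilling
begin

lemma nn_integral_PY:
  assumes [measurable]: "f \<in> borel_measurable (Rn n)"
  shows "(\<integral>\<^sup>+y. f y \<partial>PY) = (\<integral>\<^sup>+x. f (rot n v m x) \<partial>PX)"
  unfolding PY_def by (rule nn_integral_distr) measurable

lemma nn_integral_PX_component:
  assumes "i < n"
  shows "(\<integral>\<^sup>+x. ennreal ((x i)\<^sup>2) \<partial>PX) = ennreal (l i)"
  unfolding PX_def normal_prod_def
  by (subst nn_integral_PiM_component[where f = "\<lambda>t. ennreal (t\<^sup>2)"])
    (use assms prob_normal in \<open>auto simp: nn_integral_normal_square l\<close>)

text \<open>It rests on \<open>l i / max (l i) w = dd i / w\<close>. Hence the mean of
  \<open>quad\<close> offsets the distortion term of \<open>Phi\<close> exactly when the mean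
  distortion is the sum of the \<open>dd i\<close>.\<close>

lemma nn_integral_quad: "(\<integral>\<^sup>+y. ennreal (quad y) \<partial>PY) = ennreal ((\<Sum>i<n. dd i) / (2 * w))"
proof -
  have "(\<integral>\<^sup>+y. ennreal (quad y) \<partial>PY) = (\<integral>\<^sup>+x. ennreal (quad (rot n v m x)) \<partial>PX)"
    by (rule nn_integral_PY) measurable
  also have "\<dots> = (\<integral>\<^sup>+x. (\<Sum>i<n. ennreal (1 / (2 * max (l i) w)) * ennreal ((x i)\<^sup>2)) \<partial>PX)"
  proof (rule nn_integral_cong)
    fix x assume "x \<in> space PX"
    then have "unrot n v m (rot n v m x) = x" by (intro unrot_rot orthonormal) (simp add: space_Rn)
    moreover have "0 \<le> 1 / (2 * max (l i) w)" for i using w by (simp add: le_max_iff_disj)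
    ultimately show "ennreal (quad (rot n v m x)) = (\<Sum>i<n. ennreal (1 / (2 * max (l i) w)) * ennreal ((x i)\<^sup>2))"
      unfolding quad_def by (subst sum_ennreal[symmetric]) (auto simp: ennreal_mult[symmetric])
  qed
  also have "\<dots> = (\<Sum>i<n. \<integral>\<^sup>+x. ennreal (1 / (2 * max (l i) w)) * ennreal ((x i)\<^sup>2) \<partial>PX)"
    by (rule nn_integral_sum) (auto intro!: borel_measurable_times measurable_compose[OF _ measurable_ennreal] borel_measurable_power component_measurable_Rn)
  also have "\<dots> = (\<Sum>i<n. ennreal (1 / (2 * max (l i) w)) * ennreal (l i))"
  proof (intro sum.cong refl)
    fix i assume i: "i \<in> {..<n}"
    have "(\<integral>\<^sup>+x. ennreal (1 / (2 * max (l i) w)) * ennreal ((x i)\<^sup>2) \<partial>PX) = ennreal (1 / (2 * max (l i) w)) * (\<integral>\<^sup>+x. ennreal ((x i)\<^sup>2) \<partial>PX)"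
      using i by (intro nn_integral_cmult measurable_compose[OF _ measurable_ennreal] borel_measurable_power component_measurable_Rn) auto
    then show "(\<integral>\<^sup>+x. ennreal (1 / (2 * max (l i) w)) * ennreal ((x i)\<^sup>2) \<partial>PX) = ennreal (1 / (2 * max (l i) w)) * ennreal (l i)"
      using i by (simp add: nn_integral_PX_component)
  qed
  also have "\<dots> = (\<Sum>i<n. ennreal (dd i / (2 * w)))"
  proof (intro sum.cong refl)
    fix i
    have "1 / (2 * max (l i) w) * l i = dd i / (2 * w)"
      using w l[of i] by (auto simp: dd_def max_def min_def field_simps)
    then show "ennreal (1 / (2 * max (l i) w)) * ennreal (l i) = ennreal (dd i / (2 * w))"
      using l[of i] w by (simp add: ennreal_mult[symmetric] le_max_iff_disj)
  qed
  also have "\<dots> = ennreal (\<Sum>i<n. dd i / (2 * w))"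
    using dd w by (intro sum_ennreal) (simp add: less_imp_le)
  finally show ?thesis by (simp add: sum_divide_distrib)
qed

text \<open>In each rotated coordinate \<open>1 - aa i = dd i / l i\<close>, so the squared bias has
  mean \<open>(dd i)\<^sup>2 / l i\<close>; together with the noise variance
  \<open>dd i * aa i\<close> this is \<open>dd i\<close>.\<close>

lemma nn_integral_distortion_opt_kernel:
  "(\<integral>\<^sup>+p. ennreal (distortion n (fst p) (snd p)) \<partial>joint_law PY opt_kernel (Rn n)) = ennreal (\<Sum>i<n. dd i)"
proof -
  have "(\<integral>\<^sup>+p. ennreal (distortion n (fst p) (snd p)) \<partial>joint_law PY opt_kernel (Rn n))
    = (\<integral>\<^sup>+y. \<integral>\<^sup>+z. ennreal (distortion n y z) \<partial>opt_kernel y \<partial>PY)"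
    by (subst nn_integral_joint_law[OF opt_kernel_measurable_PY]) auto
  also have "\<dots> = (\<integral>\<^sup>+y. (\<Sum>i<n. ennreal (((1 - aa i) * unrot n v m y i)\<^sup>2 + (bb i)\<^sup>2)) \<partial>PY)"
  proof (rule nn_integral_cong)
    fix y assume "y \<in> space PY"
    then have y[simp]: "y \<in> space (Rn n)" by simp
    let ?x = "unrot n v m y"
    have ry: "rot n v m ?x = y" using y by (intro rot_unrot orthonormal) (simp add: space_Rn)
    have "(\<integral>\<^sup>+z. ennreal (distortion n y z) \<partial>opt_kernel y) = (\<integral>\<^sup>+g. ennreal (distortion n y (opt_out y g)) \<partial>std_gauss_n n)"
      unfolding opt_kernel_def by (rule nn_integral_distr) measurable
    also have "\<dots> = (\<integral>\<^sup>+g. (\<Sum>i<n. ennreal (((1 - aa i) * ?x i + - bb i * g i)\<^sup>2)) \<partial>std_gauss_n n)"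
    proof (rule nn_integral_cong)
      fix g
      have "distortion n y (opt_out y g) = (\<Sum>i<n. (?x i - (\<lambda>i\<in>{..<n}. aa i * ?x i + bb i * g i) i)\<^sup>2)"
        unfolding opt_out_def by (subst (1) ry[symmetric]) (rule distortion_rot[OF orthonormal])
      also have "\<dots> = (\<Sum>i<n. ((1 - aa i) * ?x i + - bb i * g i)\<^sup>2)"
        by (intro sum.cong refl) (simp add: algebra_simps)
      finally show "ennreal (distortion n y (opt_out y g)) = (\<Sum>i<n. ennreal (((1 - aa i) * ?x i + - bb i * g i)\<^sup>2))"
        by (simp add: sum_ennreal)
    qed
    also have "\<dots> = (\<Sum>i<n. \<integral>\<^sup>+g. ennreal (((1 - aa i) * ?x i + - bb i * g i)\<^sup>2) \<partial>std_gauss_n n)"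
      by (rule nn_integral_sum) (auto intro!: measurable_compose[OF _ measurable_ennreal] borel_measurable_power borel_measurable_diff borel_measurable_times component_measurable_Rn)
    also have "\<dots> = (\<Sum>i<n. ennreal (((1 - aa i) * ?x i)\<^sup>2 + (bb i)\<^sup>2))"
    proof (intro sum.cong refl)
      fix i assume i: "i \<in> {..<n}"
      have "(\<integral>\<^sup>+g. ennreal (((1 - aa i) * ?x i + - bb i * g i)\<^sup>2) \<partial>std_gauss_n n)
        = (\<integral>\<^sup>+t. ennreal (((1 - aa i) * ?x i + - bb i * t)\<^sup>2) \<partial>std_gauss)"
        unfolding std_gauss_n_def
        by (rule nn_integral_PiM_component[where f = "\<lambda>t. ennreal (((1 - aa i) * ?x i + - bb i * t)\<^sup>2)"])
          (use i prob_space_std_gauss in auto)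
      then show "(\<integral>\<^sup>+g. ennreal (((1 - aa i) * ?x i + - bb i * g i)\<^sup>2) \<partial>std_gauss_n n) = ennreal (((1 - aa i) * ?x i)\<^sup>2 + (bb i)\<^sup>2)"
        by (simp only: nn_integral_std_gauss_affine_square power2_minus)
    qed
    finally show "(\<integral>\<^sup>+z. ennreal (distortion n y z) \<partial>opt_kernel y) = (\<Sum>i<n. ennreal (((1 - aa i) * ?x i)\<^sup>2 + (bb i)\<^sup>2))" .
  qed
  also have "\<dots> = (\<integral>\<^sup>+x. (\<Sum>i<n. ennreal (((1 - aa i) * unrot n v m (rot n v m x) i)\<^sup>2 + (bb i)\<^sup>2)) \<partial>PX)"
    by (rule nn_integral_PY) (auto intro!: borel_measurable_sum measurable_compose[OF _ measurable_ennreal] borel_measurable_power borel_measurable_add borel_measurable_times component_measurable_Rn[OF unrot_measurable_Rn])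
  also have "\<dots> = (\<integral>\<^sup>+x. (\<Sum>i<n. ennreal ((1 - aa i)\<^sup>2) * ennreal ((x i)\<^sup>2) + ennreal ((bb i)\<^sup>2)) \<partial>PX)"
  proof (rule nn_integral_cong)
    fix x assume "x \<in> space PX"
    then have "unrot n v m (rot n v m x) = x" by (intro unrot_rot orthonormal) (simp add: space_Rn)
    then show "(\<Sum>i<n. ennreal (((1 - aa i) * unrot n v m (rot n v m x) i)\<^sup>2 + (bb i)\<^sup>2)) = (\<Sum>i<n. ennreal ((1 - aa i)\<^sup>2) * ennreal ((x i)\<^sup>2) + ennreal ((bb i)\<^sup>2))"
      by (simp add: power_mult_distrib ennreal_mult)
  qed
  also have "\<dots> = (\<Sum>i<n. \<integral>\<^sup>+x. ennreal ((1 - aa i)\<^sup>2) * ennreal ((x i)\<^sup>2) + ennreal ((bb i)\<^sup>2) \<partial>PX)"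
    by (rule nn_integral_sum) (auto intro!: borel_measurable_add borel_measurable_times measurable_compose[OF _ measurable_ennreal] borel_measurable_power component_measurable_Rn)
  also have "\<dots> = (\<Sum>i<n. ennreal (dd i))"
  proof (intro sum.cong refl)
    fix i assume i: "i \<in> {..<n}"
    have xm: "(\<lambda>x. ennreal ((x i)\<^sup>2)) \<in> borel_measurable PX"
      using i by (intro measurable_compose[OF _ measurable_ennreal] borel_measurable_power component_measurable_Rn) auto
    have "(\<integral>\<^sup>+x. ennreal ((1 - aa i)\<^sup>2) * ennreal ((x i)\<^sup>2) + ennreal ((bb i)\<^sup>2) \<partial>PX)
      = ennreal ((1 - aa i)\<^sup>2) * ennreal (l i) + ennreal ((bb i)\<^sup>2)"
      using i xm prob_space.emeasure_space_1[OF prob_PX]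
      by (subst nn_integral_add) (auto simp: nn_integral_cmult nn_integral_PX_component)
    also have "\<dots> = ennreal ((1 - aa i)\<^sup>2 * l i + (bb i)\<^sup>2)"
      using l[of i] by (simp add: ennreal_mult)
    also have "(1 - aa i)\<^sup>2 * l i + (bb i)\<^sup>2 = dd i"
      unfolding bb_square aa_def using l[of i] by (simp add: power2_eq_square field_simps)
    finally show "(\<integral>\<^sup>+x. ennreal ((1 - aa i)\<^sup>2) * ennreal ((x i)\<^sup>2) + ennreal ((bb i)\<^sup>2) \<partial>PX) = ennreal (dd i)" .
  qed
  also have "\<dots> = ennreal (\<Sum>i<n. dd i)" using dd by (intro sum_ennreal) (simp add: less_imp_le)
  finally show ?thesis .
qed

lemma sum_dd_nonneg: "0 \<le> (\<Sum>i<n. dd i)" using dd by (intro sum_nonneg) (simp add: less_imp_le)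

lemma sets_joint_law_PY:
  assumes "K \<in> kernels (Rn n) (Rn n)"
  shows "K \<in> PY \<rightarrow>\<^sub>M prob_algebra (Rn n)" "sets (joint_law PY K (Rn n)) = sets (Rn n \<Otimes>\<^sub>M Rn n)"
proof -
  show K: "K \<in> PY \<rightarrow>\<^sub>M prob_algebra (Rn n)"
    using assms by (simp add: kernels_def measurable_cong_sets[OF sets_PY refl])
  show "sets (joint_law PY K (Rn n)) = sets (Rn n \<Otimes>\<^sub>M Rn n)"
    unfolding sets_joint_law[OF K space_PY_nonempty] by (intro sets_pair_measure_cong) auto
qed

lemma admissible_opt_kernel:
  assumes "(\<Sum>i<n. dd i) \<le> real n * D"
  shows "admissible n PY D opt_kernel"
    and integral_distortion_opt_kernel: "(\<integral>(y, z). distortion n y z \<partial>joint_law PY opt_kernel (Rn n)) = (\<Sum>i<n. dd i)"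
proof -
  let ?J = "joint_law PY opt_kernel (Rn n)"
  have K: "opt_kernel \<in> kernels (Rn n) (Rn n)" using opt_kernel_measurable by (simp add: kernels_def)
  note [measurable_cong] = sets_joint_law_PY(2)[OF K]
  have m: "(\<lambda>(y, z). distortion n y z) \<in> borel_measurable ?J"
    unfolding split_def by measurable
  have nn: "(\<integral>\<^sup>+p. ennreal ((\<lambda>(y, z). distortion n y z) p) \<partial>?J) = ennreal (\<Sum>i<n. dd i)"
    using nn_integral_distortion_opt_kernel by (simp add: split_def)
  have int: "integrable ?J (\<lambda>(y, z). distortion n y z)"
    by (rule integrableI_nonneg[OF m]) (use nn in \<open>auto simp: distortion_nonneg\<close>)
  show eq: "(\<integral>(y, z). distortion n y z \<partial>?J) = (\<Sum>i<n. dd i)"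
    using nn by (subst integral_eq_nn_integral[OF m]) (auto simp: distortion_nonneg sum_dd_nonneg)
  show "admissible n PY D opt_kernel"
    unfolding admissible_def using K int eq assms by simp
qed

text \<open>\<open>quad\<close> depends on \<open>y\<close> alone, so its mean is the same for all
  kernels. \<open>Phi\<close> sees \<open>K\<close> only through its mean distortion, with the
  Lagrange multiplier as slope.\<close>

lemma integral_Phi:
  assumes K: "K \<in> kernels (Rn n) (Rn n)"
    and int: "integrable (joint_law PY K (Rn n)) (\<lambda>(y, z). distortion n y z)"
  shows "integrable (joint_law PY K (Rn n)) (\<lambda>p. Phi (fst p) (snd p))"
    and "(\<integral>p. Phi (fst p) (snd p) \<partial>joint_law PY K (Rn n))
      = rate + ((\<Sum>i<n. dd i) - (\<integral>(y, z). distortion n y z \<partial>joint_law PY K (Rn n))) / (2 * w)"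
proof -
  note KP = sets_joint_law_PY(1)[OF K]
  let ?J = "joint_law PY K (Rn n)"
  note [measurable_cong] = sets_joint_law_PY(2)[OF K]
  interpret J: prob_space ?J by (rule prob_space_joint_law[OF prob_PY KP])
  have int': "integrable ?J (\<lambda>p. distortion n (fst p) (snd p))" using int by (simp add: split_def)
  have nn: "(\<integral>\<^sup>+p. ennreal (quad (fst p)) \<partial>?J) = ennreal ((\<Sum>i<n. dd i) / (2 * w))"
  proof -
    have "(\<integral>\<^sup>+p. ennreal (quad (fst p)) \<partial>?J) = (\<integral>\<^sup>+y. \<integral>\<^sup>+z. ennreal (quad y) \<partial>K y \<partial>PY)"
      by (subst nn_integral_joint_law[OF KP]) auto
    also have "\<dots> = (\<integral>\<^sup>+y. ennreal (quad y) \<partial>PY)"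
      by (intro nn_integral_cong) (simp add: prob_space.emeasure_space_1[OF space_prob_kernel(1)[OF KP]])
    finally show ?thesis by (simp add: nn_integral_quad)
  qed
  have iq: "integrable ?J (\<lambda>p. quad (fst p))"
    by (rule integrableI_nonneg) (use nn in \<open>auto simp: quad_nonneg\<close>)
  have eq: "(\<integral>p. quad (fst p) \<partial>?J) = (\<Sum>i<n. dd i) / (2 * w)"
    using nn sum_dd_nonneg w by (subst integral_eq_nn_integral) (auto simp: quad_nonneg)
  show "integrable ?J (\<lambda>p. Phi (fst p) (snd p))"
    unfolding Phi_def using int' iq by auto
  show "(\<integral>p. Phi (fst p) (snd p) \<partial>?J) = rate + ((\<Sum>i<n. dd i) - (\<integral>(y, z). distortion n y z \<partial>?J)) / (2 * w)"
    unfolding Phi_def using int' iq eq by (simp add: J.prob_space split_def diff_divide_distrib)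
qed

lemma kernel_information_opt_kernel: "kernel_information PY opt_kernel (Rn n) = ennreal (rate / ln 2)"
proof -
  let ?J = "joint_law PY opt_kernel (Rn n)"
  let ?D = "density (PY \<Otimes>\<^sub>M PZ) (\<lambda>p. ennreal (exp (Phi (fst p) (snd p))))"
  have K: "opt_kernel \<in> kernels (Rn n) (Rn n)" using opt_kernel_measurable by (simp add: kernels_def)
  interpret PY: prob_space PY by (rule prob_PY)
  interpret PZ: prob_space PZ by (rule prob_PZ)
  interpret P: pair_prob_space PY PZ ..
  \<comment> \<open>Any level at which the kernel is admissible yields integrability. For
    \<open>n = 0\<close> the quotient is 0 by convention and the sum is empty.\<close>
  have int: "integrable ?J (\<lambda>(y, z). distortion n y z)"
    using admissible_opt_kernel(1)[of "(\<Sum>i<n. dd i) / real n"] sum_dd_nonneg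
    by (cases "n = 0") (auto simp: admissible_def)
  have deq: "(\<integral>(y, z). distortion n y z \<partial>?J) = (\<Sum>i<n. dd i)"
    using integral_distortion_opt_kernel[of "(\<Sum>i<n. dd i) / real n"] by (cases "n = 0") auto
  have "relative_entropy ?D (PY \<Otimes>\<^sub>M PZ)
    = ennreal ((\<integral>p. Phi (fst p) (snd p) \<partial>?D) / ln 2)"
  proof (rule relative_entropy_density)
    show "prob_space (PY \<Otimes>\<^sub>M PZ)" by (rule P.prob_space_axioms)
    show "(\<lambda>p. Phi (fst p) (snd p)) \<in> borel_measurable (PY \<Otimes>\<^sub>M PZ)" by measurable
    show "prob_space ?D"
      unfolding joint_law_opt_kernel[symmetric] by (rule prob_space_joint_law[OF prob_PY opt_kernel_measurable_PY])
    show "integrable ?D (\<lambda>p. Phi (fst p) (snd p))"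
      unfolding joint_law_opt_kernel[symmetric] by (rule integral_Phi(1)[OF K int])
  qed
  then show ?thesis
    unfolding kernel_information_def PY_bind_opt_kernel joint_law_opt_kernel[symmetric] integral_Phi(2)[OF K int] deq by simp
qed

lemma nn_integral_pair_exp_Phi_le_1:
  assumes Z: "prob_space Z" and s: "sets Z = sets (Rn n)"
  shows "(\<integral>\<^sup>+p. ennreal (exp (Phi (fst p) (snd p))) \<partial>(PY \<Otimes>\<^sub>M Z)) \<le> 1"
proof -
  interpret PY: prob_space PY by (rule prob_PY)
  interpret Z: prob_space Z by (rule Z)
  interpret P: pair_prob_space PY Z ..
  note [measurable_cong] = s
  have "(\<integral>\<^sup>+p. ennreal (exp (Phi (fst p) (snd p))) \<partial>(PY \<Otimes>\<^sub>M Z)) = (\<integral>\<^sup>+z. \<integral>\<^sup>+y. ennreal (exp (Phi y z)) \<partial>PY \<partial>Z)"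
    by (subst P.nn_integral_snd[symmetric]) (auto simp: split_def)
  also have "\<dots> \<le> (\<integral>\<^sup>+z. 1 \<partial>Z)"
    by (intro nn_integral_mono nn_integral_exp_Phi_le_1) (simp add: sets_eq_imp_space_eq[OF s])
  finally show ?thesis by (simp add: Z.emeasure_space_1)
qed

text \<open>Weak duality: Donsker--Varadhan with test function \<open>Phi\<close>, against the
  product of \<open>PY\<close> with the output law of \<open>K\<close> itself. Distortion below the
  sum of the \<open>dd i\<close> only raises the mean of \<open>Phi\<close> above
  \<open>rate\<close>.\<close>

lemma kernel_information_ge:
  assumes adm: "admissible n PY D K" and D: "real n * D \<le> (\<Sum>i<n. dd i)"
  shows "ennreal (rate / ln 2) \<le> kernel_information PY K (Rn n)"
proof -
  have K: "K \<in> kernels (Rn n) (Rn n)" and int: "integrable (joint_law PY K (Rn n)) (\<lambda>(y, z). distortion n y z)"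
    and le: "(\<integral>(y, z). distortion n y z \<partial>joint_law PY K (Rn n)) \<le> real n * D"
    using adm by (auto simp: admissible_def)
  note KP = sets_joint_law_PY(1)[OF K]
  let ?J = "joint_law PY K (Rn n)" and ?Z = "PY \<bind> K"
  have sZ: "sets ?Z = sets (Rn n)" by (rule sets_bind_kernel[OF KP space_PY_nonempty])
  interpret PY: prob_space PY by (rule prob_PY)
  interpret Z: prob_space ?Z by (rule prob_space_bind_kernel[OF prob_PY KP])
  interpret P: pair_prob_space PY ?Z ..
  have "rate \<le> (\<integral>p. Phi (fst p) (snd p) \<partial>?J)"
    unfolding integral_Phi(2)[OF K int] using le D w by simp
  then have "ennreal (rate / ln 2) \<le> ennreal ((\<integral>p. Phi (fst p) (snd p) \<partial>?J) / ln 2)"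
    by (intro ennreal_leI divide_right_mono) auto
  also have "\<dots> \<le> relative_entropy ?J (PY \<Otimes>\<^sub>M ?Z)"
  proof (rule integral_le_relative_entropy)
    show "prob_space (PY \<Otimes>\<^sub>M ?Z)" by (rule P.prob_space_axioms)
    show "prob_space ?J" by (rule prob_space_joint_law[OF prob_PY KP])
    show "sets ?J = sets (PY \<Otimes>\<^sub>M ?Z)"
      unfolding sets_joint_law_PY(2)[OF K] by (intro sets_pair_measure_cong) (auto simp: sZ)
    show "integrable ?J (\<lambda>p. Phi (fst p) (snd p))" by (rule integral_Phi(1)[OF K int])
    show "(\<integral>\<^sup>+p. ennreal (exp (Phi (fst p) (snd p))) \<partial>(PY \<Otimes>\<^sub>M ?Z)) \<le> 1"
      by (rule nn_integral_pair_exp_Phi_le_1[OF Z.prob_space_axioms sZ])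
  qed
  finally show ?thesis unfolding kernel_information_def .
qed

lemma unique_optimal_kernel_eq:
  assumes u: "unique_optimal_kernel n PY D K" and D: "real n * D = (\<Sum>i<n. dd i)"
  shows "AE y in PY. K y = opt_kernel y" "block_rdf n PY D = ennreal (rate / ln 2)"
proof -
  have adm: "admissible n PY D opt_kernel" by (rule admissible_opt_kernel) (simp add: D)
  show rdf: "block_rdf n PY D = ennreal (rate / ln 2)"
  proof (rule antisym)
    show "block_rdf n PY D \<le> ennreal (rate / ln 2)"
      unfolding block_rdf_def kernel_information_opt_kernel[symmetric] by (rule INF_lower) (simp add: adm)
    show "ennreal (rate / ln 2) \<le> block_rdf n PY D"
      unfolding block_rdf_def by (rule INF_greatest, rule kernel_information_ge[OF _ eq_refl[OF D]]) (simp only: mem_Collect_eq)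
  qed
  have all: "AE y in PY. K' y = K y"
    if "admissible n PY D K'" "kernel_information PY K' (Rn n) = block_rdf n PY D" for K'
    using u that unfolding unique_optimal_kernel_def by metis
  have "AE y in PY. opt_kernel y = K y"
    by (rule all[OF adm]) (simp only: rdf kernel_information_opt_kernel)
  then show "AE y in PY. K y = opt_kernel y" by eventually_elim simp
qed

end

section \<open>Change of measure for codes\<close>

lemma code_map_measurable:
  assumes code: "random_code n M S enc dec" and [measurable]: "yv \<in> Q \<rightarrow>\<^sub>M Rn n"
  shows "(\<lambda>p. dec (snd p) (enc (snd p) (yv (fst p)))) \<in> Q \<Otimes>\<^sub>M S \<rightarrow>\<^sub>M Rn n"
proof -
  have [measurable]: "(\<lambda>(s, y). dec s (enc s y)) \<in> S \<Otimes>\<^sub>M Rn n \<rightarrow>\<^sub>M Rn n"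
    using code by (simp add: random_code_def)
  have "(\<lambda>p. (\<lambda>(s, y). dec s (enc s y)) (snd p, yv (fst p))) \<in> Q \<Otimes>\<^sub>M S \<rightarrow>\<^sub>M Rn n"
    by measurable
  then show ?thesis by simp
qed

lemma random_code_size_pos:
  assumes "random_code n M S enc dec"
  shows "1 \<le> M"
proof -
  interpret S: prob_space S using assms by (simp add: random_code_def)
  obtain s where "s \<in> space S" using S.not_empty by blast
  moreover have "(\<lambda>i\<in>{..<n}. 0) \<in> space (Rn n)" by (simp add: space_Rn)
  ultimately have "enc s (\<lambda>i\<in>{..<n}. 0) \<in> {1..M}" using assms by (simp add: random_code_def)
  then show ?thesis by auto
qed

text \<open>For fixed randomness the output takes at most \<open>M\<close> values, so the integral is at most a sum
  over codewords.\<close>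

lemma random_code_union_bound:
  fixes G :: "'x \<Rightarrow> (nat \<Rightarrow> real) \<Rightarrow> ennreal"
  assumes Q: "prob_space Q" and yv[measurable]: "yv \<in> Q \<rightarrow>\<^sub>M Rn n"
    and code: "random_code n M S enc dec"
    and G: "(\<lambda>(x, z). G x z) \<in> borel_measurable (Q \<Otimes>\<^sub>M Rn n)"
    and I: "\<And>z. z \<in> space (Rn n) \<Longrightarrow> (\<integral>\<^sup>+x. G x z \<partial>Q) \<le> ennreal (1 / M)"
  shows "(\<integral>\<^sup>+p. G (fst p) (dec (snd p) (enc (snd p) (yv (fst p)))) \<partial>(Q \<Otimes>\<^sub>M S)) \<le> 1"
proof -
  interpret Q: prob_space Q by fact
  interpret S: prob_space S using code by (simp add: random_code_def)
  interpret P: pair_prob_space Q S ..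
  note Z[measurable] = code_map_measurable[OF code yv]
  note G[measurable]
  have Gm: "(\<lambda>p. G (fst p) (dec (snd p) (enc (snd p) (yv (fst p))))) \<in> borel_measurable (Q \<Otimes>\<^sub>M S)"
    using measurable_compose[OF measurable_Pair[OF measurable_fst Z] G] by simp
  have M: "1 \<le> M" by (rule random_code_size_pos[OF code])
  have "(\<integral>\<^sup>+p. G (fst p) (dec (snd p) (enc (snd p) (yv (fst p)))) \<partial>(Q \<Otimes>\<^sub>M S))
    = (\<integral>\<^sup>+s. \<integral>\<^sup>+x. G x (dec s (enc s (yv x))) \<partial>Q \<partial>S)"
    by (subst P.nn_integral_snd[symmetric]) (use Gm in \<open>auto simp: split_def\<close>)
  also have "\<dots> \<le> (\<integral>\<^sup>+s. 1 \<partial>S)"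
  proof (rule nn_integral_mono)
    fix s assume s: "s \<in> space S"
    have d: "dec s k \<in> space (Rn n)" if "k \<in> {1..M}" for k
      using code s that by (simp add: random_code_def)
    have "(\<integral>\<^sup>+x. G x (dec s (enc s (yv x))) \<partial>Q) \<le> (\<integral>\<^sup>+x. (\<Sum>k\<in>{1..M}. G x (dec s k)) \<partial>Q)"
    proof (rule nn_integral_mono)
      fix x assume "x \<in> space Q"
      then have "yv x \<in> space (Rn n)" by (rule measurable_space[OF yv])
      then have "enc s (yv x) \<in> {1..M}" using code s by (simp add: random_code_def)
      then show "G x (dec s (enc s (yv x))) \<le> (\<Sum>k\<in>{1..M}. G x (dec s k))"
        by (intro member_le_sum[of "enc s (yv x)" "{1..M}" "\<lambda>k. G x (dec s k)"]) auto
    qed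
    also have "\<dots> = (\<Sum>k\<in>{1..M}. \<integral>\<^sup>+x. G x (dec s k) \<partial>Q)"
    proof (rule nn_integral_sum)
      fix k assume "k \<in> {1..M}"
      then have "dec s k \<in> space (Rn n)" by (rule d)
      then show "(\<lambda>x. G x (dec s k)) \<in> borel_measurable Q"
        using measurable_compose[OF measurable_Pair[OF measurable_ident measurable_const] G, of "dec s k"] by simp
    qed
    also have "\<dots> \<le> (\<Sum>k\<in>{1..M}. ennreal (1 / M))"
      by (intro sum_mono I d)
    also have "\<dots> = ennreal (\<Sum>k\<in>{1..M}. 1 / M)" by (rule sum_ennreal) simp
    also have "\<dots> = 1" using M by simp
    finally show "(\<integral>\<^sup>+x. G x (dec s (enc s (yv x))) \<partial>Q) \<le> 1" .
  qed
  also have "\<dots> = 1" by (simp add: S.emeasure_space_1)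
  finally show ?thesis .
qed

lemma ennreal_self_divide_le_1: "x / (x :: ennreal) \<le> 1"
  by (cases "x = 0 \<or> x = \<infinity>") (auto simp: divide_ennreal_def ennreal_divide_self[unfolded divide_ennreal_def] less_top)

lemma integrable_enn2real_le:
  assumes [measurable]: "f \<in> borel_measurable M" and le: "(\<integral>\<^sup>+x. f x \<partial>M) \<le> ennreal c" and c: "0 \<le> c"
  shows "integrable M (\<lambda>x. enn2real (f x))" "(\<integral>x. enn2real (f x) \<partial>M) \<le> c"
proof -
  have "(\<integral>\<^sup>+x. ennreal (enn2real (f x)) \<partial>M) \<le> (\<integral>\<^sup>+x. f x \<partial>M)"
    by (intro nn_integral_mono) (metis enn2real_nonneg ennreal_enn2real_if ennreal_zero_less_top less_imp_le order_refl top_greatest)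
  then have le': "(\<integral>\<^sup>+x. ennreal (enn2real (f x)) \<partial>M) \<le> ennreal c" using le by simp
  show i: "integrable M (\<lambda>x. enn2real (f x))"
    by (rule integrableI_nonneg) (use le' in \<open>auto intro: le_less_trans\<close>)
  show "(\<integral>x. enn2real (f x) \<partial>M) \<le> c"
    using le' c nn_integral_eq_integral[OF i] by simp
qed

text \<open>Change of measure for a code: two applications of \<open>ln x \<le> x - 1\<close>, one for the code (the
  cost is the logarithm of the number of codewords) and one for its output law.\<close>

lemma random_code_change_of_measure:
  fixes \<phi> F :: "'x \<Rightarrow> (nat \<Rightarrow> real) \<Rightarrow> real"
  assumes Q: "prob_space Q" and yv[measurable]: "yv \<in> Q \<rightarrow>\<^sub>M Rn n"
    and code: "random_code n M S enc dec"
    and Z_def: "Z = (\<lambda>p. dec (snd p) (enc (snd p) (yv (fst p))))"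
    and PZ: "prob_space PZ" and sPZ: "sets PZ = sets (Rn n)"
    and fin: "relative_entropy (distr (Q \<Otimes>\<^sub>M S) (Rn n) Z) PZ \<le> ennreal d" and d: "0 \<le> d"
    and \<phi>: "(\<lambda>(x, z). \<phi> x z) \<in> borel_measurable (Q \<Otimes>\<^sub>M Rn n)"
    and F: "(\<lambda>(x, z). F x z) \<in> borel_measurable (Q \<Otimes>\<^sub>M Rn n)" and F0: "\<And>x z. 0 \<le> F x z"
    and B: "0 < B" "(\<integral>\<^sup>+z. \<integral>\<^sup>+x. ennreal (exp (\<phi> x z + F x z)) \<partial>Q \<partial>PZ) \<le> ennreal B"
    and int: "integrable (Q \<Otimes>\<^sub>M S) (\<lambda>p. \<phi> (fst p) (Z p))"
  shows "(\<integral>\<^sup>+p. ennreal (F (fst p) (Z p)) \<partial>(Q \<Otimes>\<^sub>M S))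
    \<le> ennreal (ln M + ln 2 * d + ln B - (\<integral>p. \<phi> (fst p) (Z p) \<partial>(Q \<Otimes>\<^sub>M S)))"
proof -
  interpret Q: prob_space Q by fact
  interpret S: prob_space S using code by (simp add: random_code_def)
  interpret W: pair_prob_space Q S ..
  interpret PZ: prob_space PZ by fact
  let ?W = "Q \<Otimes>\<^sub>M S"
  have Z[measurable]: "Z \<in> ?W \<rightarrow>\<^sub>M Rn n" unfolding Z_def by (rule code_map_measurable[OF code yv])
  note sPZ[measurable_cong]
  have [measurable]: "(\<lambda>p. \<phi> (fst p) (snd p)) \<in> borel_measurable (Q \<Otimes>\<^sub>M Rn n)"
    "(\<lambda>p. F (fst p) (snd p)) \<in> borel_measurable (Q \<Otimes>\<^sub>M Rn n)" using \<phi> F by (auto simp: split_def)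
  define PC where "PC = distr ?W (Rn n) Z"
  interpret PC: prob_space PC unfolding PC_def by (rule W.prob_space_distr) measurable
  have sPC: "sets PC = sets PZ" by (simp add: PC_def sPZ)
  have M: "1 \<le> M" by (rule random_code_size_pos[OF code])
  define G where "G p = ennreal (exp (\<phi> (fst p) (snd p) + F (fst p) (snd p)))" for p
  have Gm[measurable]: "G \<in> borel_measurable (Q \<Otimes>\<^sub>M Rn n)" unfolding G_def by measurable
  define I where "I z = (\<integral>\<^sup>+x. G (x, z) \<partial>Q)" for z
  have Im[measurable]: "I \<in> borel_measurable (Rn n)" unfolding I_def by measurable
  have sec: "(\<lambda>x. G (x, z)) \<in> borel_measurable Q" if "z \<in> space (Rn n)" for z
    using that by measurable
  have Ipos: "I z \<noteq> 0" if z: "z \<in> space (Rn n)" for z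
  proof
    assume "I z = 0"
    then have "AE x in Q. G (x, z) = 0"
      unfolding I_def by (subst (asm) nn_integral_0_iff_AE[OF sec[OF z]])
    then show False by (simp add: G_def)
  qed
  have IB: "(\<integral>\<^sup>+z. I z \<partial>PZ) \<le> ennreal B" using B(2) by (simp add: I_def G_def)
  have Ifin: "AE z in PZ. I z \<noteq> \<infinity>"
    using IB by (intro nn_integral_noteq_infinite) (auto simp: top_unique measurable_cong_sets[OF sPZ refl])
  have re: "relative_entropy PC PZ \<le> ennreal d" using fin by (simp add: PC_def)
  have ac: "absolutely_continuous PZ PC" and ied: "integrable PC (entropy_density 2 PZ PC)"
    using re by (auto simp: relative_entropy_def top_unique split: if_splits)
  have KL: "KL_divergence 2 PZ PC \<le> d"
    using re ac ied d by (simp add: relative_entropy_def)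
  define r where "r = RN_deriv PZ PC"
  have rm[measurable]: "r \<in> borel_measurable (Rn n)"
    unfolding r_def using measurable_cong_sets[OF sPZ refl] by auto
  \<comment> \<open>The two ratios to which \<open>ln x \<le> x - 1\<close> is applied. Both have
    mean at most 1 along the code: \<open>A1\<close> by the union bound, since
    \<open>M * I z\<close> normalises each codeword to \<open>1 / M\<close>; \<open>A2\<close>
    because dividing by \<open>r\<close> carries the output law back to \<open>PZ\<close>. In the
    sum of the logarithms \<open>I\<close> cancels.\<close>
  define A1 where "A1 p = G (fst p, Z p) / (M * I (Z p))" for p
  define A2 where "A2 z = I z / r z / ennreal B" for z
  have A1m[measurable]: "A1 \<in> borel_measurable ?W" unfolding A1_def by measurable
  have A2m[measurable]: "A2 \<in> borel_measurable (Rn n)" unfolding A2_def by measurable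
  have A1: "(\<integral>\<^sup>+p. A1 p \<partial>?W) \<le> ennreal 1"
  proof -
    have "(\<integral>\<^sup>+p. G (fst p, Z p) / (M * I (Z p)) \<partial>?W) \<le> 1"
      unfolding Z_def
    proof (rule random_code_union_bound[OF Q yv code, where G = "\<lambda>x z. G (x, z) / (M * I z)"])
      show "(\<lambda>(x, z). G (x, z) / (M * I z)) \<in> borel_measurable (Q \<Otimes>\<^sub>M Rn n)"
        unfolding split_def by measurable
      fix z assume z: "z \<in> space (Rn n)"
      have "(\<integral>\<^sup>+x. G (x, z) / (M * I z) \<partial>Q) = I z / (M * I z)"
        unfolding I_def by (rule nn_integral_divide[OF sec[OF z]])
      also have "\<dots> = (I z / I z) / M"
      proof -
        have "inverse (of_nat M * I z) = inverse (of_nat M) * inverse (I z)"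
          using M by (intro ennreal_inverse_mult') (auto simp: of_nat_less_top)
        then show ?thesis by (simp add: divide_ennreal_def ac_simps)
      qed
      also have "\<dots> \<le> 1 / of_nat M" by (intro divide_right_mono_ennreal ennreal_self_divide_le_1)
      also have "1 / of_nat M = ennreal (1 / M)"
        using M by (simp add: divide_ennreal[symmetric] ennreal_of_nat_eq_real_of_nat)
      finally show "(\<integral>\<^sup>+x. G (x, z) / (M * I z) \<partial>Q) \<le> ennreal (1 / M)" .
    qed
    then show ?thesis by (simp add: A1_def)
  qed
  have A2: "(\<integral>\<^sup>+p. A2 (Z p) \<partial>?W) \<le> ennreal 1"
  proof -
    have "(\<integral>\<^sup>+p. A2 (Z p) \<partial>?W) = (\<integral>\<^sup>+z. A2 z \<partial>PC)"
      unfolding PC_def by (rule nn_integral_distr[symmetric]) measurable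
    also have "\<dots> = (\<integral>\<^sup>+z. I z / r z \<partial>PC) / ennreal B"
      unfolding A2_def by (rule nn_integral_divide) (simp add: PC_def)
    also have "\<dots> \<le> (\<integral>\<^sup>+z. I z \<partial>PZ) / ennreal B"
      unfolding r_def by (intro divide_right_mono_ennreal nn_integral_divide_RN_deriv_le[OF PZ.sigma_finite_measure_axioms ac sPC])
        (simp add: measurable_cong_sets[OF sPZ refl])
    also have "\<dots> \<le> ennreal B / ennreal B" by (intro divide_right_mono_ennreal IB)
    also have "\<dots> = 1" using B by simp
    finally show ?thesis by simp
  qed
  have aeW: "AE p in ?W. P (Z p)" if "AE z in PC. P z" "Measurable.pred (Rn n) P" for P
    using that unfolding PC_def by (subst (asm) AE_distr_iff) (auto simp: pred_def)
  have "AE z in PC. I z \<noteq> \<infinity> \<and> 0 < r z \<and> r z < \<infinity>"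
    using absolutely_continuous_AE[OF sPC ac Ifin]
      AE_RN_deriv_pos_finite[OF PZ.sigma_finite_measure_axioms PC.sigma_finite_measure_axioms ac sPC]
    unfolding r_def by eventually_elim auto
  then have ae: "AE p in ?W. I (Z p) \<noteq> \<infinity> \<and> 0 < r (Z p) \<and> r (Z p) < \<infinity>"
    by (rule aeW) measurable
  note i1 = integrable_enn2real_le[OF A1m A1]
  have A2Zm: "(\<lambda>p. A2 (Z p)) \<in> borel_measurable ?W" by measurable
  note i2 = integrable_enn2real_le[OF A2Zm A2]
  define e where "e = entropy_density 2 PZ PC"
  have em[measurable]: "e \<in> borel_measurable (Rn n)"
    unfolding e_def using measurable_cong_sets[OF sPZ refl] by auto
  have ei: "integrable ?W (\<lambda>p. e (Z p))"
    using ied unfolding PC_def e_def[symmetric] by (subst (asm) integrable_distr_eq) (auto simp: e_def[unfolded PC_def, symmetric])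
  have eI: "(\<integral>p. e (Z p) \<partial>?W) \<le> d"
  proof -
    have "(\<integral>p. e (Z p) \<partial>?W) = (\<integral>z. e z \<partial>PC)" unfolding PC_def by (rule integral_distr[symmetric]) measurable
    then show ?thesis using KL by (simp add: KL_divergence_def e_def)
  qed
  \<comment> \<open>The sum of the two inequalities solved for \<open>F\<close>. The first three
    terms have mean at most 0; the others are the logarithms of \<open>M\<close>, \<open>r\<close>
    and \<open>B\<close>, and the exponent \<open>\<phi>\<close>.\<close>
  define H where "H p = enn2real (A1 p) + enn2real (A2 (Z p)) - 2 + ln M + ln 2 * e (Z p) + ln B - \<phi> (fst p) (Z p)" for p
  have Hi: "integrable ?W H" unfolding H_def using i1 i2 ei int by auto
  have HI: "integral\<^sup>L ?W H \<le> ln M + ln 2 * d + ln B - (\<integral>p. \<phi> (fst p) (Z p) \<partial>?W)"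
  proof -
    have "integral\<^sup>L ?W H = (\<integral>p. enn2real (A1 p) \<partial>?W) + (\<integral>p. enn2real (A2 (Z p)) \<partial>?W) - 2 + ln M + ln 2 * (\<integral>p. e (Z p) \<partial>?W) + ln B - (\<integral>p. \<phi> (fst p) (Z p) \<partial>?W)"
      unfolding H_def using i1 i2 ei int by (simp add: W.prob_space)
    moreover have "ln 2 * (\<integral>p. e (Z p) \<partial>?W) \<le> ln 2 * d" using eI by (intro mult_left_mono) auto
    ultimately show ?thesis using i1(2) i2(2) by linarith
  qed
  have FH: "AE p in ?W. F (fst p) (Z p) \<le> H p"
    using ae AE_space
  proof eventually_elim
    case (elim p)
    define i where "i = enn2real (I (Z p))"
    define t where "t = enn2real (r (Z p))"
    define g where "g = \<phi> (fst p) (Z p) + F (fst p) (Z p)"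
    have zp: "Z p \<in> space (Rn n)" by (rule measurable_space[OF Z elim(2)])
    have i: "0 < i" "I (Z p) = ennreal i"
      using elim(1) Ipos[OF zp] by (auto simp: i_def enn2real_positive_iff less_top zero_less_iff_neq_zero)
    have t: "0 < t" "r (Z p) = ennreal t" using elim(1) by (auto simp: t_def enn2real_positive_iff)
    have a1: "enn2real (A1 p) = exp g / (M * i)"
    proof -
      have "A1 p = ennreal (exp g) / ennreal (M * i)"
        using i(1) by (simp add: A1_def G_def g_def i(2) ennreal_mult ennreal_of_nat_eq_real_of_nat)
      also have "\<dots> = ennreal (exp g / (M * i))" using i M by (intro divide_ennreal) auto
      finally show ?thesis using i by simp
    qed
    have a2: "enn2real (A2 (Z p)) = i / t / B"
      using i t B by (simp add: A2_def divide_ennreal)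
    have et: "ln 2 * e (Z p) = ln t"
      by (simp add: e_def entropy_density_def t_def r_def log_def)
    have "ln (exp g / (M * i)) \<le> exp g / (M * i) - 1" using i M by (intro ln_le_minus_one) simp
    moreover have "ln (exp g / (M * i)) = g - ln M - ln i" using i M by (simp add: ln_div ln_mult)
    moreover have "ln (i / t / B) \<le> i / t / B - 1" using i t B by (intro ln_le_minus_one) simp
    moreover have "ln (i / t / B) = ln i - ln t - ln B" using i(1) t(1) B(1) by (simp add: ln_div ln_mult)
    ultimately have "g \<le> exp g / (M * i) + i / t / B - 2 + ln M + ln t + ln B" by linarith
    then show ?case unfolding H_def a1 a2 et g_def by linarith
  qed
  have "(\<integral>\<^sup>+p. ennreal (F (fst p) (Z p)) \<partial>?W) \<le> (\<integral>\<^sup>+p. ennreal (H p) \<partial>?W)"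
    using FH by (intro nn_integral_mono_AE) (auto intro: ennreal_leI)
  also have "\<dots> = ennreal (integral\<^sup>L ?W H)"
    using FH F0 by (intro nn_integral_eq_integral Hi) (auto elim!: eventually_mono intro: order_trans)
  also have "\<dots> \<le> ennreal (ln M + ln 2 * d + ln B - (\<integral>p. \<phi> (fst p) (Z p) \<partial>?W))"
    by (rule ennreal_leI[OF HI])
  finally show ?thesis .
qed

text \<open>\<open>Q\<close> may carry more than the data: \<open>yv\<close> extracts the block, and
  the code randomness is an independent factor \<open>S\<close>. The signal and an auxiliary draw
  can thus live on the space on which the code output is realised.\<close>

lemma joint_law_code:
  assumes Q: "prob_space Q" and yv[measurable]: "yv \<in> Q \<rightarrow>\<^sub>M Rn n" and PY: "PY = distr Q (Rn n) yv"
    and code: "random_code n M S enc dec"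
    and K: "code_kernel n S enc dec \<in> PY \<rightarrow>\<^sub>M prob_algebra (Rn n)"
    and Z: "Z = (\<lambda>p. dec (snd p) (enc (snd p) (yv (fst p))))"
  shows "joint_law PY (code_kernel n S enc dec) (Rn n) = distr (Q \<Otimes>\<^sub>M S) (Rn n \<Otimes>\<^sub>M Rn n) (\<lambda>p. (yv (fst p), Z p))"
    and "PY \<bind> code_kernel n S enc dec = distr (Q \<Otimes>\<^sub>M S) (Rn n) Z"
proof -
  let ?J = "joint_law PY (code_kernel n S enc dec) (Rn n)"
  let ?K = "code_kernel n S enc dec"
  let ?D = "distr (Q \<Otimes>\<^sub>M S) (Rn n \<Otimes>\<^sub>M Rn n) (\<lambda>p. (yv (fst p), Z p))"
  let ?W = "Q \<Otimes>\<^sub>M S"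
  interpret Q: prob_space Q by fact
  interpret S: prob_space S using code by (simp add: random_code_def)
  interpret W: pair_prob_space Q S ..
  interpret PY: prob_space PY unfolding PY by (rule Q.prob_space_distr) measurable
  have Zm[measurable]: "Z \<in> ?W \<rightarrow>\<^sub>M Rn n" unfolding Z by (rule code_map_measurable[OF code yv])
  have sPY[measurable_cong, simp]: "sets PY = sets (Rn n)" by (simp add: PY)
  have dm[measurable]: "(\<lambda>(s, y). dec s (enc s y)) \<in> S \<Otimes>\<^sub>M Rn n \<rightarrow>\<^sub>M Rn n"
    using code by (simp add: random_code_def)
  have sec: "(\<lambda>s. dec s (enc s y)) \<in> S \<rightarrow>\<^sub>M Rn n" if "y \<in> space (Rn n)" for y
    using measurable_compose[OF measurable_Pair[OF measurable_ident measurable_const] dm, of y] that by simp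
  have key: "(\<integral>\<^sup>+p. f p \<partial>?J) = (\<integral>\<^sup>+p. f (yv (fst p), Z p) \<partial>?W)"
    if f[measurable]: "f \<in> borel_measurable (Rn n \<Otimes>\<^sub>M Rn n)" for f
  proof -
    have fP: "f \<in> borel_measurable (PY \<Otimes>\<^sub>M Rn n)"
      using f by (simp add: measurable_cong_sets[OF sets_pair_measure_cong[OF sPY refl] refl])
    have Km: "(\<lambda>y. \<integral>\<^sup>+z. f (y, z) \<partial>?K y) \<in> borel_measurable PY"
      by (rule nn_integral_measurable_subprob_algebra2[OF _ measurable_prob_algebraD[OF K]]) (use fP in \<open>simp add: split_def\<close>)
    have "(\<integral>\<^sup>+p. f p \<partial>?J) = (\<integral>\<^sup>+y. \<integral>\<^sup>+z. f (y, z) \<partial>?K y \<partial>PY)"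
      by (rule nn_integral_joint_law[OF K fP])
    also have "\<dots> = (\<integral>\<^sup>+x. \<integral>\<^sup>+z. f (yv x, z) \<partial>?K (yv x) \<partial>Q)"
      unfolding PY by (rule nn_integral_distr[OF yv Km[unfolded PY]])
    also have "\<dots> = (\<integral>\<^sup>+x. \<integral>\<^sup>+s. f (yv x, Z (x, s)) \<partial>S \<partial>Q)"
    proof (rule nn_integral_cong)
      fix x assume "x \<in> space Q"
      then have y: "yv x \<in> space (Rn n)" by (rule measurable_space[OF yv])
      have "(\<lambda>z. f (yv x, z)) \<in> borel_measurable (Rn n)" using y by measurable
      then show "(\<integral>\<^sup>+z. f (yv x, z) \<partial>?K (yv x)) = (\<integral>\<^sup>+s. f (yv x, Z (x, s)) \<partial>S)"
        unfolding code_kernel_def using nn_integral_distr[OF sec[OF y]] by (simp add: Z)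
    qed
    also have "\<dots> = (\<integral>\<^sup>+p. f (yv (fst p), Z p) \<partial>?W)"
      by (subst S.nn_integral_fst[symmetric]) auto
    finally show ?thesis .
  qed
  have sJ: "sets ?J = sets (Rn n \<Otimes>\<^sub>M Rn n)"
    unfolding sets_joint_law[OF K PY.not_empty] by (intro sets_pair_measure_cong) auto
  have dm2: "(\<lambda>p. (yv (fst p), Z p)) \<in> ?W \<rightarrow>\<^sub>M Rn n \<Otimes>\<^sub>M Rn n" by measurable
  show "?J = ?D"
  proof (rule measure_eqI)
    fix A assume "A \<in> sets ?J"
    then have A: "A \<in> sets (Rn n \<Otimes>\<^sub>M Rn n)" and A': "A \<in> sets ?J" by (auto simp: sJ)
    have ind: "indicator A \<in> borel_measurable (Rn n \<Otimes>\<^sub>M Rn n)" using A by simp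
    have "emeasure ?J A = (\<integral>\<^sup>+p. indicator A p \<partial>?J)"
      using A' by simp
    also have "\<dots> = (\<integral>\<^sup>+p. indicator A (yv (fst p), Z p) \<partial>?W)" by (rule key[OF ind])
    also have "\<dots> = (\<integral>\<^sup>+q. indicator A q \<partial>?D)"
      by (subst nn_integral_distr[OF dm2]) (use A in auto)
    also have "\<dots> = emeasure ?D A"
      using A by simp
    finally show "emeasure ?J A = emeasure ?D A" .
  qed (simp add: sJ)
  have sB: "sets (PY \<bind> ?K) = sets (Rn n)"
    by (rule sets_bind_kernel[OF K PY.not_empty])
  show "PY \<bind> ?K = distr ?W (Rn n) Z"
  proof (rule measure_eqI)
    fix A assume "A \<in> sets (PY \<bind> ?K)"
    then have A[measurable]: "A \<in> sets (Rn n)" by (simp add: sB)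
    have "emeasure (PY \<bind> ?K) A = (\<integral>\<^sup>+y. emeasure (?K y) A \<partial>PY)"
      by (rule emeasure_bind[OF PY.not_empty measurable_prob_algebraD[OF K] A])
    also have "\<dots> = (\<integral>\<^sup>+y. \<integral>\<^sup>+z. indicator A z \<partial>?K y \<partial>PY)"
      by (rule nn_integral_cong) (simp add: space_prob_kernel(2)[OF K])
    also have "\<dots> = (\<integral>\<^sup>+p. indicator A (snd p) \<partial>?J)"
      by (subst nn_integral_joint_law[OF K]) auto
    also have "\<dots> = (\<integral>\<^sup>+p. indicator A (snd (yv (fst p), Z p)) \<partial>?W)"
      by (rule key) measurable
    also have "\<dots> = (\<integral>\<^sup>+z. indicator A z \<partial>distr ?W (Rn n) Z)"
      by (subst nn_integral_distr[OF Zm]) auto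
    also have "\<dots> = emeasure (distr ?W (Rn n) Z) A" by simp
    finally show "emeasure (PY \<bind> ?K) A = emeasure (distr ?W (Rn n) Z) A" .
  qed (simp add: sB)
qed

lemma relative_entropy_self: "prob_space P \<Longrightarrow> relative_entropy P P = 0"
proof -
  let ?D = "density P (\<lambda>x. ennreal (exp 0))"
  assume P: "prob_space P"
  interpret P: prob_space P by fact
  have eq: "?D = P" by (simp add: density_1)
  have "relative_entropy ?D P
    = ennreal (integral\<^sup>L ?D (\<lambda>_. 0) / ln 2)"
    by (rule relative_entropy_density[OF P]) (simp_all only: eq P, simp_all)
  then show ?thesis unfolding eq by simp
qed

section \<open>Codes for the Gaussian source\<close>

context waterfilling
begin

text \<open>Change of measure with exponent \<open>Phi\<close>, whose mean along an admissible code
  is at least \<open>rate\<close>. The reference law \<open>R\<close> is left free: it will be the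
  optimal output law in one use and the output law of the code itself in another.\<close>

lemma code_gap:
  fixes F :: "'x \<Rightarrow> (nat \<Rightarrow> real) \<Rightarrow> real"
  assumes Q: "prob_space Q" and yv: "yv \<in> Q \<rightarrow>\<^sub>M Rn n" and PYQ: "PY = distr Q (Rn n) yv"
    and code: "random_code n M S enc dec"
    and adm: "admissible n PY D (code_kernel n S enc dec)" and D: "real n * D \<le> (\<Sum>i<n. dd i)"
    and R: "prob_space R" "sets R = sets (Rn n)"
    and fin: "relative_entropy (PY \<bind> code_kernel n S enc dec) R \<le> ennreal d" and d: "0 \<le> d"
    and F: "(\<lambda>(x, z). F x z) \<in> borel_measurable (Q \<Otimes>\<^sub>M Rn n)" and F0: "\<And>x z. 0 \<le> F x z"
    and B: "0 < B" "(\<integral>\<^sup>+z. \<integral>\<^sup>+x. ennreal (exp (Phi (yv x) z + F x z)) \<partial>Q \<partial>R) \<le> ennreal B"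
  shows "(\<integral>\<^sup>+p. ennreal (F (fst p) (dec (snd p) (enc (snd p) (yv (fst p))))) \<partial>(Q \<Otimes>\<^sub>M S))
    \<le> ennreal (ln M + ln 2 * d + ln B - rate)"
proof -
  let ?J = "joint_law PY (code_kernel n S enc dec) (Rn n)"
  let ?W = "Q \<Otimes>\<^sub>M S"
  note yv[measurable]
  define Z where "Z = (\<lambda>p. dec (snd p) (enc (snd p) (yv (fst p))))"
  have Km: "code_kernel n S enc dec \<in> kernels (Rn n) (Rn n)"
    and int: "integrable ?J (\<lambda>(y, z). distortion n y z)"
    and le: "(\<integral>(y, z). distortion n y z \<partial>?J) \<le> real n * D"
    using adm by (auto simp: admissible_def)
  note KP = sets_joint_law_PY(1)[OF Km]
  note J = joint_law_code(1)[OF Q yv PYQ code KP Z_def]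
  have Zm[measurable]: "Z \<in> ?W \<rightarrow>\<^sub>M Rn n" unfolding Z_def by (rule code_map_measurable[OF code yv])
  have PhiJ: "integrable ?W (\<lambda>p. Phi (yv (fst p)) (Z p))"
    "(\<integral>p. Phi (yv (fst p)) (Z p) \<partial>?W) = (\<integral>p. Phi (fst p) (snd p) \<partial>?J)"
    using integral_Phi(1)[OF Km int] unfolding J
    by (simp_all add: integrable_distr_eq integral_distr)
  have "rate \<le> (\<integral>p. Phi (yv (fst p)) (Z p) \<partial>?W)"
    unfolding PhiJ(2) integral_Phi(2)[OF Km int] using le D w by simp
  moreover have "(\<integral>\<^sup>+p. ennreal (F (fst p) (Z p)) \<partial>?W)
    \<le> ennreal (ln M + ln 2 * d + ln B - (\<integral>p. Phi (yv (fst p)) (Z p) \<partial>?W))"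
  proof (rule random_code_change_of_measure[OF Q yv code Z_def R _ d _ F F0 B PhiJ(1)])
    show "relative_entropy (distr ?W (Rn n) Z) R \<le> ennreal d"
      using fin unfolding joint_law_code(2)[OF Q yv PYQ code KP Z_def] .
    show "(\<lambda>(x, z). Phi (yv x) z) \<in> borel_measurable (Q \<Otimes>\<^sub>M Rn n)"
      unfolding split_def by measurable
  qed
  ultimately show ?thesis
    unfolding Z_def by (elim order_trans) (intro ennreal_leI, simp)
qed

text \<open>With the output law of the code as reference the divergence is 0. The constant
  \<open>F = 1\<close> with \<open>B = exp 1\<close> serves instead of \<open>F = 0\<close>, because
  an \<open>ennreal\<close> inequality with left side 0 says nothing about the sign of the real
  number on the right.\<close>

lemma rate_le_log_code_size:
  assumes code: "random_code n M S enc dec"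
    and adm: "admissible n PY D (code_kernel n S enc dec)" and D: "real n * D \<le> (\<Sum>i<n. dd i)"
  shows "rate \<le> ln M"
proof -
  have Km: "code_kernel n S enc dec \<in> kernels (Rn n) (Rn n)" using adm by (simp add: admissible_def)
  note KP = sets_joint_law_PY(1)[OF Km]
  let ?R = "PY \<bind> code_kernel n S enc dec"
  interpret PY: prob_space PY by (rule prob_PY)
  interpret S: prob_space S using code by (simp add: random_code_def)
  interpret W: pair_prob_space PY S ..
  interpret R: prob_space ?R by (rule prob_space_bind_kernel[OF prob_PY KP])
  have sR: "sets ?R = sets (Rn n)" by (rule sets_bind_kernel[OF KP space_PY_nonempty])
  have "(\<integral>\<^sup>+p. ennreal 1 \<partial>(PY \<Otimes>\<^sub>M S)) \<le> ennreal (ln M + ln 2 * 0 + ln (exp 1) - rate)"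
  proof (rule code_gap[OF prob_PY _ _ code adm D R.prob_space_axioms sR, where F = "\<lambda>_ _. 1" and yv = "\<lambda>y. y"])
    show "(\<lambda>y. y) \<in> PY \<rightarrow>\<^sub>M Rn n" by measurable
    show "PY = distr PY (Rn n) (\<lambda>y. y)" by (rule distr_id2[symmetric]) simp
    show "relative_entropy ?R ?R \<le> ennreal 0" using relative_entropy_self[OF R.prob_space_axioms] by simp
    have "(\<integral>\<^sup>+z. \<integral>\<^sup>+x. ennreal (exp (Phi x z + 1)) \<partial>PY \<partial>?R) \<le> (\<integral>\<^sup>+z. ennreal (exp 1) \<partial>?R)"
    proof (rule nn_integral_mono)
      fix z assume "z \<in> space ?R"
      then have z: "z \<in> space (Rn n)" by (simp add: sets_eq_imp_space_eq[OF sR])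
      have "(\<integral>\<^sup>+x. ennreal (exp (Phi x z + 1)) \<partial>PY) = (\<integral>\<^sup>+x. ennreal (exp 1) * ennreal (exp (Phi x z)) \<partial>PY)"
        by (intro nn_integral_cong) (simp add: exp_add ennreal_mult mult.commute)
      also have "\<dots> = ennreal (exp 1) * (\<integral>\<^sup>+x. ennreal (exp (Phi x z)) \<partial>PY)"
        by (rule nn_integral_cmult) (use z in measurable)
      also have "\<dots> \<le> ennreal (exp 1) * 1"
        by (intro mult_left_mono nn_integral_exp_Phi_le_1 z) simp
      finally show "(\<integral>\<^sup>+x. ennreal (exp (Phi x z + 1)) \<partial>PY) \<le> ennreal (exp 1)" by simp
    qed
    then show "(\<integral>\<^sup>+z. \<integral>\<^sup>+x. ennreal (exp (Phi x z + 1)) \<partial>PY \<partial>?R) \<le> ennreal (exp 1)"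
      by (simp add: R.emeasure_space_1)
  qed auto
  then have "ennreal 1 \<le> ennreal (ln M + 1 - rate)" by (simp add: W.emeasure_space_1)
  then have "1 \<le> ln M + 1 - rate"
    by (metis ennreal_le_iff2 not_one_le_zero)
  then show ?thesis by simp
qed

text \<open>The rotation is an isometry, and coordinate \<open>i\<close> of the noise enters with
  the factor \<open>bb i\<close>, whose square \<open>dd i * aa i\<close> is at most
  \<open>l i\<close>.\<close>

lemma distortion_opt_out_le:
  assumes \<Lambda>: "\<And>i. i < n \<Longrightarrow> l i \<le> \<Lambda>" and \<Lambda>0: "0 \<le> \<Lambda>"
  shows "distortion n (opt_out y g) (opt_out y g') \<le> \<Lambda> * (\<Sum>i<n. (g i - g' i)\<^sup>2)"
proof -
  have "distortion n (opt_out y g) (opt_out y g') = (\<Sum>i<n. (bb i)\<^sup>2 * (g i - g' i)\<^sup>2)"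
    unfolding opt_out_def distortion_rot[OF orthonormal]
    by (intro sum.cong refl) (simp add: power_mult_distrib[symmetric] right_diff_distrib)
  also have "\<dots> \<le> (\<Sum>i<n. \<Lambda> * (g i - g' i)\<^sup>2)"
  proof (intro sum_mono mult_right_mono)
    fix i assume "i \<in> {..<n}"
    then have "dd i * aa i \<le> \<Lambda> * 1"
      using \<Lambda>[of i] dd[of i] aa[of i] \<Lambda>0 by (intro mult_mono) auto
    then show "(bb i)\<^sup>2 \<le> \<Lambda>" by (simp add: bb_square)
  qed simp
  finally show ?thesis by (simp add: sum_distrib_left)
qed

text \<open>As a function of the noise, the composite has Lipschitz constant
  \<open>L * sqrt \<Lambda> / sqrt n\<close>: \<open>L\<close> from \<open>H\<close>,
  \<open>sqrt \<Lambda>\<close> from \<open>opt_out\<close>, and \<open>1 / sqrt n\<close> from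
  \<open>ndist\<close>.\<close>

lemma opt_kernel_concentration:
  assumes n: "1 \<le> n" and H[measurable]: "H \<in> borel_measurable (Rn n)"
    and lip: "\<And>a b. a \<in> space (Rn n) \<Longrightarrow> b \<in> space (Rn n) \<Longrightarrow> \<bar>H a - H b\<bar> \<le> L * ndist n a b"
    and L: "0 < L" and \<Lambda>: "\<And>i. i < n \<Longrightarrow> l i \<le> \<Lambda>" "0 < \<Lambda>"
    and y: "y \<in> space (Rn n)"
  shows "(\<integral>\<^sup>+g. \<integral>\<^sup>+g'. ennreal (exp ((H (opt_out y g) - H (opt_out y g'))\<^sup>2 / (8 * (L\<^sup>2 * \<Lambda> / n)))) \<partial>std_gauss_n n \<partial>std_gauss_n n) \<le> 2"
proof -
  let ?g = "std_gauss_n n"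
  define e where "e = L * sqrt \<Lambda> / sqrt n"
  have e: "0 < e" "e\<^sup>2 = L\<^sup>2 * \<Lambda> / n"
    using n L \<Lambda> by (auto simp: e_def power_divide power_mult_distrib)
  have out: "opt_out y g \<in> space (Rn n)" for g by (simp add: space_Rn opt_out_def rot_def)
  have om: "(\<lambda>g. opt_out y g) \<in> Rn n \<rightarrow>\<^sub>M Rn n" using y by measurable
  have "(\<integral>\<^sup>+g. \<integral>\<^sup>+g'. ennreal (exp (((\<lambda>g. H (opt_out y g)) g - (\<lambda>g. H (opt_out y g)) g')\<^sup>2 / (8 * e\<^sup>2))) \<partial>?g \<partial>?g) \<le> 2"
  proof (rule std_gauss_n_Lipschitz_exp_square[OF _ _ e(1)])
    show "(\<lambda>g. H (opt_out y g)) \<in> borel_measurable (\<Pi>\<^sub>M i\<in>{..<n}. borel)"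
      using measurable_compose[OF om H] by (simp add: Rn_def)
    fix g g'
    have "\<bar>H (opt_out y g) - H (opt_out y g')\<bar> \<le> L * ndist n (opt_out y g) (opt_out y g')" by (rule lip[OF out out])
    also have "ndist n (opt_out y g) (opt_out y g') = sqrt (distortion n (opt_out y g) (opt_out y g')) / sqrt n"
      by (simp add: ndist_def distortion_def L2_set_nonneg)
    also have "L * (sqrt (distortion n (opt_out y g) (opt_out y g')) / sqrt n) \<le> L * (sqrt (\<Lambda> * (\<Sum>i<n. (g i - g' i)\<^sup>2)) / sqrt n)"
      using L \<Lambda> by (intro mult_left_mono divide_right_mono real_sqrt_le_mono distortion_opt_out_le) auto
    also have "\<dots> = e * L2_set (\<lambda>i. g i - g' i) {..<n}"
      by (simp add: e_def L2_set_def real_sqrt_mult)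
    finally show "\<bar>H (opt_out y g) - H (opt_out y g')\<bar> \<le> e * L2_set (\<lambda>i. g i - g' i) {..<n}" .
  qed
  then show ?thesis by (simp only: e(2))
qed

end

section \<open>Existence of the water level\<close>

text \<open>The total distortion is continuous in the level, 0 at level 0, and the total variance
  once the level exceeds every single variance.\<close>

lemma exists_water_level:
  fixes l :: "nat \<Rightarrow> real"
  assumes l: "\<And>i. 0 < l i" and D: "0 < D" "D \<le> (\<Sum>i<n. l i)"
  shows "\<exists>w>0. (\<Sum>i<n. min (l i) w) = D"
proof -
  define f where "f w = (\<Sum>i<n. min (l i) w)" for w
  have up: "l i \<le> (\<Sum>i<n. l i)" if "i < n" for i
    using that l by (intro member_le_sum) (auto simp: less_imp_le)
  have f0: "f 0 = 0" by (simp add: f_def min_absorb2 less_imp_le l)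
  have f1: "f (\<Sum>i<n. l i) = (\<Sum>i<n. l i)" unfolding f_def using up by (intro sum.cong) auto
  have "\<exists>w\<ge>0. w \<le> (\<Sum>i<n. l i) \<and> f w = D"
  proof (rule IVT')
    show "continuous_on {0..\<Sum>i<n. l i} f" unfolding f_def by (intro continuous_intros)
  qed (use D f0 f1 in auto)
  then obtain w where "0 \<le> w" "f w = D" by auto
  moreover have "w \<noteq> 0" using f0 D(1) \<open>f w = D\<close> by auto
  ultimately show ?thesis unfolding f_def by (intro exI[of _ w]) auto
qed

text \<open>If \<open>D\<close> were not positive, a low water level would make the rate exceed \<open>ln M\<close>. If \<open>n * D\<close>
  exceeded the total variance, a constant output would be the unique optimum, with distortion
  strictly below \<open>n * D\<close>.\<close>

lemma optimal_water_level:
  assumes n: "1 \<le> n" and o: "orthonormal n v" and l: "\<And>i. 0 < l i"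
    and QY: "QY = distr (normal_prod n l) (Rn n) (rot n v m)"
    and u: "unique_optimal_kernel n QY D K"
    and code: "random_code n M S enc dec" and adm: "admissible n QY D (code_kernel n S enc dec)"
  obtains w where "waterfilling n v l w" "real n * D = (\<Sum>i<n. min (l i) w)"
proof -
  have PYw: "waterfilling.PY n v m l = QY" if "waterfilling n v l w" for w
    using waterfilling.PY_def[OF that] waterfilling.PX_def[OF that] by (simp add: QY)
  have Dpos: "0 < D"
  proof (rule ccontr)
    assume "\<not> 0 < D"
    \<comment> \<open>Half the logarithm of \<open>l 0 / w\<close> is \<open>ln M + 1\<close>, so
      coordinate 0 alone already pushes \<open>rate\<close> beyond \<open>ln M\<close>.\<close>
    define w where "w = l 0 * exp (- 2 * (ln M + 1))"
    have w: "0 < w" using l by (simp add: w_def)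
    interpret waterfilling n v m l w using o l w by unfold_locales
    have "rate \<le> ln M"
    proof (rule rate_le_log_code_size[OF code, of D])
      show "admissible n PY D (code_kernel n S enc dec)" using adm PYw[OF waterfilling_axioms] by simp
      have "real n * D \<le> 0" using \<open>\<not> 0 < D\<close> by (intro mult_nonneg_nonpos) auto
      then show "real n * D \<le> (\<Sum>i<n. dd i)" using sum_dd_nonneg by linarith
    qed
    moreover have "ln M + 1 \<le> ln (l 0 / dd 0) / 2"
    proof -
      have "l 0 / w \<le> l 0 / dd 0" using dd[of 0] l[of 0] w by (intro divide_left_mono) auto
      then have "ln (l 0 / w) \<le> ln (l 0 / dd 0)" using l[of 0] w dd[of 0] by (subst ln_le_cancel_iff) auto
      moreover have "l 0 / w = exp (2 * (ln M + 1))"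
        using l[of 0] by (simp add: w_def exp_minus field_simps flip: exp_add)
      ultimately show ?thesis by simp
    qed
    moreover have "ln (l 0 / dd 0) / 2 \<le> rate"
      unfolding rate_def using n dd l
      by (intro member_le_sum[of 0 "{..<n}" "\<lambda>i. ln (l i / dd i) / 2"]) auto
    ultimately show False by linarith
  qed
  have le: "real n * D \<le> (\<Sum>i<n. l i)"
  proof (rule ccontr)
    assume neg: "\<not> real n * D \<le> (\<Sum>i<n. l i)"
    \<comment> \<open>All variances lie below this level, so \<open>dd i = l i\<close>, every
      \<open>aa i\<close> vanishes and the rate is 0.\<close>
    define w where "w = (\<Sum>i<n. l i) + 1"
    have s0: "0 \<le> (\<Sum>i<n. l i)" using l by (intro sum_nonneg) (simp add: less_imp_le)
    interpret waterfilling n v m l w using o l s0 by unfold_locales (auto simp: w_def)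
    have ddl: "dd i = l i" if "i < n" for i
    proof -
      have "l i \<le> (\<Sum>i<n. l i)" using that l by (intro member_le_sum) (auto simp: less_imp_le)
      then show ?thesis unfolding dd_def by (simp add: w_def)
    qed
    have r0: "rate = 0" unfolding rate_def using ddl l by (simp add: less_imp_neq[symmetric])
    have u': "unique_optimal_kernel n PY D K" using u PYw[OF waterfilling_axioms] by simp
    have adm': "admissible n PY D opt_kernel" using neg ddl by (intro admissible_opt_kernel(1)) simp
    have i0: "kernel_information PY opt_kernel (Rn n) = 0" using r0 by (simp add: kernel_information_opt_kernel)
    have "block_rdf n PY D \<le> 0"
      unfolding block_rdf_def i0[symmetric] by (rule INF_lower) (simp add: adm')
    then have "kernel_information PY opt_kernel (Rn n) = block_rdf n PY D" using i0 by simp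
    then have ae: "AE y in PY. opt_kernel y = K y"
      using u' adm' unfolding unique_optimal_kernel_def by metis
    have Km: "K \<in> kernels (Rn n) (Rn n)" using u' by (simp add: unique_optimal_kernel_def admissible_def)
    have "joint_law PY opt_kernel (Rn n) = joint_law PY K (Rn n)"
      by (rule joint_law_cong_AE[OF opt_kernel_measurable_PY sets_joint_law_PY(1)[OF Km] ae])
    then have "real n * D = (\<Sum>i<n. dd i)"
      using u' integral_distortion_opt_kernel[of D] neg ddl by (simp add: unique_optimal_kernel_def)
    then show False using neg ddl by simp
  qed
  obtain w where "0 < w" "(\<Sum>i<n. min (l i) w) = real n * D"
    using exists_water_level[of l "real n * D" n] l Dpos n le by auto
  then show ?thesis using o l by (intro that[of w]) (auto simp: waterfilling_def)
qed

section \<open>Comparison of the risks\<close>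

text \<open>Continuity is proved for the extension to all sequences that ignores coordinates from
  \<open>n\<close> on, since for sequences the product sigma-algebra coincides with the Borel sets
  of the product topology. The Lipschitz bound thereby supplies the measurability of the loss in the
  reconstruction.\<close>

lemma Lipschitz_measurable_Rn:
  assumes lip: "\<And>a b. a \<in> space (Rn n) \<Longrightarrow> b \<in> space (Rn n) \<Longrightarrow> \<bar>F a - F b\<bar> \<le> L * ndist n a b"
  shows "F \<in> borel_measurable (Rn n)"
proof -
  define F' where "F' x = F (restrict x {..<n})" for x :: "nat \<Rightarrow> real"
  have cont: "continuous_on UNIV F'"
    unfolding continuous_on_def
  proof
    fix x :: "nat \<Rightarrow> real"
    let ?b = "\<lambda>y. L / sqrt n * sqrt (\<Sum>i<n. (y i - x i)\<^sup>2)"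
    have c: "((\<lambda>y::nat \<Rightarrow> real. y i) \<longlongrightarrow> x i) (at x within UNIV)" for i
      using continuous_on_product_coordinates[of i] unfolding continuous_on_def by auto
    have "(?b \<longlongrightarrow> L / sqrt n * sqrt (\<Sum>i<n. (x i - x i)\<^sup>2)) (at x within UNIV)"
      by (intro tendsto_intros c)
    then have lim0: "(?b \<longlongrightarrow> 0) (at x within UNIV)" by simp
    have "((\<lambda>y. F' y - F' x) \<longlongrightarrow> 0) (at x within UNIV)"
    proof (rule Lim_null_comparison[OF _ lim0], rule always_eventually, rule allI)
      fix y :: "nat \<Rightarrow> real"
      have "\<bar>F' y - F' x\<bar> \<le> L * ndist n (restrict y {..<n}) (restrict x {..<n})"
        unfolding F'_def by (rule lip) (auto simp: space_Rn)
      also have "ndist n (restrict y {..<n}) (restrict x {..<n}) = sqrt (\<Sum>i<n. (y i - x i)\<^sup>2) / sqrt n"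
        by (simp add: ndist_def L2_set_def)
      finally show "norm (F' y - F' x) \<le> ?b y" by simp
    qed
    then show "(F' \<longlongrightarrow> F' x) (at x within UNIV)" by (simp add: LIM_zero_iff)
  qed
  then have "F' \<in> borel_measurable borel" by (rule borel_measurable_continuous_onI)
  then have F'm: "F' \<in> borel_measurable (PiM UNIV (\<lambda>_. borel))"
    by (simp add: measurable_cong_sets[OF sets_PiM_equal_borel refl])
  have "(\<lambda>x. \<lambda>i\<in>UNIV. if i < n then x i else 0) \<in> Rn n \<rightarrow>\<^sub>M PiM UNIV (\<lambda>_. borel)"
  proof (rule measurable_restrict)
    fix i :: nat
    show "(\<lambda>x. if i < n then x i else 0) \<in> borel_measurable (Rn n)"
      by (cases "i < n") (auto intro: component_measurable_Rn[of "\<lambda>x. x" "Rn n" n i])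
  qed
  then have "(\<lambda>x. F' (\<lambda>i\<in>UNIV. if i < n then x i else 0)) \<in> borel_measurable (Rn n)"
    by (rule measurable_compose[OF _ F'm])
  moreover have "F' (\<lambda>i\<in>UNIV. if i < n then x i else 0) = F x" if "x \<in> space (Rn n)" for x
  proof -
    have "restrict (\<lambda>i\<in>UNIV. if i < n then x i else 0) {..<n} = x"
      using that by (intro extensionalityI[of _ "{..<n}"]) (auto simp: space_Rn)
    then show ?thesis by (simp add: F'_def)
  qed
  ultimately show ?thesis by (subst (asm) measurable_cong) auto
qed

section \<open>Measurability in the signal space\<close>

lemma space_metric_borel: "space (metric_borel T) = mspace T"
  unfolding metric_borel_def by (rule space_measure_of) (auto dest!: openin_subset)

lemma mball_in_metric_borel: "q \<in> mspace T \<Longrightarrow> {a \<in> mspace T. mdist T q a < r} \<in> sets (metric_borel T)"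
proof -
  assume q: "q \<in> mspace T"
  interpret Metric_space "mspace T" "mdist T" by (rule Metric_space_mspace_mdist)
  have "{a \<in> mspace T. mdist T q a < r} = mball q r" using q by (auto simp: mball_def)
  then have "openin (mtopology_of T) {a \<in> mspace T. mdist T q a < r}"
    by (simp add: mtopology_of_def)
  then show ?thesis unfolding metric_borel_def
    by (subst sets_measure_of) (auto dest!: openin_subset)
qed

text \<open>Separability reduces the joint condition to distances from fixed points:
  \<open>mdist T (f x) (g x) < r\<close> holds iff some \<open>q\<close> in a countable dense set
  and some rational \<open>s\<close> satisfy \<open>mdist T q (f x) < s\<close> and
  \<open>mdist T q (g x) < r - s\<close>.\<close>

lemma mdist_measurable:
  assumes T: "polish_metric T"
    and f: "\<And>x. x \<in> space M \<Longrightarrow> f x \<in> mspace T" "\<And>q. q \<in> mspace T \<Longrightarrow> (\<lambda>x. mdist T q (f x)) \<in> borel_measurable M"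
    and g: "\<And>x. x \<in> space M \<Longrightarrow> g x \<in> mspace T" "\<And>q. q \<in> mspace T \<Longrightarrow> (\<lambda>x. mdist T q (g x)) \<in> borel_measurable M"
  shows "(\<lambda>x. mdist T (f x) (g x)) \<in> borel_measurable M"
proof -
  interpret Metric_space "mspace T" "mdist T" by (rule Metric_space_mspace_mdist)
  obtain C where C: "countable C" "C \<subseteq> mspace T" and dense: "mtopology closure_of C = mspace T"
    using T by (auto simp: polish_metric_def separable_space_def mtopology_of_def)
  have near: "\<exists>q\<in>C. mdist T a q < e" if "a \<in> mspace T" "0 < e" for a e
  proof -
    have "a \<in> mtopology closure_of C" using that dense by simp
    then show ?thesis using that unfolding metric_closure_of by auto
  qed
  show ?thesis
  proof (rule borel_measurableI_less)
    fix r :: real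
  let ?U = "(\<Union>q\<in>C. \<Union>s\<in>\<rat>. {x \<in> space M. mdist T q (f x) < s} \<inter> {x \<in> space M. mdist T q (g x) < r - s})"
  let ?A = "{x \<in> space M. mdist T (f x) (g x) < r}"
    have "?A =
      ?U"
    proof (intro Set.set_eqI iffI)
      fix x assume "x \<in> ?A"
      then have x: "x \<in> space M" "mdist T (f x) (g x) < r" by auto
      \<comment> \<open>With \<open>q\<close> closer than \<open>e\<close> to \<open>f x\<close> and
        \<open>e < s < 2 * e\<close>, the distance from \<open>q\<close> to \<open>g x\<close> is
        below \<open>r - 3 * e\<close>, hence below \<open>r - s\<close>.\<close>
      define e where "e = (r - mdist T (f x) (g x)) / 4"
      have e: "0 < e" using x by (simp add: e_def)
      obtain q where q: "q \<in> C" "mdist T (f x) q < e" using near[OF f(1)[OF x(1)] e] by auto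
      obtain s where s: "s \<in> \<rat>" "e < s" "s < 2 * e" using Rats_dense_in_real[of e "2 * e"] e by auto
      have qT: "q \<in> mspace T" using q C by auto
      have "mdist T q (g x) \<le> mdist T q (f x) + mdist T (f x) (g x)"
        using triangle[OF qT f(1)[OF x(1)] g(1)[OF x(1)]] .
      also have "\<dots> < r - s" using q s e_def by (simp add: commute[of q] e_def field_simps)
      finally have "mdist T q (g x) < r - s" .
      moreover have "mdist T q (f x) < s" using q s by (simp add: commute[of q])
      ultimately show "x \<in> ?U"
        using q(1) s(1) x(1) by blast
    next
      fix x assume "x \<in> ?U"
      then obtain q s where q: "q \<in> C" and x: "x \<in> space M" "mdist T q (f x) < s" "mdist T q (g x) < r - s" by auto
      have qT: "q \<in> mspace T" using q C by auto
      have "mdist T (f x) (g x) \<le> mdist T (f x) q + mdist T q (g x)"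
        using triangle[OF f(1)[OF x(1)] qT g(1)[OF x(1)]] .
      then show "x \<in> ?A" using x by (simp add: commute[of _ q])
    qed
    also have "\<dots> \<in> sets M"
    proof (intro sets.countable_UN'' countable_rat C(1) sets.Int)
      fix q s assume "q \<in> C"
      then have "q \<in> mspace T" using C by auto
      note [measurable] = f(2)[OF this] g(2)[OF this]
      show "{x \<in> space M. mdist T q (f x) < s} \<in> sets M" "{x \<in> space M. mdist T q (g x) < r - s} \<in> sets M"
        by measurable
    qed
    finally show "?A \<in> sets M" .
  qed
qed

section \<open>Risks on a common probability space\<close>

lemma risk_eq:
  assumes P: "prob_space P" and T: "polish_metric T"
    and th[measurable]: "th \<in> P \<rightarrow>\<^sub>M metric_borel T" and Y[measurable]: "block Y n \<in> P \<rightarrow>\<^sub>M Rn n"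
    and K: "K \<in> Rn n \<rightarrow>\<^sub>M prob_algebra (Rn n)"
    and h: "(\<lambda>p. mdist T (fst p) (\<phi> (snd p))) \<in> borel_measurable (metric_borel T \<Otimes>\<^sub>M Rn n)"
  shows "risk T n (signal_block_law P T th Y n) K \<phi> =
    (\<integral>\<^sup>+\<omega>. \<integral>\<^sup>+z. ennreal ((mdist T (th \<omega>) (\<phi> z))\<^sup>2) \<partial>K (block Y n \<omega>) \<partial>P)"
proof -
  let ?Q = "signal_block_law P T th Y n"
  let ?f = "\<lambda>p. ennreal ((mdist T (fst (fst p)) (\<phi> (snd p)))\<^sup>2)"
  have sQ: "sets ?Q = sets (metric_borel T \<Otimes>\<^sub>M Rn n)" by (simp add: signal_block_law_def)
  have K2: "(\<lambda>p. K (snd p)) \<in> metric_borel T \<Otimes>\<^sub>M Rn n \<rightarrow>\<^sub>M prob_algebra (Rn n)"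
    by (rule measurable_compose[OF measurable_snd K])
  then have K3: "(\<lambda>p. K (snd p)) \<in> ?Q \<rightarrow>\<^sub>M prob_algebra (Rn n)"
    by (simp add: measurable_cong_sets[OF sQ refl])
  have f: "?f \<in> borel_measurable ((metric_borel T \<Otimes>\<^sub>M Rn n) \<Otimes>\<^sub>M Rn n)"
  proof -
    have "(\<lambda>p. (fst (fst p), snd p)) \<in> (metric_borel T \<Otimes>\<^sub>M Rn n) \<Otimes>\<^sub>M Rn n \<rightarrow>\<^sub>M metric_borel T \<Otimes>\<^sub>M Rn n"
      by measurable
    from measurable_compose[OF this h] show ?thesis by simp
  qed
  have fQ: "?f \<in> borel_measurable (?Q \<Otimes>\<^sub>M Rn n)"
    using f by (simp add: measurable_cong_sets[OF sets_pair_measure_cong[OF sQ refl] refl])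
  have inner: "(\<lambda>q. \<integral>\<^sup>+z. ?f (q, z) \<partial>K (snd q)) \<in> borel_measurable (metric_borel T \<Otimes>\<^sub>M Rn n)"
    by (rule nn_integral_measurable_subprob_algebra2[OF _ measurable_prob_algebraD[OF K2]]) (use f in \<open>simp add: split_def\<close>)
  have tY: "(\<lambda>\<omega>. (th \<omega>, block Y n \<omega>)) \<in> P \<rightarrow>\<^sub>M metric_borel T \<Otimes>\<^sub>M Rn n" by measurable
  have "risk T n ?Q K \<phi> = (\<integral>\<^sup>+p. ?f p \<partial>joint_law ?Q (\<lambda>p. K (snd p)) (Rn n))"
    by (simp add: risk_def split_def)
  also have "\<dots> = (\<integral>\<^sup>+q. \<integral>\<^sup>+z. ?f (q, z) \<partial>K (snd q) \<partial>?Q)"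
    by (rule nn_integral_joint_law[OF K3 fQ])
  also have "\<dots> = (\<integral>\<^sup>+\<omega>. \<integral>\<^sup>+z. ?f ((th \<omega>, block Y n \<omega>), z) \<partial>K (snd (th \<omega>, block Y n \<omega>)) \<partial>P)"
    unfolding signal_block_law_def by (rule nn_integral_distr[OF tY]) (use inner in simp)
  finally show ?thesis by simp
qed

lemma block_measurable:
  assumes "\<And>i. Y i \<in> borel_measurable P"
  shows "block Y n \<in> P \<rightarrow>\<^sub>M Rn n"
  unfolding block_def Rn_def using assms by (intro measurable_restrict)

text \<open>With \<open>d = f x - g x\<close>, the squares differ by
  \<open>2 * f x * d - d\<^sup>2\<close>, and the cross term is split by Young's inequality with
  weight \<open>\<epsilon>\<close>. The integrability of the square of \<open>g\<close> is a
  consequence, so the second risk is finite too.\<close>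

lemma square_integral_gap:
  fixes f g :: "'x \<Rightarrow> real"
  assumes [measurable]: "f \<in> borel_measurable M" "g \<in> borel_measurable M"
    and f: "(\<integral>\<^sup>+x. ennreal ((f x)\<^sup>2) \<partial>M) = ennreal a" and a: "0 \<le> a"
    and fg: "(\<integral>\<^sup>+x. ennreal ((f x - g x)\<^sup>2) \<partial>M) \<le> ennreal \<delta>" and \<delta>: "0 \<le> \<delta>"
    and \<epsilon>: "0 < \<epsilon>"
  shows "\<bar>enn2ereal (\<integral>\<^sup>+x. ennreal ((f x)\<^sup>2) \<partial>M) - enn2ereal (\<integral>\<^sup>+x. ennreal ((g x)\<^sup>2) \<partial>M)\<bar>
    \<le> ereal (\<epsilon> * a + (1 + 1 / \<epsilon>) * \<delta>)"
proof -
  have if': "integrable M (\<lambda>x. (f x)\<^sup>2)" by (rule integrableI_nonneg) (use f in auto)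
  have ifg: "integrable M (\<lambda>x. (f x - g x)\<^sup>2)"
    by (rule integrableI_nonneg) (use fg in \<open>auto intro: le_less_trans\<close>)
  have Ia: "(\<integral>x. (f x)\<^sup>2 \<partial>M) = a"
    using f a nn_integral_eq_integral[OF if'] by simp
  have Id: "(\<integral>x. (f x - g x)\<^sup>2 \<partial>M) \<le> \<delta>"
    using fg \<delta> nn_integral_eq_integral[OF ifg] by simp
  have pt: "\<bar>(f x)\<^sup>2 - (g x)\<^sup>2\<bar> \<le> \<epsilon> * (f x)\<^sup>2 + (1 + 1 / \<epsilon>) * (f x - g x)\<^sup>2" for x
  proof -
    define d where "d = f x - g x"
    have "2 * \<bar>f x\<bar> * \<bar>d\<bar> \<le> \<epsilon> * (f x)\<^sup>2 + (1 / \<epsilon>) * d\<^sup>2"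
    proof -
      have "0 \<le> (sqrt \<epsilon> * \<bar>f x\<bar> - \<bar>d\<bar> / sqrt \<epsilon>)\<^sup>2" by simp
      also have "\<dots> = \<epsilon> * (f x)\<^sup>2 + (1 / \<epsilon>) * d\<^sup>2 - 2 * \<bar>f x\<bar> * \<bar>d\<bar>"
        using \<epsilon> by (simp add: power2_diff power_mult_distrib power_divide)
      finally show ?thesis by simp
    qed
    moreover have "(f x)\<^sup>2 - (g x)\<^sup>2 = 2 * f x * d - d\<^sup>2" by (simp add: d_def power2_eq_square algebra_simps)
    moreover have "\<bar>2 * f x * d - d\<^sup>2\<bar> \<le> 2 * \<bar>f x\<bar> * \<bar>d\<bar> + d\<^sup>2"
      using abs_triangle_ineq4[of "2 * f x * d" "d\<^sup>2"] by (simp add: abs_mult)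
    ultimately show ?thesis unfolding d_def[symmetric] by (simp add: distrib_right)
  qed
  have igb: "integrable M (\<lambda>x. (f x)\<^sup>2 + (\<epsilon> * (f x)\<^sup>2 + (1 + 1 / \<epsilon>) * (f x - g x)\<^sup>2))" using if' ifg by auto
  have ig: "integrable M (\<lambda>x. (g x)\<^sup>2)"
  proof (rule Bochner_Integration.integrable_bound[OF igb])
    show "AE x in M. norm ((g x)\<^sup>2) \<le> norm ((f x)\<^sup>2 + (\<epsilon> * (f x)\<^sup>2 + (1 + 1 / \<epsilon>) * (f x - g x)\<^sup>2))"
    proof (rule AE_I2)
      fix x show "norm ((g x)\<^sup>2) \<le> norm ((f x)\<^sup>2 + (\<epsilon> * (f x)\<^sup>2 + (1 + 1 / \<epsilon>) * (f x - g x)\<^sup>2))"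
        using pt[of x] by (simp add: abs_le_iff)
    qed
  qed simp
  have eg: "(\<integral>\<^sup>+x. ennreal ((g x)\<^sup>2) \<partial>M) = ennreal (\<integral>x. (g x)\<^sup>2 \<partial>M)"
    using ig by (intro nn_integral_eq_integral) auto
  have "\<bar>(\<integral>x. (f x)\<^sup>2 \<partial>M) - (\<integral>x. (g x)\<^sup>2 \<partial>M)\<bar> = \<bar>\<integral>x. (f x)\<^sup>2 - (g x)\<^sup>2 \<partial>M\<bar>"
    using if' ig by simp
  also have "\<dots> \<le> (\<integral>x. \<bar>(f x)\<^sup>2 - (g x)\<^sup>2\<bar> \<partial>M)" by (rule integral_abs_bound)
  also have "\<dots> \<le> (\<integral>x. \<epsilon> * (f x)\<^sup>2 + (1 + 1 / \<epsilon>) * (f x - g x)\<^sup>2 \<partial>M)"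
    using if' ig ifg by (intro integral_mono pt) auto
  also have "\<dots> = \<epsilon> * a + (1 + 1 / \<epsilon>) * (\<integral>x. (f x - g x)\<^sup>2 \<partial>M)" using if' ifg Ia by simp
  also have "\<dots> \<le> \<epsilon> * a + (1 + 1 / \<epsilon>) * \<delta>" using Id \<epsilon> by (intro add_left_mono mult_left_mono) auto
  finally show ?thesis unfolding eg f using a by (simp add: Ia enn2ereal_ennreal)
qed

text \<open>The Gaussian factor is invisible to the integrand and integrates out. It is carried
  along so that the code output and the draw from the optimal kernel live on the same space.\<close>

lemma nn_integral_code_pair:
  assumes P: "prob_space P" and code: "random_code n M S enc dec"
    and Y: "block Y n \<in> P \<rightarrow>\<^sub>M Rn n"
    and h: "(\<lambda>(\<omega>, z). f \<omega> z) \<in> borel_measurable (P \<Otimes>\<^sub>M Rn n)"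
  shows "(\<integral>\<^sup>+\<omega>. \<integral>\<^sup>+z. f \<omega> z \<partial>code_kernel n S enc dec (block Y n \<omega>) \<partial>P)
    = (\<integral>\<^sup>+p. f (fst (fst p)) (dec (snd p) (enc (snd p) (block Y n (fst (fst p))))) \<partial>((P \<Otimes>\<^sub>M std_gauss_n n) \<Otimes>\<^sub>M S))"
proof -
  let ?W = "(P \<Otimes>\<^sub>M std_gauss_n n) \<Otimes>\<^sub>M S"
  let ?Q = "P \<Otimes>\<^sub>M std_gauss_n n"
  let ?g = "std_gauss_n n"
  interpret P: prob_space P by fact
  interpret S: prob_space S using code by (simp add: random_code_def)
  interpret g: prob_space "?g" by (rule prob_space_std_gauss_n)
  interpret Pg: pair_prob_space P "?g" ..
  interpret W: pair_prob_space "?Q" S ..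
  have yv: "(\<lambda>x. block Y n (fst x)) \<in> ?Q \<rightarrow>\<^sub>M Rn n"
    by (rule measurable_compose[OF measurable_fst Y])
  have dm[measurable]: "(\<lambda>(s, y). dec s (enc s y)) \<in> S \<Otimes>\<^sub>M Rn n \<rightarrow>\<^sub>M Rn n"
    using code by (simp add: random_code_def)
  have sec: "(\<lambda>s. dec s (enc s y)) \<in> S \<rightarrow>\<^sub>M Rn n" if "y \<in> space (Rn n)" for y
    using measurable_compose[OF measurable_Pair[OF measurable_ident measurable_const] dm, of y] that by simp
  have Zm: "(\<lambda>p. dec (snd p) (enc (snd p) (block Y n (fst (fst p))))) \<in> ?W \<rightarrow>\<^sub>M Rn n"
    by (rule code_map_measurable[OF code yv])
  have ZPm: "(\<lambda>p. dec (snd p) (enc (snd p) (block Y n (fst p)))) \<in> P \<Otimes>\<^sub>M S \<rightarrow>\<^sub>M Rn n"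
    by (rule code_map_measurable[OF code Y])
  have fm: "(\<lambda>p. f (fst (fst p)) (dec (snd p) (enc (snd p) (block Y n (fst (fst p)))))) \<in> borel_measurable (?W)"
    using measurable_compose[OF measurable_Pair[OF measurable_compose[OF measurable_fst measurable_fst] Zm] h] by simp
  have fP: "(\<lambda>p. f (fst p) (dec (snd p) (enc (snd p) (block Y n (fst p))))) \<in> borel_measurable (P \<Otimes>\<^sub>M S)"
    using measurable_compose[OF measurable_Pair[OF measurable_fst ZPm] h] by simp
  have im: "(\<lambda>x. \<integral>\<^sup>+s. f (fst x) (dec s (enc s (block Y n (fst x)))) \<partial>S) \<in> borel_measurable ?Q"
    using S.borel_measurable_nn_integral_fst[OF fm] by simp
  have "(\<integral>\<^sup>+p. f (fst (fst p)) (dec (snd p) (enc (snd p) (block Y n (fst (fst p))))) \<partial>(?W))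
    = (\<integral>\<^sup>+x. \<integral>\<^sup>+s. f (fst x) (dec s (enc s (block Y n (fst x)))) \<partial>S \<partial>?Q)"
    using S.nn_integral_fst[OF fm] by simp
  also have "\<dots> = (\<integral>\<^sup>+\<omega>. \<integral>\<^sup>+g. \<integral>\<^sup>+s. f \<omega> (dec s (enc s (block Y n \<omega>))) \<partial>S \<partial>?g \<partial>P)"
    using g.nn_integral_fst[OF im] by simp
  also have "\<dots> = (\<integral>\<^sup>+\<omega>. \<integral>\<^sup>+s. f \<omega> (dec s (enc s (block Y n \<omega>))) \<partial>S \<partial>P)"
    by (simp add: g.emeasure_space_1)
  also have "\<dots> = (\<integral>\<^sup>+\<omega>. \<integral>\<^sup>+z. f \<omega> z \<partial>code_kernel n S enc dec (block Y n \<omega>) \<partial>P)"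
  proof (rule nn_integral_cong)
    fix \<omega> assume w: "\<omega> \<in> space P"
    then have y: "block Y n \<omega> \<in> space (Rn n)" by (rule measurable_space[OF Y])
    have fz: "f \<omega> \<in> borel_measurable (Rn n)"
      using measurable_compose[OF measurable_Pair[OF measurable_const measurable_ident] h, of \<omega>] w by simp
    show "(\<integral>\<^sup>+s. f \<omega> (dec s (enc s (block Y n \<omega>))) \<partial>S) = (\<integral>\<^sup>+z. f \<omega> z \<partial>code_kernel n S enc dec (block Y n \<omega>))"
      unfolding code_kernel_def by (subst nn_integral_distr[OF sec[OF y]]) (use fz in auto)
  qed
  finally show ?thesis ..
qed

text \<open>The signal is compared along the code output and along an independent draw from the
  optimal kernel, generated from a standard Gaussian vector \<open>g\<close>. Both draws see the same
  \<open>(\<theta>, Y)\<close>, so a bound on their squared difference transfers to the risks.\<close>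

lemma risk_gap:
  fixes P :: "'w measure" and S :: "'s measure"
  assumes n: "1 \<le> n" and P: "prob_space P" and T: "polish_metric T"
    and th[measurable]: "th \<in> P \<rightarrow>\<^sub>M metric_borel T" and Yi: "\<And>i. Y i \<in> borel_measurable P"
    and mu: "mu \<in> carrier_vec n" and Sg: "pos_def_mat n Sg" and gauss: "gaussian P n (block Y n) mu Sg"
    and u: "unique_optimal_kernel n (block_law P Y n) D Ks"
    and code: "random_code n M S enc dec" and K: "K = code_kernel n S enc dec"
    and adm: "admissible n (block_law P Y n) D K"
    and \<phi>: "\<phi> \<in> space (Rn n) \<rightarrow> mspace T"
    and fin: "risk T n (signal_block_law P T th Y n) K \<phi> < \<infinity>"
    and lip: "\<And>a b. a \<in> space (Rn n) \<Longrightarrow> b \<in> space (Rn n) \<Longrightarrow> mdist T (\<phi> a) (\<phi> b) \<le> L * ndist n a b"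
    and L: "0 < L" and \<Lambda>: "mat_opnorm Sg \<le> \<Lambda>" "0 < \<Lambda>"
    and div: "relative_entropy (block_law P Y n \<bind> K) (block_law P Y n \<bind> Ks) \<le> ennreal d" and d: "0 \<le> d"
    and \<epsilon>: "0 < \<epsilon>"
  obtains R where "0 \<le> R" "block_rdf n (block_law P Y n) D = ennreal (R / ln 2)"
    "\<bar>enn2ereal (risk T n (signal_block_law P T th Y n) K \<phi>) - enn2ereal (risk T n (signal_block_law P T th Y n) Ks \<phi>)\<bar>
      \<le> ereal (\<epsilon> * enn2real (risk T n (signal_block_law P T th Y n) K \<phi>)
        + (1 + 1 / \<epsilon>) * max 0 (8 * (L\<^sup>2 * \<Lambda> / n) * (ln M + ln 2 * d + ln 2 - R)))"
proof -
  let ?r = "risk T n (signal_block_law P T th Y n) K \<phi>"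
  let ?rs = "risk T n (signal_block_law P T th Y n) Ks \<phi>"
  interpret P: prob_space P by fact
  have Y[measurable]: "block Y n \<in> P \<rightarrow>\<^sub>M Rn n" by (rule block_measurable[OF Yi])
  obtain v l where o: "orthonormal n v" and eig: "\<And>j i. j < n \<Longrightarrow> i < n \<Longrightarrow> matv n Sg (v j) i = l j * v j i"
    and l: "\<And>i. 0 < l i" and lop: "\<And>j. j < n \<Longrightarrow> l j \<le> mat_opnorm Sg"
    using pos_def_spectral[OF Sg] by blast
  define m where "m = vec_index mu"
  have BL: "block_law P Y n = distr (normal_prod n l) (Rn n) (rot n v m)"
    unfolding block_law_def m_def
    by (rule gaussian_eq_rot_normal_prod[OF gauss _ o mu eig l]) (use Sg in \<open>simp add: pos_def_mat_def\<close>)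
  obtain w where wf: "waterfilling n v l w" and nD: "real n * D = (\<Sum>i<n. min (l i) w)"
    using optimal_water_level[OF n o l BL u code] adm K by metis
  interpret waterfilling n v m l w by (rule wf)
  have PYeq: "block_law P Y n = PY" by (simp add: BL PY_def PX_def)
  have nD': "real n * D = (\<Sum>i<n. dd i)" by (simp add: nD dd_def)
  have uP: "unique_optimal_kernel n PY D Ks" using u by (simp add: PYeq)
  have ae: "AE y in PY. Ks y = opt_kernel y" and rdf: "block_rdf n PY D = ennreal (rate / ln 2)"
    by (rule unique_optimal_kernel_eq[OF uP nD'])+
  have Ksm: "Ks \<in> Rn n \<rightarrow>\<^sub>M prob_algebra (Rn n)"
    using uP by (simp add: unique_optimal_kernel_def admissible_def kernels_def)
  have Km: "K \<in> Rn n \<rightarrow>\<^sub>M prob_algebra (Rn n)" using adm by (simp add: admissible_def kernels_def)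
  have KsP: "Ks \<in> PY \<rightarrow>\<^sub>M prob_algebra (Rn n)" using Ksm by (simp add: measurable_cong_sets[OF sets_PY refl])
  have PZeq: "PY \<bind> Ks = PZ"
    unfolding PY_bind_opt_kernel[symmetric]
    by (rule bind_cong_AE[OF refl measurable_prob_algebraD[OF KsP] measurable_prob_algebraD[OF opt_kernel_measurable_PY] ae])
  have thT: "th \<omega> \<in> mspace T" if "\<omega> \<in> space P" for \<omega>
    using measurable_space[OF th that] by (simp add: space_metric_borel)
  have \<phi>T: "\<phi> a \<in> mspace T" if "a \<in> space (Rn n)" for a using \<phi> that by auto
  interpret T: Metric_space "mspace T" "mdist T" by (rule Metric_space_mspace_mdist)
  have dlip: "\<bar>mdist T t (\<phi> a) - mdist T t (\<phi> b)\<bar> \<le> L * ndist n a b"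
    if "t \<in> mspace T" "a \<in> space (Rn n)" "b \<in> space (Rn n)" for t a b
  proof -
    have "mdist T t (\<phi> a) \<le> mdist T t (\<phi> b) + mdist T (\<phi> b) (\<phi> a)"
      "mdist T t (\<phi> b) \<le> mdist T t (\<phi> a) + mdist T (\<phi> a) (\<phi> b)"
      by (intro T.triangle that \<phi>T)+
    then show ?thesis using lip[OF that(2,3)] T.commute[of "\<phi> b" "\<phi> a"] by linarith
  qed
  have qphi: "(\<lambda>a. mdist T q (\<phi> a)) \<in> borel_measurable (Rn n)" if "q \<in> mspace T" for q
    by (rule Lipschitz_measurable_Rn[where L = L]) (use dlip that in auto)
  have qid: "(\<lambda>t. mdist T q t) \<in> borel_measurable (metric_borel T)" if "q \<in> mspace T" for q
    by (rule borel_measurableI_less) (use mball_in_metric_borel[OF that] in \<open>simp add: space_metric_borel\<close>)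
  have hm: "(\<lambda>p. mdist T (fst p) (\<phi> (snd p))) \<in> borel_measurable (metric_borel T \<Otimes>\<^sub>M Rn n)"
    by (rule mdist_measurable[OF T])
      (auto simp: space_pair_measure space_metric_borel intro: \<phi>T measurable_compose[OF measurable_fst qid] measurable_compose[OF measurable_snd qphi])
  define h where "h \<omega> z = mdist T (th \<omega>) (\<phi> z)" for \<omega> z
  have hPm[measurable (raw)]: "(\<lambda>x. h (f x) (g x)) \<in> borel_measurable N"
    if [measurable]: "f \<in> N \<rightarrow>\<^sub>M P" "g \<in> N \<rightarrow>\<^sub>M Rn n" for f g and N :: "'x measure"
  proof -
    have "(\<lambda>x. (th (f x), g x)) \<in> N \<rightarrow>\<^sub>M metric_borel T \<Otimes>\<^sub>M Rn n" by measurable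
    from measurable_compose[OF this hm] show ?thesis by (simp add: h_def)
  qed
  let ?g = "std_gauss_n n"
  interpret g: prob_space ?g by (rule prob_space_std_gauss_n)
  \<comment> \<open>Signal and data come from \<open>P\<close>, the noise of the optimal kernel from
    \<open>?g\<close> and the randomness of the code from \<open>S\<close>, as independent
    factors.\<close>
  let ?Q = "P \<Otimes>\<^sub>M ?g"
  interpret Q: pair_prob_space P ?g ..
  interpret S: prob_space S using code by (simp add: random_code_def)
  interpret W: pair_prob_space ?Q S ..
  let ?W = "?Q \<Otimes>\<^sub>M S"
  note std_gauss_n_sets_Rn[measurable_cong]
  define yv where "yv x = block Y n (fst x)" for x :: "'w \<times> (nat \<Rightarrow> real)"
  have yvm[measurable]: "yv \<in> ?Q \<rightarrow>\<^sub>M Rn n" unfolding yv_def by measurable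
  define Z where "Z = (\<lambda>p. dec (snd p) (enc (snd p) (yv (fst p))))"
  have Zm[measurable]: "Z \<in> ?W \<rightarrow>\<^sub>M Rn n" unfolding Z_def by (rule code_map_measurable[OF code yvm])
  define z' where "z' x = opt_out (yv x) (snd x)" for x
  have z'm[measurable]: "z' \<in> ?Q \<rightarrow>\<^sub>M Rn n" unfolding z'_def by measurable
  \<comment> \<open>The constant of \<open>opt_kernel_concentration\<close>, so that
    \<open>exp F\<close> has mean at most 2 along the optimal kernel.\<close>
  define c where "c = 8 * (L\<^sup>2 * \<Lambda> / n)"
  have c: "0 < c" using n L \<Lambda> by (simp add: c_def)
  define F where "F x z = (h (fst x) z - h (fst x) (z' x))\<^sup>2 / c" for x z
  have PYQ: "PY = distr ?Q (Rn n) yv"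
  proof -
    have "distr ?Q (Rn n) yv = distr (distr ?Q P fst) (Rn n) (block Y n)"
      by (subst distr_distr) (auto simp: yv_def[abs_def] comp_def)
    then show ?thesis using PYeq by (simp add: g.distr_pair_fst block_law_def)
  qed
  have Fm: "(\<lambda>(x, z). F x z) \<in> borel_measurable (?Q \<Otimes>\<^sub>M Rn n)"
    unfolding F_def split_def by measurable
  \<comment> \<open>When \<open>z\<close> is integrated first, the factor \<open>exp Phi\<close>
    turns \<open>PZ\<close> into the optimal kernel at \<open>yv x\<close>. Then \<open>z\<close>
    and \<open>z' x\<close> are two independent draws for the same signal and data, and
    concentration applies for each \<open>\<omega>\<close>.\<close>
  have B: "(\<integral>\<^sup>+z. \<integral>\<^sup>+x. ennreal (exp (Phi (yv x) z + F x z)) \<partial>?Q \<partial>PZ) \<le> ennreal 2"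
  proof -
    interpret PZ: prob_space PZ by (rule prob_PZ)
    interpret QZ: pair_prob_space ?Q PZ ..
    have Fm': "(\<lambda>p. F (fst p) (snd p)) \<in> borel_measurable (?Q \<Otimes>\<^sub>M Rn n)" using Fm by (simp add: split_def)
    note [measurable] = Fm'
    have em: "(\<lambda>p. ennreal (exp (Phi (yv (fst p)) (snd p) + F (fst p) (snd p)))) \<in> borel_measurable (?Q \<Otimes>\<^sub>M PZ)"
      by measurable
    have "(\<integral>\<^sup>+z. \<integral>\<^sup>+x. ennreal (exp (Phi (yv x) z + F x z)) \<partial>?Q \<partial>PZ)
      = (\<integral>\<^sup>+x. \<integral>\<^sup>+z. ennreal (exp (Phi (yv x) z + F x z)) \<partial>PZ \<partial>?Q)"
      by (rule QZ.Fubini') (use em in \<open>simp add: split_def\<close>)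
    also have "\<dots> = (\<integral>\<^sup>+x. \<integral>\<^sup>+g. ennreal (exp (F x (opt_out (yv x) g))) \<partial>?g \<partial>?Q)"
    proof (rule nn_integral_cong)
      fix x assume x: "x \<in> space ?Q"
      have y: "yv x \<in> space (Rn n)" by (rule measurable_space[OF yvm x])
      have Fx[measurable]: "F x \<in> borel_measurable (Rn n)"
        using measurable_compose[OF measurable_Pair[OF measurable_const measurable_ident] Fm, of x] x by simp
      have Px: "(\<lambda>z. ennreal (exp (Phi (yv x) z))) \<in> borel_measurable PZ" using y by measurable
      have "(\<integral>\<^sup>+z. ennreal (exp (Phi (yv x) z + F x z)) \<partial>PZ) = (\<integral>\<^sup>+z. ennreal (exp (Phi (yv x) z)) * ennreal (exp (F x z)) \<partial>PZ)"
        by (simp add: exp_add ennreal_mult)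
      also have "\<dots> = (\<integral>\<^sup>+z. ennreal (exp (F x z)) \<partial>density PZ (\<lambda>z. ennreal (exp (Phi (yv x) z))))"
        by (rule nn_integral_density[symmetric, OF Px]) measurable
      also have "\<dots> = (\<integral>\<^sup>+z. ennreal (exp (F x z)) \<partial>opt_kernel (yv x))"
        by (simp only: opt_kernel_density[OF y])
      also have "\<dots> = (\<integral>\<^sup>+g. ennreal (exp (F x (opt_out (yv x) g))) \<partial>?g)"
        unfolding opt_kernel_def by (rule nn_integral_distr) (use y in measurable)
      finally show "(\<integral>\<^sup>+z. ennreal (exp (Phi (yv x) z + F x z)) \<partial>PZ) = (\<integral>\<^sup>+g. ennreal (exp (F x (opt_out (yv x) g))) \<partial>?g)" .
    qed
    also have "\<dots> = (\<integral>\<^sup>+\<omega>. \<integral>\<^sup>+g'. \<integral>\<^sup>+g. ennreal (exp (F (\<omega>, g') (opt_out (yv (\<omega>, g')) g))) \<partial>?g \<partial>?g \<partial>P)"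
    proof -
      have "(\<lambda>p. (fst p, opt_out (yv (fst p)) (snd p))) \<in> ?Q \<Otimes>\<^sub>M ?g \<rightarrow>\<^sub>M ?Q \<Otimes>\<^sub>M Rn n" by measurable
      from measurable_compose[OF this Fm]
      have [measurable]: "(\<lambda>p. F (fst p) (opt_out (yv (fst p)) (snd p))) \<in> borel_measurable (?Q \<Otimes>\<^sub>M ?g)" by simp
      have "(\<lambda>p. ennreal (exp (F (fst p) (opt_out (yv (fst p)) (snd p))))) \<in> borel_measurable (?Q \<Otimes>\<^sub>M ?g)" by measurable
      from g.borel_measurable_nn_integral_fst[OF this]
      have "(\<lambda>x. \<integral>\<^sup>+g. ennreal (exp (F x (opt_out (yv x) g))) \<partial>?g) \<in> borel_measurable ?Q" by simp
      from g.nn_integral_fst[OF this] show ?thesis by simp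
    qed
    also have "\<dots> \<le> (\<integral>\<^sup>+\<omega>. 2 \<partial>P)"
    proof (rule nn_integral_mono)
      fix \<omega> assume om: "\<omega> \<in> space P"
      have y: "block Y n \<omega> \<in> space (Rn n)" by (rule measurable_space[OF Y om])
      have "(\<integral>\<^sup>+g'. \<integral>\<^sup>+g. ennreal (exp ((h \<omega> (opt_out (block Y n \<omega>) g') - h \<omega> (opt_out (block Y n \<omega>) g))\<^sup>2 / (8 * (L\<^sup>2 * \<Lambda> / n)))) \<partial>?g \<partial>?g) \<le> 2"
      proof (rule opt_kernel_concentration[OF n _ _ L _ \<Lambda>(2) y])
        show "h \<omega> \<in> borel_measurable (Rn n)" unfolding h_def by (rule qphi[OF thT[OF om]])
        show "\<bar>h \<omega> a - h \<omega> b\<bar> \<le> L * ndist n a b" if "a \<in> space (Rn n)" "b \<in> space (Rn n)" for a b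
          unfolding h_def by (rule dlip[OF thT[OF om] that])
        show "l i \<le> \<Lambda>" if "i < n" for i using lop[OF that] \<Lambda>(1) by simp
      qed
      then show "(\<integral>\<^sup>+g'. \<integral>\<^sup>+g. ennreal (exp (F (\<omega>, g') (opt_out (yv (\<omega>, g')) g))) \<partial>?g \<partial>?g) \<le> 2"
        by (simp add: F_def z'_def yv_def c_def power2_commute)
    qed
    also have "\<dots> = 2" by (simp add: P.emeasure_space_1)
    finally show ?thesis by simp
  qed
  have gap: "(\<integral>\<^sup>+p. ennreal (F (fst p) (Z p)) \<partial>?W) \<le> ennreal (ln M + ln 2 * d + ln 2 - rate)"
    unfolding Z_def
  proof (rule code_gap[OF Q.prob_space_axioms yvm PYQ code _ _ prob_PZ sets_PZ _ d Fm _ _ B])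
    show "admissible n PY D (code_kernel n S enc dec)" using adm by (simp add: PYeq K)
    show "real n * D \<le> (\<Sum>i<n. dd i)" using nD' by simp
    show "relative_entropy (PY \<bind> code_kernel n S enc dec) PZ \<le> ennreal d"
      using div by (simp add: PYeq K PZeq)
    show "0 \<le> F x z" for x z using c by (simp add: F_def)
  qed simp
  \<comment> \<open>A negative argument of \<open>ennreal\<close> in \<open>gap\<close> stands for
    0; the maximum makes the real bound agree with this.\<close>
  define \<delta> where "\<delta> = max 0 (c * (ln M + ln 2 * d + ln 2 - rate))"
  define f1 where "f1 p = h (fst (fst p)) (Z p)" for p
  define f2 where "f2 p = h (fst (fst p)) (z' (fst p))" for p :: "('w \<times> (nat \<Rightarrow> real)) \<times> 's"
  have [measurable]: "f1 \<in> borel_measurable ?W" "f2 \<in> borel_measurable ?W"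
    unfolding f1_def f2_def by measurable
  have sq: "(\<integral>\<^sup>+p. ennreal ((f1 p - f2 p)\<^sup>2) \<partial>?W) \<le> ennreal \<delta>"
  proof -
    have e: "ennreal ((f1 p - f2 p)\<^sup>2) = ennreal c * ennreal (F (fst p) (Z p))" for p
      using c by (simp add: F_def f1_def f2_def ennreal_mult[symmetric])
    have Fz: "(\<lambda>p. ennreal (F (fst p) (Z p))) \<in> borel_measurable ?W"
      unfolding F_def by measurable
    have "(\<integral>\<^sup>+p. ennreal ((f1 p - f2 p)\<^sup>2) \<partial>?W) = ennreal c * (\<integral>\<^sup>+p. ennreal (F (fst p) (Z p)) \<partial>?W)"
      unfolding e by (rule nn_integral_cmult[OF Fz])
    also have "\<dots> \<le> ennreal c * ennreal (ln M + ln 2 * d + ln 2 - rate)"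
      by (intro mult_left_mono gap) simp
    also have "\<dots> \<le> ennreal \<delta>"
    proof (cases "0 \<le> ln M + ln 2 * d + ln 2 - rate")
      case True
      then show ?thesis using c by (simp add: \<delta>_def ennreal_mult[symmetric] ennreal_leI)
    next
      case False
      then show ?thesis by (simp add: ennreal_neg)
    qed
    finally show ?thesis .
  qed
  have r1: "?r = (\<integral>\<^sup>+p. ennreal ((f1 p)\<^sup>2) \<partial>?W)"
  proof -
    have "(\<lambda>(\<omega>, z). ennreal ((h \<omega> z)\<^sup>2)) \<in> borel_measurable (P \<Otimes>\<^sub>M Rn n)" unfolding split_def by measurable
    from nn_integral_code_pair[OF P code Y this]
    show ?thesis unfolding risk_eq[OF P T th Y Km hm] by (simp add: K h_def f1_def Z_def yv_def)
  qed
  have r2: "?rs = (\<integral>\<^sup>+p. ennreal ((f2 p)\<^sup>2) \<partial>?W)"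
  proof -
    have aeP: "AE \<omega> in P. Ks (block Y n \<omega>) = opt_kernel (block Y n \<omega>)"
      by (rule AE_distrD[OF Y]) (use ae[unfolded PYeq[symmetric]] in \<open>simp only: block_law_def\<close>)
    have h2m: "(\<lambda>x. ennreal ((h (fst x) (z' x))\<^sup>2)) \<in> borel_measurable ?Q" by measurable
    have "?rs = (\<integral>\<^sup>+\<omega>. \<integral>\<^sup>+z. ennreal ((h \<omega> z)\<^sup>2) \<partial>Ks (block Y n \<omega>) \<partial>P)"
      unfolding risk_eq[OF P T th Y Ksm hm] h_def ..
    also have "\<dots> = (\<integral>\<^sup>+\<omega>. \<integral>\<^sup>+z. ennreal ((h \<omega> z)\<^sup>2) \<partial>opt_kernel (block Y n \<omega>) \<partial>P)"
      using aeP by (intro nn_integral_cong_AE) auto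
    also have "\<dots> = (\<integral>\<^sup>+\<omega>. \<integral>\<^sup>+g. ennreal ((h \<omega> (z' (\<omega>, g)))\<^sup>2) \<partial>?g \<partial>P)"
    proof (rule nn_integral_cong)
      fix \<omega> assume om: "\<omega> \<in> space P"
      then have y: "block Y n \<omega> \<in> space (Rn n)" by (rule measurable_space[OF Y])
      have hz: "h \<omega> \<in> borel_measurable (Rn n)" unfolding h_def by (rule qphi[OF thT[OF om]])
      have out: "opt_out (block Y n \<omega>) \<in> ?g \<rightarrow>\<^sub>M Rn n" using y by measurable
      show "(\<integral>\<^sup>+z. ennreal ((h \<omega> z)\<^sup>2) \<partial>opt_kernel (block Y n \<omega>)) = (\<integral>\<^sup>+g. ennreal ((h \<omega> (z' (\<omega>, g)))\<^sup>2) \<partial>?g)"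
        unfolding opt_kernel_def z'_def yv_def
        by (subst nn_integral_distr[OF out]) (use hz in auto)
    qed
    also have "\<dots> = (\<integral>\<^sup>+x. ennreal ((h (fst x) (z' x))\<^sup>2) \<partial>?Q)"
      using g.nn_integral_fst[OF h2m] by simp
    also have "\<dots> = (\<integral>\<^sup>+x. \<integral>\<^sup>+s. ennreal ((f2 (x, s))\<^sup>2) \<partial>S \<partial>?Q)"
      by (simp add: f2_def S.emeasure_space_1)
    also have "\<dots> = (\<integral>\<^sup>+p. ennreal ((f2 p)\<^sup>2) \<partial>?W)"
      by (rule S.nn_integral_fst) measurable
    finally show ?thesis .
  qed
  have a: "(\<integral>\<^sup>+p. ennreal ((f1 p)\<^sup>2) \<partial>?W) = ennreal (enn2real ?r)"
    using fin r1 by (simp add: ennreal_enn2real_if)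
  have "\<bar>enn2ereal (\<integral>\<^sup>+p. ennreal ((f1 p)\<^sup>2) \<partial>?W) - enn2ereal (\<integral>\<^sup>+p. ennreal ((f2 p)\<^sup>2) \<partial>?W)\<bar>
    \<le> ereal (\<epsilon> * enn2real ?r + (1 + 1 / \<epsilon>) * \<delta>)"
    by (rule square_integral_gap[OF _ _ a _ sq _ \<epsilon>]) (auto simp: \<delta>_def)
  then have "\<bar>enn2ereal ?r - enn2ereal ?rs\<bar>
    \<le> ereal (\<epsilon> * enn2real ?r + (1 + 1 / \<epsilon>) * \<delta>)"
    by (simp only: r1[symmetric] r2[symmetric])
  then show thesis
    by (intro that[OF rate_nonneg]) (simp_all add: PYeq rdf \<delta>_def c_def)
qed

section \<open>Passage to the limit\<close>

theorem theorem2: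
  fixes P :: "'w measure"
    and T :: "nat \<Rightarrow> 't metric"
    and th :: "nat \<Rightarrow> 'w \<Rightarrow> 't"
    and Y :: "nat \<Rightarrow> 'w \<Rightarrow> real"
    and mu :: "nat \<Rightarrow> real vec"
    and Sig :: "nat \<Rightarrow> real mat"
    and D :: real
    and Kstar :: "nat \<Rightarrow> (nat \<Rightarrow> real) \<Rightarrow> (nat \<Rightarrow> real) measure"
    and \<phi> :: "nat \<Rightarrow> (nat \<Rightarrow> real) \<Rightarrow> 't"
    and M :: "nat \<Rightarrow> nat"
    and S :: "nat \<Rightarrow> 's measure"
    and enc :: "nat \<Rightarrow> 's \<Rightarrow> (nat \<Rightarrow> real) \<Rightarrow> nat"
    and dec :: "nat \<Rightarrow> 's \<Rightarrow> nat \<Rightarrow> (nat \<Rightarrow> real)"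
    and K :: "nat \<Rightarrow> (nat \<Rightarrow> real) \<Rightarrow> (nat \<Rightarrow> real) measure"
    and L :: real
  assumes prob: "prob_space P"
    and polish: "\<And>n. n \<ge> 1 \<Longrightarrow> polish_metric (T n)"
    and signal: "\<And>n. n \<ge> 1 \<Longrightarrow> th n \<in> measurable P (metric_borel (T n))"
    and process: "\<And>i. Y i \<in> borel_measurable P"
    and ergodic: "\<And>n. n \<ge> 1 \<Longrightarrow> cond_stationary_ergodic P (metric_borel (T n)) (th n) Y"
    and mean: "\<And>n. n \<ge> 1 \<Longrightarrow> mu n \<in> carrier_vec n"
    and cov: "\<And>n. n \<ge> 1 \<Longrightarrow> pos_def_mat n (Sig n)"
    and gauss: "\<And>n. n \<ge> 1 \<Longrightarrow> gaussian P n (block Y n) (mu n) (Sig n)"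
    and opnorm: "limsup (\<lambda>n. ereal (mat_opnorm (Sig n))) < \<infinity>"
    and A_RD: "\<And>n. n \<ge> 1 \<Longrightarrow> unique_optimal_kernel n (block_law P Y n) D (Kstar n)"
    and code: "\<And>n. n \<ge> 1 \<Longrightarrow> random_code n (M n) (S n) (enc n) (dec n)"
    and code_K: "\<And>n. n \<ge> 1 \<Longrightarrow> K n = code_kernel n (S n) (enc n) (dec n)"
    and code_adm: "\<And>n. n \<ge> 1 \<Longrightarrow> admissible n (block_law P Y n) D (K n)"
    and estimator: "\<And>n. n \<ge> 1 \<Longrightarrow> \<phi> n \<in> space (Rn n) \<rightarrow> mspace (T n)"
    and risk_finite: "\<And>n. n \<ge> 1 \<Longrightarrow>
          risk (T n) n (signal_block_law P (T n) (th n) Y n) (K n) (\<phi> n) < \<infinity>"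
    and risk_bounded:
          "limsup (\<lambda>n. risk (T n) n (signal_block_law P (T n) (th n) Y n) (K n) (\<phi> n)) < \<infinity>"
    and lipschitz: "\<And>n u v. n \<ge> 1 \<Longrightarrow> u \<in> space (Rn n) \<Longrightarrow> v \<in> space (Rn n) \<Longrightarrow>
          mdist (T n) (\<phi> n u) (\<phi> n v) \<le> L * ndist n u v"
    and rate: "(\<lambda>n. ennreal (code_rate n (M n)))
          \<longlonglongrightarrow> rate_distortion (\<lambda>n. block_law P Y n) D"
    and abs_cont: "\<And>n. n \<ge> 1 \<Longrightarrow>
          AE y in block_law P Y n. absolutely_continuous (Kstar n y) (K n y)"
    and output_div: "(\<lambda>n. relative_entropy (block_law P Y n \<bind> K n) (block_law P Y n \<bind> Kstar n)
          / of_nat n) \<longlonglongrightarrow> 0"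
  shows "(\<lambda>n. \<bar>enn2ereal (risk (T n) n (signal_block_law P (T n) (th n) Y n) (K n) (\<phi> n))
            - enn2ereal (risk (T n) n (signal_block_law P (T n) (th n) Y n) (Kstar n) (\<phi> n))\<bar>)
          \<longlonglongrightarrow> 0"
proof -
  define B where "B n = block_law P Y n" for n
  define risk1 where "risk1 n = risk (T n) n (signal_block_law P (T n) (th n) Y n) (K n) (\<phi> n)" for n
  define risk2 where "risk2 n = risk (T n) n (signal_block_law P (T n) (th n) Y n) (Kstar n) (\<phi> n)" for n
  define rel where "rel n = relative_entropy (B n \<bind> K n) (B n \<bind> Kstar n)" for n
  define e where "e n = enn2real (rel n / of_nat n)" for n
  \<comment> \<open>Concentration divides by the Lipschitz constant, so a strictly positive one is
    used.\<close>
  define L' where "L' = \<bar>L\<bar> + 1"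
  have L': "0 < L'" by (simp add: L'_def)
  have lip': "mdist (T n) (\<phi> n a) (\<phi> n b) \<le> L' * ndist n a b"
    if "n \<ge> 1" "a \<in> space (Rn n)" "b \<in> space (Rn n)" for n a b
  proof -
    have "0 \<le> ndist n a b" by (simp add: ndist_def L2_set_nonneg)
    then have "L * ndist n a b \<le> L' * ndist n a b" by (intro mult_right_mono) (auto simp: L'_def)
    then show ?thesis using lipschitz[OF that] by simp
  qed
  obtain \<Lambda>0 where "limsup (\<lambda>n. ereal (mat_opnorm (Sig n))) < ereal \<Lambda>0"
    using ereal_dense2[OF opnorm] by blast
  then have ev\<Lambda>0: "eventually (\<lambda>n. ereal (mat_opnorm (Sig n)) < ereal \<Lambda>0) sequentially"
    by (rule Limsup_lessD)
  define \<Lambda> where "\<Lambda> = max 1 \<Lambda>0"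
  have \<Lambda>: "0 < \<Lambda>" by (simp add: \<Lambda>_def)
  have ev\<Lambda>: "eventually (\<lambda>n. mat_opnorm (Sig n) \<le> \<Lambda>) sequentially"
    using ev\<Lambda>0 by eventually_elim (simp add: \<Lambda>_def)
  \<comment> \<open>A finite bound \<open>C\<close> on the risk of the code for large
    \<open>n\<close>; in the final estimate it multiplies \<open>\<epsilon>\<close>.\<close>
  obtain z where z: "limsup risk1 < z" "z < \<infinity>"
    using dense[OF risk_bounded] unfolding risk1_def by blast
  define C where "C = enn2real z"
  have zC: "z = ennreal C" and C: "0 \<le> C" using z(2) by (auto simp: C_def ennreal_enn2real_if)
  have evC: "eventually (\<lambda>n. risk1 n < ennreal C) sequentially"
    using Limsup_lessD[OF z(1)] by (simp add: zC)
  have div0: "(\<lambda>n. rel n / of_nat n) \<longlonglongrightarrow> 0"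
    using output_div by (simp add: rel_def B_def)
  have e0: "e \<longlonglongrightarrow> 0"
    unfolding e_def by (rule tendsto_enn2real) (use div0 in simp_all)
  have evrel: "eventually (\<lambda>n. rel n / of_nat n < 1) sequentially"
    using div0 by (rule order_tendstoD) simp
  define good where "good n \<longleftrightarrow> n \<ge> 1 \<and> mat_opnorm (Sig n) \<le> \<Lambda> \<and> risk1 n < ennreal C \<and> rel n / of_nat n < 1" for n
  have evgood: "eventually good sequentially"
    using ev\<Lambda> evC evrel eventually_ge_at_top[of 1] by eventually_elim (simp add: good_def)
  \<comment> \<open>The mean-square bound of \<open>risk_gap\<close> at block length
    \<open>n\<close>. Everything is in nats, so the divergence \<open>n * e n\<close>, given in
    bits, carries the factor \<open>ln 2\<close>.\<close>
  define gb where "gb n R = max 0 (8 * (L'\<^sup>2 * \<Lambda> / n) * (ln (M n) + ln 2 * (n * e n) + ln 2 - R))" for n :: nat and R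
  have gap: "\<exists>R\<ge>0. block_rdf n (B n) D = ennreal (R / ln 2) \<and>
      \<bar>enn2ereal (risk1 n) - enn2ereal (risk2 n)\<bar>
      \<le> ereal (\<epsilon> * C + (1 + 1 / \<epsilon>) * gb n R)"
    if good: "good n" and \<epsilon>: "0 < \<epsilon>" for n \<epsilon>
  proof -
    have n: "n \<ge> 1" using good by (simp add: good_def)
    have relfin: "rel n / of_nat n = ennreal (e n)"
      using good unfolding e_def good_def
      by (metis ennreal_enn2real ennreal_one_less_top less_trans)
    have "rel n = of_nat n * (rel n / of_nat n)"
      unfolding ennreal_times_divide mult.commute[of "of_nat n"]
      using n by (intro mult_divide_eq_ennreal[symmetric]) (auto simp: of_nat_less_top less_top)
    also have "\<dots> = ennreal (n * e n)"
      unfolding relfin by (simp add: ennreal_mult e_def ennreal_of_nat_eq_real_of_nat)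
    finally have div: "relative_entropy (block_law P Y n \<bind> K n) (block_law P Y n \<bind> Kstar n) \<le> ennreal (n * e n)"
      by (simp add: rel_def B_def)
    have \<Lambda>n: "mat_opnorm (Sig n) \<le> \<Lambda>" and Cn: "risk1 n < ennreal C" using good by (auto simp: good_def)
    have en: "0 \<le> n * e n" by (simp add: e_def)
    obtain R where R: "0 \<le> R" "block_rdf n (block_law P Y n) D = ennreal (R / ln 2)"
      and bd: "\<bar>enn2ereal (risk1 n) - enn2ereal (risk2 n)\<bar>
        \<le> ereal (\<epsilon> * enn2real (risk1 n) + (1 + 1 / \<epsilon>) * gb n R)"
      using risk_gap[OF n prob polish[OF n] signal[OF n] process mean[OF n] cov[OF n] gauss[OF n] A_RD[OF n]
          code[OF n] code_K[OF n] code_adm[OF n] estimator[OF n] risk_finite[OF n] lip'[OF n] L' \<Lambda>n \<Lambda> div en \<epsilon>]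
      unfolding risk1_def risk2_def gb_def by metis
    have "enn2real (risk1 n) \<le> C" using Cn C by (intro enn2real_leI) auto
    then have "\<epsilon> * enn2real (risk1 n) \<le> \<epsilon> * C" using \<epsilon> by (intro mult_left_mono) auto
    then have "\<bar>enn2ereal (risk1 n) - enn2ereal (risk2 n)\<bar>
        \<le> ereal (\<epsilon> * C + (1 + 1 / \<epsilon>) * gb n R)"
      using bd by (elim order_trans) simp
    with R show ?thesis unfolding B_def by blast
  qed
  \<comment> \<open>The infimum bounds \<open>R\<close> below by \<open>n * ln 2\<close> times the
    rate-distortion value, which is the useful direction because \<open>R\<close> enters
    \<open>gb\<close> with a minus sign.\<close>
  have rd_le: "rate_distortion B D \<le> block_rdf n (B n) D / of_nat n" if "n \<ge> 1" for n
    unfolding rate_distortion_def using that by (intro INF_lower) simp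
  \<comment> \<open>A single block length with a finite value of \<open>block_rdf\<close> makes the
    infimum finite.\<close>
  obtain N where N: "good N" using evgood by (metis eventually_sequentially order_refl)
  define r where "r = enn2real (rate_distortion B D)"
  have rfin: "rate_distortion B D = ennreal r"
  proof -
    obtain R where "block_rdf N (B N) D = ennreal (R / ln 2)" using gap[OF N, of 1] by auto
    moreover have "1 \<le> N" using N by (simp add: good_def)
    ultimately have "rate_distortion B D < \<infinity>"
      using rd_le[of N] by (auto intro: le_less_trans simp: ennreal_divide_eq_top_iff less_top[symmetric] top_unique)
    then show ?thesis by (simp add: r_def ennreal_enn2real_if)
  qed
  \<comment> \<open>The argument of the maximum in \<open>gb\<close> after \<open>R\<close> has been
    replaced by its lower bound, with \<open>ln (M n) / n\<close> written as
    \<open>ln 2 * code_rate n (M n)\<close>.\<close>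
  define u where "u n = 8 * L'\<^sup>2 * \<Lambda> * (ln 2 * (code_rate n (M n) - r) + ln 2 * e n + ln 2 / n)" for n
  have cr: "(\<lambda>n. code_rate n (M n)) \<longlonglongrightarrow> r"
  proof (rule tendsto_ennrealD)
    show "(\<lambda>n. ennreal (code_rate n (M n))) \<longlonglongrightarrow> ennreal r"
      using rate unfolding rfin[symmetric] B_def .
    show "eventually (\<lambda>n. 0 \<le> code_rate n (M n)) sequentially"
      using eventually_ge_at_top[of 1]
    proof eventually_elim
      case (elim n)
      then have "1 \<le> M n" using random_code_size_pos[OF code] by simp
      then show ?case by (simp add: code_rate_def)
    qed
  qed (simp add: r_def)
  have "u \<longlonglongrightarrow> 8 * L'\<^sup>2 * \<Lambda> * (ln 2 * (r - r) + ln 2 * 0 + 0)"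
    unfolding u_def by (intro tendsto_intros cr e0 lim_const_over_n)
  then have u0: "u \<longlonglongrightarrow> 0" by simp
  \<comment> \<open>The summand \<open>1 / n\<close> keeps \<open>v n\<close> strictly positive, so
    that its square root can serve as \<open>\<epsilon>\<close>.\<close>
  define v where "v n = max 0 (u n) + 1 / n" for n
  have v0: "v \<longlonglongrightarrow> 0"
  proof -
    have "(\<lambda>n. max 0 (u n) + 1 / n) \<longlonglongrightarrow> max 0 0 + 0"
      by (intro tendsto_intros u0 lim_const_over_n)
    then show ?thesis by (simp add: v_def[abs_def])
  qed
  define b where "b n = sqrt (v n) * C + v n + sqrt (v n)" for n
  have "b \<longlonglongrightarrow> sqrt 0 * C + 0 + sqrt 0" unfolding b_def by (intro tendsto_intros v0)
  then have b0: "(\<lambda>n. ereal (b n)) \<longlonglongrightarrow> 0" by (simp add: zero_ereal_def)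
  have bound: "\<bar>enn2ereal (risk1 n) - enn2ereal (risk2 n)\<bar> \<le> ereal (b n)" if good: "good n" for n
  proof -
    have n: "n \<ge> 1" using good by (simp add: good_def)
    have v: "0 < v n" using n by (simp add: v_def add_nonneg_pos)
    \<comment> \<open>This choice balances the error terms: \<open>\<epsilon> * C\<close> and
      \<open>v n / \<epsilon> = sqrt (v n)\<close> both tend to 0.\<close>
    define \<epsilon> where "\<epsilon> = sqrt (v n)"
    have \<epsilon>: "0 < \<epsilon>" "\<epsilon> * \<epsilon> = v n" using v by (auto simp: \<epsilon>_def)
    obtain R where R: "0 \<le> R" "block_rdf n (B n) D = ennreal (R / ln 2)"
      and bd: "\<bar>enn2ereal (risk1 n) - enn2ereal (risk2 n)\<bar>
        \<le> ereal (\<epsilon> * C + (1 + 1 / \<epsilon>) * gb n R)"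
      using gap[OF good \<epsilon>(1)] by blast
    have "ennreal r \<le> ennreal (R / ln 2) / of_nat n"
      using rd_le[OF n] R(2) rfin by simp
    also have "\<dots> = ennreal (R / ln 2 / n)"
      using n R(1) by (simp add: ennreal_of_nat_eq_real_of_nat divide_ennreal)
    finally have "r \<le> R / ln 2 / n" using R(1) by (subst (asm) ennreal_le_iff) auto
    then have "ln 2 * r \<le> ln 2 * (R / ln 2 / n)" by (intro mult_left_mono) auto
    then have rR: "ln 2 * r \<le> R / n" by simp
    have "8 * (L'\<^sup>2 * \<Lambda> / n) * (ln (M n) + ln 2 * (n * e n) + ln 2 - R)
      = 8 * L'\<^sup>2 * \<Lambda> * (ln (M n) / n + ln 2 * e n + ln 2 / n - R / n)"
      using n by (simp add: field_simps)
    also have "\<dots> \<le> 8 * L'\<^sup>2 * \<Lambda> * (ln (M n) / n + ln 2 * e n + ln 2 / n - ln 2 * r)"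
      using rR \<Lambda> by (intro mult_left_mono) auto
    also have "\<dots> = u n"
    proof -
      have "ln 2 * (code_rate n (M n) - r) = ln (M n) / n - ln 2 * r"
        by (simp add: code_rate_def log_def right_diff_distrib)
      then show ?thesis unfolding u_def by (intro arg_cong2[of _ _ _ _ "(*)"]) simp_all
    qed
    finally have "gb n R \<le> max 0 (u n)"
      unfolding gb_def by (rule max.mono[OF order_refl])
    also have "\<dots> \<le> v n" by (simp add: v_def)
    finally have "gb n R \<le> v n" .
    then have "(1 + 1 / \<epsilon>) * gb n R \<le> (1 + 1 / \<epsilon>) * v n"
      using \<epsilon>(1) by (intro mult_left_mono) auto
    also have "(1 + 1 / \<epsilon>) * v n = v n + \<epsilon>"
      using \<epsilon> by (simp add: distrib_right flip: \<epsilon>(2))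
    finally show ?thesis
      using bd by (elim order_trans) (simp add: b_def \<epsilon>_def)
  qed
  have "(\<lambda>n. \<bar>enn2ereal (risk1 n) - enn2ereal (risk2 n)\<bar>) \<longlonglongrightarrow> 0"
  proof (rule tendsto_sandwich[OF _ _ tendsto_const b0])
    show "eventually (\<lambda>n. 0 \<le> \<bar>enn2ereal (risk1 n) - enn2ereal (risk2 n)\<bar>) sequentially" by simp
    show "eventually (\<lambda>n. \<bar>enn2ereal (risk1 n) - enn2ereal (risk2 n)\<bar> \<le> ereal (b n)) sequentially"
      using evgood by eventually_elim (rule bound)
  qed
  then show ?thesis unfolding risk1_def risk2_def .
qed

end
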